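(* Let $c$, $k$ and $t$ be positive integers with $c\ge 6$ and $k\ge t+3$. Suppose $\mathcal{F}$ and $\mathcal{G}$ are cross $t$-intersecting subfamilies of $U^{[ck]}_{c,k}$ such that both $|\bigcap_{F\in\mathcal{F}}F|$ and $|\bigcap_{G\in\mathcal{G}}G|$ are less than $t$. If $c\ge 4\log_2 t+7$ or $k\ge 2t+3$, and $|\mathcal{F}||\mathcal{G}|$ takes the maximum value among all such pairs, then one of the following holds: (i) $\mathcal{F}=\mathcal{N}_1(T,L,M)$ and $\mathcal{G}=\mathcal{N}_1(T,M,L)$ for some $T\in U^{[ck]}_{c,t}$ and $L,M\in U^{[ck]}_{c,k-1}$ with $T\subseteq L\cap M$ and $|L\cap M|\ge t+\min\{t,2\}$; (ii) $\mathcal{F}=\mathcal{G}=\mathcal{N}_2(Z)$ for some $Z\in U^{[ck]}_{c,t+2}$; (iii) $\mathcal{F}=\mathcal{N}_3(A_1,A_2,C)$ and $\mathcal{G}=\mathcal{N}_3(B_1,B_2,C)$ for some $A_1=\{e_1,e_2\}$, $A_2=\{e_3,e_4\}$, $B_1=\{e_1,e_3\}$, $B_2=\{e_2,e_4\}$, $C=\{e_1,e_4\}\in U^{[ck]}_{c,2}$. Moreover, if $(k,t)\in\{(4,1),(5,1)\}$, then (i), (ii) or (iii) holds; if $k=t+3$ and $t\ge 2$, then (i) or (ii) holds; if $t+4\le k\le 2t+3$ with $(k,t)\ne(5,1)$, then (ii) holds; if $k\ge 2t+4$, then (i) holds.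
   Context: For positive integers $c,k,\ell$, $U^{[ck]}_{c,\ell}$ denotes the set of all families of $\ell$ pairwise disjoint $c$-subsets ("blocks") of $[ck]$; $U^{[ck]}_{c,k}$ is the set of $c$-uniform partitions of $[ck]$. Members are regarded as sets of blocks: $A\cap B$ is the set of common blocks, $A\subseteq B$ means every block of $A$ is a block of $B$, and $\bigcap_{F\in\mathcal{F}}F$ is the set of blocks common to all members of $\mathcal{F}$. Families $\mathcal{A},\mathcal{B}$ are cross $t$-intersecting if $|A\cap B|\ge t$ for all $A\in\mathcal{A}$, $B\in\mathcal{B}$. For $T\in U^{[ck]}_{c,t}$ and $L,M\in U^{[ck]}_{c,k-1}$ with $T\subseteq L\cap M$: $\mathcal{N}_1(T,L,M)=\{F\in U^{[ck]}_{c,k}: T\subseteq F,\ |F\cap L|\ge t+1\}\cup\{F\in U^{[ck]}_{c,k}: T\not\subseteq F,\ |F\cap M|=k-2\}$. For $Z\in U^{[ck]}_{c,t+2}$: $\mathcal{N}_2(Z)=\{F\in U^{[ck]}_{c,k}: |F\cap Z|\ge t+1\}$. For $c$-subsets $e_1,e_2,e_3,e_4$ of $[ck]$ such that $\{e_1,e_2\},\{e_3,e_4\},\{e_1,e_3\},\{e_2,e_4\},\{e_1,e_4\}$ all lie in $U^{[ck]}_{c,2}$, and $X,Y,W$ among these pairs: $\mathcal{N}_3(X,Y,W)=\{F\in U^{[ck]}_{c,k}: X\subseteq F \text{ or } Y\subseteq F\text{ or } W\subseteq F\}$. *)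

theory Defs
  imports Complex_Main "HOL-Library.Disjoint_Sets"
begin

definition blocks :: "nat \<Rightarrow> nat \<Rightarrow> nat set set" where
  "blocks c k = {e. e \<subseteq> {1..c * k} \<and> card e = c}"

text \<open>The set written \<open>U\<close> with superscript \<open>[ck]\<close> and subscript \<open>c, l\<close>.\<close>

definition U :: "nat \<Rightarrow> nat \<Rightarrow> nat \<Rightarrow> nat set set set" where
  "U c k l = {A. A \<subseteq> blocks c k \<and> disjoint A \<and> card A = l}"

text \<open>The intersection is taken inside the finite set of all blocks, so that the empty family
  has all blocks in common (a bare \<open>\<Inter>{}\<close> is the infinite set \<open>UNIV\<close>, whose \<open>card\<close> is \<open>0\<close>).\<close>

definition common_blocks :: "nat \<Rightarrow> nat \<Rightarrow> nat set set set \<Rightarrow> nat set set" where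
  "common_blocks c k \<F> = blocks c k \<inter> \<Inter>\<F>"

definition cross_intersecting :: "nat \<Rightarrow> 'a set set \<Rightarrow> 'a set set \<Rightarrow> bool" where
  "cross_intersecting t \<A> \<B> \<longleftrightarrow> (\<forall>A\<in>\<A>. \<forall>B\<in>\<B>. t \<le> card (A \<inter> B))"

definition nontrivial_cross_pair ::
    "nat \<Rightarrow> nat \<Rightarrow> nat \<Rightarrow> nat set set set \<Rightarrow> nat set set set \<Rightarrow> bool" where
  "nontrivial_cross_pair c k t \<F> \<G> \<longleftrightarrow>
     \<F> \<subseteq> U c k k \<and> \<G> \<subseteq> U c k k \<and> cross_intersecting t \<F> \<G> \<and>
     card (common_blocks c k \<F>) < t \<and> card (common_blocks c k \<G>) < t"

definition N1 :: "nat \<Rightarrow> nat \<Rightarrow> nat \<Rightarrow> nat set set \<Rightarrow> nat set set \<Rightarrow> nat set set \<Rightarrow> nat set set set" where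
  "N1 c k t T L M =
     {F \<in> U c k k. T \<subseteq> F \<and> t + 1 \<le> card (F \<inter> L)} \<union>
     {F \<in> U c k k. \<not> T \<subseteq> F \<and> card (F \<inter> M) = k - 2}"

definition N2 :: "nat \<Rightarrow> nat \<Rightarrow> nat \<Rightarrow> nat set set \<Rightarrow> nat set set set" where
  "N2 c k t Z = {F \<in> U c k k. t + 1 \<le> card (F \<inter> Z)}"

definition N3 :: "nat \<Rightarrow> nat \<Rightarrow> nat set set \<Rightarrow> nat set set \<Rightarrow> nat set set \<Rightarrow> nat set set set" where
  "N3 c k X Y W = {F \<in> U c k k. X \<subseteq> F \<or> Y \<subseteq> F \<or> W \<subseteq> F}"

definition is_N1_pair ::
    "nat \<Rightarrow> nat \<Rightarrow> nat \<Rightarrow> nat set set set \<Rightarrow> nat set set set \<Rightarrow> bool" where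
  "is_N1_pair c k t \<F> \<G> \<longleftrightarrow>
     (\<exists>T \<in> U c k t. \<exists>L \<in> U c k (k - 1). \<exists>M \<in> U c k (k - 1).
        T \<subseteq> L \<inter> M \<and> t + min t 2 \<le> card (L \<inter> M) \<and>
        \<F> = N1 c k t T L M \<and> \<G> = N1 c k t T M L)"

definition is_N2_pair ::
    "nat \<Rightarrow> nat \<Rightarrow> nat \<Rightarrow> nat set set set \<Rightarrow> nat set set set \<Rightarrow> bool" where
  "is_N2_pair c k t \<F> \<G> \<longleftrightarrow>
     (\<exists>Z \<in> U c k (t + 2). \<F> = N2 c k t Z \<and> \<G> = N2 c k t Z)"

text \<open>Nothing is required of the pair \<open>e2, e3\<close>: these two blocks may meet or even coincide.\<close>

definition is_N3_pair ::
    "nat \<Rightarrow> nat \<Rightarrow> nat set set set \<Rightarrow> nat set set set \<Rightarrow> bool" where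
  "is_N3_pair c k \<F> \<G> \<longleftrightarrow>
     (\<exists>e1 e2 e3 e4.
        {e1, e2} \<in> U c k 2 \<and> {e3, e4} \<in> U c k 2 \<and> {e1, e3} \<in> U c k 2 \<and>
        {e2, e4} \<in> U c k 2 \<and> {e1, e4} \<in> U c k 2 \<and>
        \<F> = N3 c k {e1, e2} {e3, e4} {e1, e4} \<and>
        \<G> = N3 c k {e1, e3} {e2, e4} {e1, e4})"

end

theory Submission
  imports Defs
begin

text \<open>
  Write \<open>m = k - t - 1\<close>, \<open>M = max m (t + 2)\<close>, and let \<open>u\<close> and \<open>v\<close> be the numbers of partitions
  through \<open>t + 1\<close>, respectively \<open>t + 2\<close>, given blocks; the ratio \<open>u / v\<close> is the binomial coefficient
  \<open>(c m - 1) choose (c - 1)\<close>, which the hypotheses make larger than every error term below.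

  A \<open>t\<close>-cover of \<open>\<F>\<close> is a set of disjoint blocks meeting each member of \<open>\<F>\<close> in at least \<open>t\<close>
  blocks; every member of \<open>\<G>\<close> is one, and nontriviality excludes covers with at most \<open>t\<close> blocks. If
  the smallest covers of \<open>\<F>\<close> and \<open>\<G>\<close> have \<open>s\<close> and \<open>s'\<close> blocks, branching over non-covers bounds
  \<open>|\<F>| |\<G>|\<close> by \<open>f s * f s'\<close> for a function \<open>f\<close> that drops so fast that maximality forces
  \<open>s = s' = t + 1\<close>. By maximality the families \<open>\<A>\<close>, \<open>\<B>\<close> of \<open>(t + 1)\<close>-covers are then cross
  \<open>t\<close>-intersecting, and \<open>|\<G>|\<close> and \<open>|\<F>|\<close> are \<open>|\<A>| u\<close> and \<open>|\<B>| u\<close> up to terms of order \<open>v\<close>. Since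
  the constructions achieve about \<open>(M u)\<^sup>2\<close>, we get \<open>|\<A>| |\<B>| \<ge> M\<^sup>2\<close>. As at most \<open>m\<close> covers contain
  a given \<open>t\<close>-set, this leaves only three shapes: all covers share a \<open>t\<close>-set (giving \<open>N1\<close>), they are
  all \<open>(t + 1)\<close>-subsets of a \<open>(t + 2)\<close>-set (giving \<open>N2\<close>), or \<open>t = 1\<close> and they form a pair of
  complementary paths on four blocks (giving \<open>N3\<close>).
\<close>

section \<open>Counting uniform partitions\<close>

text \<open>Counts the partitions of a set of \<open>c * n\<close> points into blocks of size
  \<open>c\<close>: a fixed point chooses its block, the rest recurses. The recursive form exposes
  the ratio of consecutive values, which every estimate below relies on.\<close>

fun npart :: "nat \<Rightarrow> nat \<Rightarrow> nat" where
  "npart c 0 = 1"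
| "npart c (Suc n) = ((c * Suc n - 1) choose (c - 1)) * npart c n"

definition uparts :: "nat \<Rightarrow> 'a set \<Rightarrow> 'a set set set" where
  "uparts c V = {P. partition_on V P \<and> (\<forall>p\<in>P. card p = c)}"

lemma card_subsets_containing:
  assumes "finite V" "x \<in> V" "0 < c"
  shows "card {e. e \<subseteq> V \<and> x \<in> e \<and> card e = c} = (card V - 1) choose (c - 1)"
proof -
  have "{e. e \<subseteq> V \<and> x \<in> e \<and> card e = c} = insert x ` {e. e \<subseteq> V - {x} \<and> card e = c - 1}"
    (is "?L = ?R")
  proof
    show "?L \<subseteq> ?R"
    proof
      fix e assume e: "e \<in> ?L"
      then have "e = insert x (e - {x})" "card (e - {x}) = c - 1" "e - {x} \<subseteq> V - {x}"
        by auto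
      then show "e \<in> ?R" by blast
    qed
    show "?R \<subseteq> ?L"
    proof
      fix e assume "e \<in> ?R"
      then obtain f where f: "e = insert x f" "f \<subseteq> V - {x}" "card f = c - 1" by blast
      then have "finite f" using assms(1) finite_subset by blast
      moreover have "x \<notin> f" using f by blast
      ultimately have "card e = c" using f assms(3) by simp
      then show "e \<in> ?L" using f assms by auto
    qed
  qed
  moreover have "inj_on (insert x) {e. e \<subseteq> V - {x} \<and> card e = c - 1}"
    by (rule inj_onI) (metis (mono_tags, lifting) Diff_insert_absorb insert_absorb
        mem_Collect_eq subset_Diff_insert)
  ultimately show ?thesis
    using assms by (simp add: card_image n_subsets)
qed

text \<open>Fix a point \<open>x\<close>. A partition amounts to the block of \<open>x\<close>
  together with a partition of the remaining points, and the map \<open>?g\<close> from such pairs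
  is injective because only one block contains \<open>x\<close>.\<close>

lemma card_uparts:
  assumes "0 < c" "finite V" "card V = c * n"
  shows "card (uparts c V) = npart c n"
  using assms(2,3)
proof (induction n arbitrary: V)
  case 0
  then have "V = {}" by simp
  then have "uparts c V = {{}}" by (auto simp: uparts_def partition_on_empty)
  then show ?case by simp
next
  case (Suc n)
  from Suc.prems assms(1) have "V \<noteq> {}" by auto
  then obtain x where x: "x \<in> V" by blast
  define E where "E = {e. e \<subseteq> V \<and> x \<in> e \<and> card e = c}"
  have finE: "finite E" unfolding E_def using Suc.prems(1) by simp
  have cardE: "card E = (c * Suc n - 1) choose (c - 1)"
    unfolding E_def using card_subsets_containing[OF Suc.prems(1) x assms(1)] Suc.prems by simp
  let ?g = "\<lambda>(e, P). insert e P"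
  let ?S = "Sigma E (\<lambda>e. uparts c (V - e))"
  have notin: "e \<notin> P" if "e \<in> E" "P \<in> uparts c (V - e)" for e P
    using that by (auto simp: E_def uparts_def partition_on_def)
  have uniq: "p \<in> P \<Longrightarrow> x \<notin> p" if "e \<in> E" "P \<in> uparts c (V - e)" for e P p
    using that by (auto simp: E_def uparts_def partition_on_def)
  have inj: "inj_on ?g ?S"
  proof (rule inj_onI, clarify)
    fix e P e' P' assume a: "e \<in> E" "P \<in> uparts c (V - e)" "e' \<in> E" "P' \<in> uparts c (V - e')"
      and eq: "insert e P = insert e' P'"
    have xe: "x \<in> e" "x \<in> e'" using a by (auto simp: E_def)
    have "e = e'"
    proof (rule ccontr)
      assume "e \<noteq> e'"
      then have "e \<in> P'" using eq by blast
      then show False using uniq[OF a(3,4)] xe by blast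
    qed
    moreover have "P = P'" using eq notin[OF a(1,2)] notin[OF a(3,4)] \<open>e = e'\<close>
      by (metis Diff_insert_absorb)
    ultimately show "e = e' \<and> P = P'" by simp
  qed
  have img: "uparts c V = ?g ` ?S"
  proof
    show "uparts c V \<subseteq> ?g ` ?S"
    proof
      fix Q assume Q: "Q \<in> uparts c V"
      then have "\<Union>Q = V" by (simp add: uparts_def partition_on_def)
      then obtain e where e: "e \<in> Q" "x \<in> e" using x by blast
      have "partition_on V Q" and cq: "\<forall>p\<in>Q. card p = c" using Q by (auto simp: uparts_def)
      then have "partition_on (V - e) (Q - {e})"
        using e(1) \<open>\<Union>Q = V\<close> by (auto simp: partition_on_def disjoint_def)
      then have "Q - {e} \<in> uparts c (V - e)" using cq by (auto simp: uparts_def)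
      moreover have "e \<in> E" using e cq \<open>\<Union>Q = V\<close> by (auto simp: E_def)
      moreover have "Q = ?g (e, Q - {e})" using e by auto
      ultimately show "Q \<in> ?g ` ?S" by blast
    qed
    show "?g ` ?S \<subseteq> uparts c V"
    proof clarify
      fix e P assume e: "e \<in> E" and P: "P \<in> uparts c (V - e)"
      then have "partition_on V (insert e P)"
        by (auto simp: partition_on_def E_def uparts_def disjoint_def)
      then show "insert e P \<in> uparts c V" using e P by (auto simp: uparts_def E_def)
    qed
  qed
  have "card (uparts c (V - e)) = npart c n" if "e \<in> E" for e
  proof (rule Suc.IH)
    show "finite (V - e)" using Suc.prems by simp
    have "finite e" "card e = c" "e \<subseteq> V" using that Suc.prems finite_subset by (auto simp: E_def)
    then show "card (V - e) = c * n" using Suc.prems by (simp add: card_Diff_subset)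
  qed
  moreover have "finite (uparts c (V - e))" for e
  proof -
    have "uparts c (V - e) \<subseteq> Pow (Pow V)" by (auto simp: uparts_def partition_on_def)
    then show ?thesis using Suc.prems(1) finite_subset by (metis finite_Pow_iff)
  qed
  ultimately have "card ?S = card E * npart c n"
    using finE by simp
  then show ?case using img card_image[OF inj] cardE by simp
qed

text \<open>Raising \<open>j\<close> by one multiplies the binomial by
  \<open>(c * (m - 1) + j + 1) / (j + 1)\<close>, which is at least \<open>m\<close> as long as
  \<open>j + 1\<close> does not exceed \<open>c\<close>. The factor 3 comes from the case
  \<open>j = 1\<close>, where \<open>c\<close> is at least 6 and \<open>m\<close> at least
  2.\<close>

lemma binomial_add_ge:
  fixes c m j :: nat
  assumes "6 \<le> c" "2 \<le> m" "1 \<le> j" "j \<le> c - 1"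
  shows "3 * m ^ j \<le> (c * (m - 1) + j) choose j"
  using assms(3,4)
proof (induction j rule: nat_induct_at_least)
  case base
  obtain n where n: "m = n + 2" using assms(2) by (metis add.commute le_Suc_ex)
  have "6 * (n + 1) \<le> c * (n + 1)" using assms(1) by (rule mult_right_mono) simp
  then show ?case by (simp add: n)
next
  case (Suc j)
  obtain n where n: "m = n + 1" using assms(2) by (metis add.commute le_Suc_ex one_le_numeral order.trans)
  let ?b = "c * (m - 1)"
  have "n * Suc j \<le> c * n" using Suc.prems by (metis diff_le_self le_trans mult.commute mult_le_mono1)
  then have "m * Suc j \<le> ?b + Suc j" by (simp add: n)
  have "3 * m ^ Suc j * Suc j = (3 * m ^ j) * (m * Suc j)" by (simp only: power_Suc ac_simps)
  also have "\<dots> \<le> ((?b + j) choose j) * (?b + Suc j)"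
    using Suc \<open>m * Suc j \<le> ?b + Suc j\<close> by (intro mult_mono) auto
  also have "\<dots> = ((?b + Suc j) choose Suc j) * Suc j"
    using Suc_times_binomial_eq[of "?b + j" j] by (simp add: mult.commute)
  finally show ?case by (simp only: mult_le_cancel2)
qed

lemma binomial_ratio_ge:
  fixes c i :: nat
  assumes "6 \<le> c" "2 \<le> i"
  shows "3 * i ^ (c - 1) \<le> (c * i - 1) choose (c - 1)"
proof -
  have "c * (i - 1) + (c - 1) = c * i - 1"
    using assms by (cases i) auto
  then show ?thesis using binomial_add_ge[OF assms, of "c - 1"] assms by auto
qed

section \<open>Sets of disjoint blocks and their extensions\<close>

lemma finite_blocks [simp]: "finite (blocks c k)"
proof -
  have "blocks c k \<subseteq> Pow {1..c * k}" by (auto simp: blocks_def)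
  then show ?thesis by (rule finite_subset) simp
qed

lemma finite_U_member: "A \<in> U c k j \<Longrightarrow> finite A"
  by (metis (no_types, lifting) U_def finite_blocks finite_subset mem_Collect_eq)

lemma finite_U [simp]: "finite (U c k j)"
proof -
  have "U c k j \<subseteq> Pow (blocks c k)" by (auto simp: U_def)
  then show ?thesis by (rule finite_subset) simp
qed

lemma card_U_member: "A \<in> U c k j \<Longrightarrow> card A = j"
  by (simp add: U_def)

lemma U_subset: "A \<in> U c k j \<Longrightarrow> B \<subseteq> A \<Longrightarrow> B \<in> U c k (card B)"
  unfolding U_def by (blast intro: pairwise_subset)

lemma Union_U_subset: "A \<in> U c k j \<Longrightarrow> \<Union>A \<subseteq> {1..c * k}"
  by (auto simp: U_def blocks_def)

lemma card_Union_U: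
  assumes "A \<in> U c k j" shows "card (\<Union>A) = c * j"
proof -
  have fe: "finite e \<and> card e = c" if "e \<in> A" for e
    using that assms by (auto simp: U_def blocks_def intro: finite_subset)
  have "card (\<Union>A) = sum card A"
    using assms fe by (intro card_Union_disjoint) (auto simp: U_def disjoint_def pairwise_def disjnt_def)
  also have "\<dots> = card A * c" using fe by simp
  finally show ?thesis using assms by (simp add: U_def)
qed

lemma U_card_le:
  assumes "A \<in> U c k j" "0 < c" shows "j \<le> k"
proof -
  have "c * j \<le> c * k"
    using card_mono[OF _ Union_U_subset[OF assms(1)]] card_Union_U[OF assms(1)] by simp
  then show ?thesis using assms(2) by simp
qed

lemma U_Union_eq:
  assumes "F \<in> U c k k" shows "\<Union>F = {1..c * k}"
  using Union_U_subset[OF assms] card_Union_U[OF assms] by (intro card_subset_eq) auto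

lemma U_UnI:
  assumes "A \<in> U c k i" "B \<in> U c k j" "\<Union>A \<inter> \<Union>B = {}" "0 < c"
  shows "A \<union> B \<in> U c k (i + j)"
proof -
  have "e \<noteq> {}" if "e \<in> A" for e using that assms(1,4) by (auto simp: U_def blocks_def)
  then have "A \<inter> B = {}" using assms(3) by blast
  then have "card (A \<union> B) = i + j"
    using assms by (simp add: card_Un_disjoint finite_U_member card_U_member)
  moreover have "disjoint (A \<union> B)"
    using assms by (intro disjoint_union) (auto simp: U_def)
  ultimately show ?thesis using assms by (auto simp: U_def)
qed

lemma U_insertD:
  assumes "insert e S \<in> U c k (Suc j)" "S \<in> U c k j"
  shows "e \<notin> S" "e \<inter> \<Union>S = {}" "e \<in> blocks c k"
proof -
  show 1: "e \<notin> S" using assms card_U_member by (metis insert_absorb n_not_Suc_n)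
  show "e \<inter> \<Union>S = {}" using assms(1) 1 by (auto simp: U_def disjoint_def)
  show "e \<in> blocks c k" using assms(1) by (auto simp: U_def)
qed

lemma U_insert_complement:
  assumes "insert e D \<in> U c k k" "e \<notin> D"
  shows "e = {1..c * k} - \<Union>D"
proof -
  have "e \<inter> \<Union>D = {}" using assms by (auto simp: U_def disjoint_def)
  moreover have "e \<union> \<Union>D = {1..c * k}" using U_Union_eq[OF assms(1)] by simp
  ultimately show ?thesis by blast
qed

text \<open>All but one of the blocks of a partition determine the last one, as the complement of
  their union.\<close>

lemma U_eqI:
  assumes F: "F \<in> U c k k" and F': "F' \<in> U c k k" and D: "D \<subseteq> F" "D \<subseteq> F'" "k \<le> card D + 1"
  shows "F = F'"
proof -
  have ext: "\<exists>e. F = insert e D \<and> e \<notin> D" if "F \<in> U c k k" "D \<subseteq> F" "card D \<noteq> k" for F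
  proof -
    have fin: "finite F" "card F = k" using that finite_U_member card_U_member by auto
    then have "D \<subset> F" using that(2,3) by auto
    then obtain e where e: "e \<in> F" "e \<notin> D" by blast
    have "card (insert e D) = card D + 1"
      using e fin that finite_subset by (metis Suc_eq_plus1 card_insert_disjoint)
    then have "insert e D = F" using e fin that D(3) by (intro card_seteq) auto
    then show ?thesis using e by blast
  qed
  show ?thesis
  proof (cases "card D = k")
    case True
    have "D = F" using card_subset_eq[OF finite_U_member[OF F] D(1)] True card_U_member[OF F] by simp
    moreover have "D = F'"
      using card_subset_eq[OF finite_U_member[OF F'] D(2)] True card_U_member[OF F'] by simp
    ultimately show ?thesis by simp
  next
    case False
    obtain e where e: "F = insert e D" "e \<notin> D" using ext[OF F D(1) False] by blast
    obtain e' where e': "F' = insert e' D" "e' \<notin> D" using ext[OF F' D(2) False] by blast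
    have "e = e'"
      using U_insert_complement[of e D c k] U_insert_complement[of e' D c k] e e' F F' by simp
    then show ?thesis using e e' by simp
  qed
qed

text \<open>For disjoint blocks \<open>S\<close> these are the blocks disjoint from all of
  \<open>S\<close>. Members of \<open>S\<close> itself are excluded by the \<open>Suc\<close> in the
  cardinality.\<close>

definition compat :: "nat \<Rightarrow> nat \<Rightarrow> nat set set \<Rightarrow> nat set set" where
  "compat c k S = {e. insert e S \<in> U c k (Suc (card S))}"

lemma compat_Un:
  assumes S: "S \<in> U c k j" and F: "F \<in> U c k l" and c: "0 < c"
  shows "S \<union> (F \<inter> compat c k S) \<in> U c k (j + card (F \<inter> compat c k S))"
proof (rule U_UnI[OF S _ _ c])
  show "F \<inter> compat c k S \<in> U c k (card (F \<inter> compat c k S))" using U_subset[OF F] by blast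
  have "e \<inter> \<Union>S = {}" if "e \<in> compat c k S" for e
    using that U_insertD(2)[OF _ S] card_U_member[OF S] by (auto simp: compat_def)
  then show "\<Union>S \<inter> \<Union>(F \<inter> compat c k S) = {}" by blast
qed

lemma card_compat_le:
  assumes "S \<in> U c k j" "F \<in> U c k l" "0 < c"
  shows "card (F \<inter> compat c k S) \<le> k - j"
  using U_card_le[OF compat_Un[OF assms] assms(3)] by simp

text \<open>With \<open>k - j\<close> compatible blocks, \<open>S\<close> and these blocks would
  form a partition sharing \<open>k - 1\<close> blocks with \<open>F\<close>, hence equal to
  \<open>F\<close>, although \<open>F\<close> misses a block of \<open>S\<close>. Saving this one
  block is what yields the degree bound \<open>m = k - t - 1\<close> in
  \<open>covers_degree\<close>.\<close>

lemma card_compat_less: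
  assumes S: "S \<in> U c k j" and F: "F \<in> U c k k" and c: "0 < c" and i: "card (F \<inter> S) + 1 = j"
  shows "card (F \<inter> compat c k S) < k - j"
proof (rule ccontr)
  let ?X = "F \<inter> compat c k S"
  assume "\<not> ?thesis"
  with card_compat_le[OF S F c] have X: "card ?X = k - j" by simp
  have jk: "j \<le> k" using U_card_le[OF S c] .
  have H: "S \<union> ?X \<in> U c k k" using compat_Un[OF S F c] X jk by simp
  have "S \<inter> ?X = {}" using U_insertD(1)[OF _ S] card_U_member[OF S] by (auto simp: compat_def)
  then have "card ((F \<inter> S) \<union> ?X) = card (F \<inter> S) + card ?X"
    using finite_U_member[OF F] by (intro card_Un_disjoint) auto
  then have "k \<le> card ((F \<inter> S) \<union> ?X) + 1" using X i jk by simp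
  then have "F = S \<union> ?X" by (intro U_eqI[OF F H]) auto
  then have "F \<inter> S = S" by blast
  then show False using i card_U_member[OF S] by simp
qed

section \<open>Partitions through given blocks\<close>

definition star :: "nat \<Rightarrow> nat \<Rightarrow> nat set set \<Rightarrow> nat set set set" where
  "star c k A = {F \<in> U c k k. A \<subseteq> F}"

lemma finite_star [simp]: "finite (star c k A)"
  by (simp add: star_def)

text \<open>The partitions through \<open>A\<close> are \<open>A\<close> together with an arbitrary
  uniform partition of the points outside \<open>A\<close>.\<close>

lemma card_star:
  assumes A: "A \<in> U c k j" and c: "0 < c"
  shows "card (star c k A) = npart c (k - j)"
proof -
  let ?V = "{1..c * k} - \<Union>A"
  have jk: "j \<le> k" using U_card_le[OF A c] .
  have "card ?V = c * (k - j)"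
    using card_Union_U[OF A] Union_U_subset[OF A]
    by (simp add: card_Diff_subset finite_subset diff_mult_distrib2)
  then have cu: "card (uparts c ?V) = npart c (k - j)" by (intro card_uparts c) auto
  have ne: "e \<noteq> {}" if "e \<in> blocks c k" for e using that c by (auto simp: blocks_def)
  have disj: "A \<inter> P = {}" if "P \<in> uparts c ?V" for P
  proof -
    have P: "\<Union>P = ?V" "{} \<notin> P" using that by (auto simp: uparts_def partition_on_def)
    have "p = {}" if "p \<in> A" "p \<in> P" for p
    proof -
      have "p \<subseteq> \<Union>A" "p \<subseteq> ?V" using that P(1) by auto
      then show ?thesis by blast
    qed
    then show ?thesis using P(2) by blast
  qed
  have inj: "inj_on (\<lambda>P. A \<union> P) (uparts c ?V)"
  proof (rule inj_onI)
    fix P P' assume "P \<in> uparts c ?V" "P' \<in> uparts c ?V" and eq: "A \<union> P = A \<union> P'"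
    then have "A \<inter> P = {}" "A \<inter> P' = {}" using disj by auto
    then show "P = P'" using eq by blast
  qed
  have "star c k A = (\<lambda>P. A \<union> P) ` uparts c ?V"
  proof
    show "star c k A \<subseteq> (\<lambda>P. A \<union> P) ` uparts c ?V"
    proof
      fix F assume "F \<in> star c k A"
      then have F: "F \<in> U c k k" "A \<subseteq> F" by (auto simp: star_def)
      have dF: "disjoint F" "F \<subseteq> blocks c k" using F by (auto simp: U_def)
      have "\<Union>(F - A) \<inter> \<Union>A = {}"
      proof -
        have "e \<inter> a = {}" if "e \<in> F - A" "a \<in> A" for e a
          using that dF(1) F(2) disjointD[of F e a] by blast
        then show ?thesis by blast
      qed
      moreover have "\<Union>(F - A) \<union> \<Union>A = {1..c * k}"
        using U_Union_eq[OF F(1)] F(2) by blast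
      ultimately have un: "\<Union>(F - A) = ?V" by blast
      have "disjoint (F - A)" using dF(1) by (rule pairwise_subset) blast
      moreover have "{} \<notin> F - A" using dF(2) ne by blast
      moreover have "\<forall>p\<in>F - A. card p = c" using dF(2) by (auto simp: blocks_def)
      ultimately have "F - A \<in> uparts c ?V"
        using un by (simp add: uparts_def partition_on_def)
      moreover have "F = A \<union> (F - A)" using F by blast
      ultimately show "F \<in> (\<lambda>P. A \<union> P) ` uparts c ?V" by blast
    qed
    show "(\<lambda>P. A \<union> P) ` uparts c ?V \<subseteq> star c k A"
    proof clarify
      fix P assume P: "P \<in> uparts c ?V"
      then have un: "\<Union>P = ?V" and cp: "\<And>p. p \<in> P \<Longrightarrow> card p = c" and dj: "disjoint P"
        by (auto simp: uparts_def partition_on_def)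
      have "P \<subseteq> blocks c k"
      proof
        fix p assume "p \<in> P"
        then have "p \<subseteq> ?V" "card p = c" using un cp by auto
        then show "p \<in> blocks c k" by (auto simp: blocks_def)
      qed
      then have PU: "P \<in> U c k (card P)" using dj by (simp add: U_def)
      have "c * card P = c * (k - j)" using card_Union_U[OF PU] un \<open>card ?V = c * (k - j)\<close> by simp
      then have "card P = k - j" using c by simp
      moreover have "\<Union>A \<inter> \<Union>P = {}" using un by blast
      ultimately have "A \<union> P \<in> U c k k" using U_UnI[OF A PU _ c] jk by simp
      then show "A \<union> P \<in> star c k A" by (simp add: star_def)
    qed
  qed
  then show ?thesis using card_image[OF inj] cu by simp
qed

lemma star_nonempty_U:
  assumes "F \<in> star c k A" shows "A \<in> U c k (card A)"
  using assms U_subset unfolding star_def by blast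

lemma card_star_insert_le:
  assumes "S \<in> U c k j" "e \<notin> S" "0 < c"
  shows "card (star c k (insert e S)) \<le> npart c (k - Suc j)"
proof (cases "star c k (insert e S) = {}")
  case False
  then obtain F where "F \<in> star c k (insert e S)" by blast
  then have "insert e S \<in> U c k (Suc j)"
    using star_nonempty_U[of F c k "insert e S"] assms finite_U_member[OF assms(1)]
    by (simp add: card_U_member)
  then show ?thesis using card_star assms by simp
qed simp

section \<open>Growth of the partition counts\<close>

lemma npart_pos: "0 < npart c n"
proof (induction n)
  case (Suc n)
  have "c - 1 \<le> c * Suc n - 1" by (cases c) auto
  then show ?case using Suc by simp
qed simp

lemma npart_Suc_ge:
  assumes "6 \<le> c" "2 \<le> i"
  shows "3 * i ^ (c - 1) * npart c (i - 1) \<le> npart c i"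
  using binomial_ratio_ge[OF assms] assms by (cases i) auto

lemma npart_mono: "i \<le> j \<Longrightarrow> npart c i \<le> npart c j"
proof (induction j)
  case (Suc j)
  have "npart c j \<le> npart c (Suc j)"
  proof -
    have "c - 1 \<le> c * Suc j - 1" by (cases c) auto
    then have "1 \<le> (c * Suc j - 1) choose (c - 1)" by (simp add: Suc_le_eq)
    then show ?thesis by simp
  qed
  then show ?case using Suc le_trans by (metis le_SucE order_refl)
qed simp

lemma npart_ge_96:
  assumes "6 \<le> c" "2 \<le> i"
  shows "96 * npart c (i - 1) \<le> npart c i"
proof -
  \<comment> \<open>The constant is \<open>96 = 3 * 2 ^ 5\<close>, with exponent
    \<open>c - 1\<close> at least 5.\<close>
  have "(2::nat) ^ 5 \<le> i ^ 5" using assms by (intro power_mono) auto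
  also have "\<dots> \<le> i ^ (c - 1)" using assms by (intro power_increasing) auto
  finally have "96 \<le> 3 * i ^ (c - 1)" by simp
  then show ?thesis using npart_Suc_ge[OF assms] by (meson le_trans mult_le_mono1)
qed

text \<open>A union bound: a partition through \<open>S\<close> that meets \<open>E\<close> does so
  in a block compatible with \<open>S\<close>, and each such block spoils at most
  \<open>npart c (k - Suc j)\<close> partitions.\<close>

lemma star_avoiding:
  assumes S: "S \<in> U c k j" and c: "0 < c" and E: "finite E" "E \<inter> S = {}"
    and lt: "card (E \<inter> compat c k S) * npart c (k - Suc j) < npart c (k - j)"
  obtains F where "F \<in> star c k S" "F \<inter> E = {}"
proof -
  let ?E = "E \<inter> compat c k S"
  have "card (\<Union>e\<in>?E. star c k (insert e S)) \<le> (\<Sum>e\<in>?E. card (star c k (insert e S)))"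
    using E by (intro card_UN_le) auto
  also have "\<dots> \<le> (\<Sum>e\<in>?E. npart c (k - Suc j))"
    using E by (intro sum_mono card_star_insert_le[OF S _ c]) auto
  also have "\<dots> < card (star c k S)" using lt card_star[OF S c] by simp
  finally have "\<not> star c k S \<subseteq> (\<Union>e\<in>?E. star c k (insert e S))"
    using E by (metis (no_types, lifting) card_mono finite_Int finite_UN_I finite_star leD)
  then obtain F where F: "F \<in> star c k S" "\<And>e. e \<in> ?E \<Longrightarrow> F \<notin> star c k (insert e S)" by blast
  have "F \<inter> E = {}"
  proof (rule ccontr)
    assume "F \<inter> E \<noteq> {}"
    then obtain e where e: "e \<in> F" "e \<in> E" by blast
    have m: "F \<in> star c k (insert e S)" using F(1) e by (auto simp: star_def)
    have "insert e S \<in> U c k (Suc (card S))"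
      using star_nonempty_U[OF m] e E finite_U_member[OF S] by (metis card_insert_disjoint disjoint_iff)
    then have "e \<in> ?E" using e by (simp add: compat_def)
    then show False using F(2) m by blast
  qed
  then show ?thesis using F that by blast
qed

section \<open>Cross intersecting families of \<open>(t + 1)\<close>-sets\<close>

lemma Diff_subset_of_large_Int:
  assumes "finite A" "card A = t + 1" "t \<le> card (A \<inter> B)" "x \<in> A" "x \<notin> B"
  shows "A - {x} \<subseteq> B"
proof -
  have "A \<inter> B = A - {x}"
    using assms by (intro card_seteq) auto
  then show ?thesis by blast
qed

text \<open>To be instantiated with the covers of \<open>\<F>\<close> and of \<open>\<G>\<close>
  that have \<open>t + 1\<close> blocks. What is needed of the blocks is captured by the cross
  intersection and the degree bound \<open>m\<close>, so the elements are left abstract.\<close>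

locale cross_pair =
  fixes \<A> \<B> :: "'a set set" and t m :: nat
  assumes t_pos: "1 \<le> t"
    and fin: "finite \<A>" "finite \<B>"
    and ne: "\<A> \<noteq> {}" "\<B> \<noteq> {}"
    and A: "\<And>A. A \<in> \<A> \<Longrightarrow> finite A" "\<And>A. A \<in> \<A> \<Longrightarrow> card A = t + 1"
    and B: "\<And>B. B \<in> \<B> \<Longrightarrow> finite B" "\<And>B. B \<in> \<B> \<Longrightarrow> card B = t + 1"
    and cross: "\<And>A B. A \<in> \<A> \<Longrightarrow> B \<in> \<B> \<Longrightarrow> t \<le> card (A \<inter> B)"
    and degA: "\<And>T. card T = t \<Longrightarrow> card {A \<in> \<A>. T \<subseteq> A} \<le> m"
    and degB: "\<And>T. card T = t \<Longrightarrow> card {B \<in> \<B>. T \<subseteq> B} \<le> m"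
begin

lemma swap: "cross_pair \<B> \<A> t m"
proof
  show "t \<le> card (B' \<inter> A')" if "B' \<in> \<B>" "A' \<in> \<A>" for A' B'
    using cross[OF that(2,1)] by (simp add: Int_commute)
qed (use t_pos fin ne A B degA degB in auto)

lemma missA: "A \<in> \<A> \<Longrightarrow> B \<in> \<B> \<Longrightarrow> x \<in> A \<Longrightarrow> x \<notin> B \<Longrightarrow> A - {x} \<subseteq> B"
  using Diff_subset_of_large_Int[OF A(1) A(2)] cross by blast

lemma missB: "A \<in> \<A> \<Longrightarrow> B \<in> \<B> \<Longrightarrow> x \<in> B \<Longrightarrow> x \<notin> A \<Longrightarrow> B - {x} \<subseteq> A"
  using Diff_subset_of_large_Int[OF B(1) B(2)] cross by (metis Int_commute)

text \<open>Every member of \<open>\<A>\<close> contains all but at most one element of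
  \<open>B0\<close>; each of the \<open>t + 1\<close> subsets of size \<open>t\<close> lies in at
  most \<open>m\<close> members.\<close>

lemma card_le_singleton:
  assumes "\<B> = {B0}"
  shows "card \<A> \<le> (t + 1) * m"
proof -
  have B0: "B0 \<in> \<B>" "finite B0" "card B0 = t + 1" using assms B by auto
  have "\<A> \<subseteq> (\<Union>x\<in>B0. {A \<in> \<A>. B0 - {x} \<subseteq> A})"
  proof
    fix A assume A': "A \<in> \<A>"
    have "B0 \<noteq> {}" using B0 by auto
    then obtain x where "x \<in> B0" "B0 - {x} \<subseteq> A"
      using missB[OF A' B0(1)] by (cases "B0 \<subseteq> A") auto
    then show "A \<in> (\<Union>x\<in>B0. {A \<in> \<A>. B0 - {x} \<subseteq> A})" using A' by blast
  qed
  then have "card \<A> \<le> card (\<Union>x\<in>B0. {A \<in> \<A>. B0 - {x} \<subseteq> A})"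
    using B0 fin by (intro card_mono) auto
  also have "\<dots> \<le> (\<Sum>x\<in>B0. card {A \<in> \<A>. B0 - {x} \<subseteq> A})"
    by (rule card_UN_le[OF B0(2)])
  also have "\<dots> \<le> (\<Sum>x\<in>B0. m)"
    using B0 by (intro sum_mono degA) auto
  finally show ?thesis using B0 by simp
qed

text \<open>Members through the common \<open>t\<close>-set number at most \<open>m\<close>. One
  that misses \<open>x\<close> in it must contain the other \<open>t + 1\<close> elements of the
  union and so equals that set, which leaves one possibility for each of the \<open>t\<close>
  choices of \<open>x\<close>.\<close>

lemma card_le_of_close:
  assumes A1: "A1 \<in> \<A>" and A2: "A2 \<in> \<A>" and I: "card (A1 \<inter> A2) = t"
  shows "card \<B> \<le> m + t"
proof -
  let ?I = "A1 \<inter> A2"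
  have fI: "finite ?I" using A A1 by simp
  have un: "card (A1 \<union> A2) = t + 2"
    using card_Un_Int[OF A(1)[OF A1] A(1)[OF A2]] A(2) A1 A2 I by simp
  have "\<B> \<subseteq> {B \<in> \<B>. ?I \<subseteq> B} \<union> (\<lambda>x. (A1 \<union> A2) - {x}) ` ?I"
  proof
    fix B assume B': "B \<in> \<B>"
    show "B \<in> {B \<in> \<B>. ?I \<subseteq> B} \<union> (\<lambda>x. (A1 \<union> A2) - {x}) ` ?I"
    proof (cases "?I \<subseteq> B")
      case False
      then obtain x where x: "x \<in> ?I" "x \<notin> B" by blast
      then have "(A1 \<union> A2) - {x} \<subseteq> B" using missA B' A1 A2 by blast
      moreover have "card ((A1 \<union> A2) - {x}) = t + 1" using un x by simp
      ultimately have "(A1 \<union> A2) - {x} = B" using B B' by (metis card_subset_eq)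
      then show ?thesis using x by blast
    qed (use B' in auto)
  qed
  then have "card \<B> \<le> card ({B \<in> \<B>. ?I \<subseteq> B} \<union> (\<lambda>x. (A1 \<union> A2) - {x}) ` ?I)"
    using fI fin by (intro card_mono) auto
  also have "\<dots> \<le> card {B \<in> \<B>. ?I \<subseteq> B} + card ((\<lambda>x. (A1 \<union> A2) - {x}) ` ?I)"
    by (rule card_Un_le)
  also have "\<dots> \<le> m + t"
    using degB[OF I] card_image_le[OF fI, of "\<lambda>x. (A1 \<union> A2) - {x}"] I by simp
  finally show ?thesis .
qed

text \<open>\<open>B\<close> has \<open>t + 1\<close> elements and meets both sets in at least
  \<open>t\<close>, so it has at least \<open>2 * t - (t + 1) = t - 1\<close> elements in common
  with both. As the intersection has fewer than \<open>t\<close> elements, it has exactly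
  \<open>t - 1\<close>, all in \<open>B\<close>.\<close>

lemma far_core:
  assumes A1: "A1 \<in> \<A>" and A2: "A2 \<in> \<A>" and I: "card (A1 \<inter> A2) < t" and B': "B \<in> \<B>"
  shows "card (A1 \<inter> A2) + 1 = t" "A1 \<inter> A2 \<subseteq> B"
proof -
  have fB: "finite B" using B B' by simp
  have "card (B \<inter> A1) + card (B \<inter> A2) = card (B \<inter> A1 \<union> B \<inter> A2) + card (B \<inter> A1 \<inter> (B \<inter> A2))"
    using fB by (intro card_Un_Int) auto
  moreover have "card (B \<inter> A1 \<union> B \<inter> A2) \<le> t + 1"
    using card_mono[OF fB, of "B \<inter> A1 \<union> B \<inter> A2"] B(2)[OF B'] by auto
  moreover have "t \<le> card (B \<inter> A1)" "t \<le> card (B \<inter> A2)"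
    using cross A1 A2 B' by (metis Int_commute)+
  ultimately have ge: "t \<le> card (B \<inter> A1 \<inter> (B \<inter> A2)) + 1" by linarith
  have fI: "finite (A1 \<inter> A2)" using A A1 by simp
  have sub: "B \<inter> A1 \<inter> (B \<inter> A2) \<subseteq> A1 \<inter> A2" by blast
  have le: "card (B \<inter> A1 \<inter> (B \<inter> A2)) \<le> card (A1 \<inter> A2)" using card_mono[OF fI sub] .
  show "card (A1 \<inter> A2) + 1 = t" using ge le I by simp
  then have "B \<inter> A1 \<inter> (B \<inter> A2) = A1 \<inter> A2" using ge le by (intro card_seteq[OF fI sub]) simp
  then show "A1 \<inter> A2 \<subseteq> B" by blast
qed

text \<open>\<open>D\<close> uses up \<open>t - 1\<close> elements of \<open>B\<close>. The two left
  must meet both tails, the pair \<open>x1, x2\<close> and the pair \<open>y1, y2\<close>, so there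
  is one from each.\<close>

lemma far_B:
  assumes A1: "insert x1 (insert x2 D) \<in> \<A>" and A2: "insert y1 (insert y2 D) \<in> \<A>"
    and d: "distinct [x1, x2, y1, y2]" "{x1, x2, y1, y2} \<inter> D = {}" "card D + 1 = t"
    and B': "B \<in> \<B>"
  shows "B \<in> {insert x1 (insert y1 D), insert x1 (insert y2 D),
              insert x2 (insert y1 D), insert x2 (insert y2 D)}"
proof -
  let ?A1 = "insert x1 (insert x2 D)" and ?A2 = "insert y1 (insert y2 D)"
  have fD: "finite D" using A(1)[OF A1] by simp
  have ID: "?A1 \<inter> ?A2 = D" using d by auto
  then have DB: "D \<subseteq> B" using far_core(2)[OF A1 A2 _ B'] d(3) by simp
  have "\<exists>x\<in>{x1, x2}. x \<in> B"
  proof (rule ccontr)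
    assume "\<not> ?thesis"
    then have "?A1 \<inter> B \<subseteq> D" by blast
    then show False using cross[OF A1 B'] card_mono[OF fD, of "?A1 \<inter> B"] d(3) by simp
  qed
  then obtain x where x: "x \<in> {x1, x2}" "x \<in> B" by blast
  have "\<exists>y\<in>{y1, y2}. y \<in> B"
  proof (rule ccontr)
    assume "\<not> ?thesis"
    then have "?A2 \<inter> B \<subseteq> D" by blast
    then show False using cross[OF A2 B'] card_mono[OF fD, of "?A2 \<inter> B"] d(3) by simp
  qed
  then obtain y where y: "y \<in> {y1, y2}" "y \<in> B" by blast
  have "card (insert x (insert y D)) = t + 1" using x y d fD by auto
  moreover have "insert x (insert y D) \<subseteq> B" using x y DB by blast
  ultimately have "insert x (insert y D) = B" using B B' by (metis card_subset_eq)
  then show ?thesis using x(1) y(1) by auto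
qed

lemma far_obtain:
  assumes A1: "A1 \<in> \<A>" and A2: "A2 \<in> \<A>" and I: "card (A1 \<inter> A2) < t"
  obtains D x1 x2 y1 y2 where "A1 = insert x1 (insert x2 D)" "A2 = insert y1 (insert y2 D)"
    "distinct [x1, x2, y1, y2]" "{x1, x2, y1, y2} \<inter> D = {}" "card D + 1 = t"
proof -
  let ?D = "A1 \<inter> A2"
  obtain B where "B \<in> \<B>" using ne by blast
  then have D: "card ?D + 1 = t" using far_core(1)[OF A1 A2 I] by blast
  have fD: "finite ?D" using A A1 by simp
  have "card (A1 - ?D) = 2" using A A1 D fD by (simp add: card_Diff_subset)
  then obtain x1 x2 where x: "A1 - ?D = {x1, x2}" "x1 \<noteq> x2" by (meson card_2_iff)
  have "card (A2 - ?D) = 2" using A A2 D fD by (simp add: card_Diff_subset)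
  then obtain y1 y2 where y: "A2 - ?D = {y1, y2}" "y1 \<noteq> y2" by (meson card_2_iff)
  show ?thesis
  proof (rule that[of x1 x2 ?D y1 y2])
    show "A1 = insert x1 (insert x2 ?D)" "A2 = insert y1 (insert y2 ?D)" using x y by blast+
    show "distinct [x1, x2, y1, y2]" "{x1, x2, y1, y2} \<inter> ?D = {}" using x y by auto
  qed (use D in simp)
qed

lemma card_B_le_of_two:
  assumes A1: "A1 \<in> \<A>" and A2: "A2 \<in> \<A>" and "A1 \<noteq> A2"
  shows "card \<B> \<le> max 4 (m + t)"
proof (cases "card (A1 \<inter> A2) < t")
  case True
  then obtain D x1 x2 y1 y2 where *: "A1 = insert x1 (insert x2 D)" "A2 = insert y1 (insert y2 D)"
    "distinct [x1, x2, y1, y2]" "{x1, x2, y1, y2} \<inter> D = {}" "card D + 1 = t"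
    by (rule far_obtain[OF A1 A2])
  let ?L = "[insert x1 (insert y1 D), insert x1 (insert y2 D),
              insert x2 (insert y1 D), insert x2 (insert y2 D)]"
  have "\<B> \<subseteq> set ?L" using far_B[of x1 x2 D y1 y2] A1 A2 * by auto
  then have "card \<B> \<le> card (set ?L)" by (intro card_mono) auto
  also have "\<dots> \<le> 4" using card_length[of ?L] by simp
  finally show ?thesis by simp
next
  case False
  have "card (A1 \<inter> A2) \<noteq> t + 1"
    using A A1 A2 assms(3) by (metis card_subset_eq inf_le1 inf_le2)
  moreover have "card (A1 \<inter> A2) \<le> t + 1"
    using A A1 by (metis card_mono inf_le1)
  ultimately have "card (A1 \<inter> A2) = t" using False by simp
  then show ?thesis using card_le_of_close[OF A1 A2] by simp
qed

text \<open>Two far members of \<open>\<B>\<close> restrict \<open>\<A>\<close> to four candidates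
  just as two far members of \<open>\<A>\<close> restrict \<open>\<B>\<close>; the third known
  member of \<open>\<B>\<close> excludes one of them. Up to the common part \<open>D\<close> the
  candidates are edges on four points, and complementary edges cannot face each other.\<close>

lemma far_three:
  assumes A1: "insert x1 (insert x2 D) \<in> \<A>" and A2: "insert y1 (insert y2 D) \<in> \<A>"
    and d: "distinct [x1, x2, y1, y2]" "{x1, x2, y1, y2} \<inter> D = {}" "card D + 1 = t"
    and b: "insert x1 (insert y1 D) \<in> \<B>" "insert x2 (insert y2 D) \<in> \<B>"
      "insert x1 (insert y2 D) \<in> \<B>"
    and M: "(max m (t + 2)) ^ 2 \<le> card \<A> * card \<B>"
  shows "t = 1 \<and> m \<le> 3 \<and> D = {} \<and> \<A> = {{x1, x2}, {x1, y2}, {y1, y2}} \<and>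
    \<B> = {{x1, y1}, {x2, y2}, {x1, y2}}"
proof -
  interpret sw: cross_pair \<B> \<A> t m by (rule swap)
  have fD: "finite D" using A(1)[OF A1] by simp
  have subA: "\<A> \<subseteq> set [insert x1 (insert x2 D), insert x1 (insert y2 D), insert y1 (insert y2 D)]"
  proof
    fix A assume A': "A \<in> \<A>"
    have "A \<in> {insert x1 (insert x2 D), insert x1 (insert y2 D),
              insert y1 (insert x2 D), insert y1 (insert y2 D)}"
      using sw.far_B[of x1 y1 D x2 y2 A] b d A' by auto
    moreover have "A \<noteq> insert y1 (insert x2 D)"
    proof
      assume "A = insert y1 (insert x2 D)"
      then have "A \<inter> insert x1 (insert y2 D) = D" using d by auto
      then show False using cross[OF A' b(3)] d(3) by simp
    qed
    ultimately show "A \<in> set [insert x1 (insert x2 D), insert x1 (insert y2 D), insert y1 (insert y2 D)]"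
      by auto
  qed
  have "card \<A> \<le> card (set [insert x1 (insert x2 D), insert x1 (insert y2 D), insert y1 (insert y2 D)])"
    using subA by (intro card_mono) auto
  also have "\<dots> \<le> 3" using card_length[of "[insert x1 (insert x2 D), insert x1 (insert y2 D), insert y1 (insert y2 D)]"] by simp
  finally have cA: "card \<A> \<le> 3" .
  have subB: "\<B> \<subseteq> set [insert x1 (insert y1 D), insert x1 (insert y2 D),
              insert x2 (insert y1 D), insert x2 (insert y2 D)]" (is "_ \<subseteq> set ?L")
    using far_B[OF A1 A2 d] by auto
  have "card \<B> \<le> card (set ?L)" using subB by (intro card_mono) auto
  also have "\<dots> \<le> 4" using card_length[of ?L] by simp
  finally have cB: "card \<B> \<le> 4" .
  have prod: "card \<A> * card \<B> \<le> 3 * 4" using mult_mono[OF cA cB] by simp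
  \<comment> \<open>The product is at most 12, below the square of 4. Afterwards it must reach 9,
    which two members on the left and four on the right cannot provide.\<close>
  have "max m (t + 2) < 4"
  proof (rule ccontr)
    assume "\<not> ?thesis"
    then have "4 ^ 2 \<le> (max m (t + 2)) ^ 2" by (intro power_mono) auto
    then show False using M prod by simp
  qed
  then have t1: "t = 1" and m3: "m \<le> 3" using t_pos by auto
  then have D0: "D = {}" using d(3) fD by simp
  have "max m (t + 2) = 3" using t1 m3 by simp
  then have nine: "9 \<le> card \<A> * card \<B>" using M by simp
  have "card \<A> = 3"
  proof (rule ccontr)
    assume "card \<A> \<noteq> 3"
    then have "card \<A> * card \<B> \<le> 2 * 4" using cA cB by (intro mult_mono) auto
    then show False using nine by simp
  qed
  have AA: "\<A> = {{x1, x2}, {x1, y2}, {y1, y2}}"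
  proof (rule card_seteq)
    show "\<A> \<subseteq> {{x1, x2}, {x1, y2}, {y1, y2}}" using subA D0 by auto
    have "card {{x1, x2}, {x1, y2}, {y1, y2}} \<le> 3"
      by (simp add: card_insert_if)
    then show "card {{x1, x2}, {x1, y2}, {y1, y2}} \<le> card \<A>" using \<open>card \<A> = 3\<close> by simp
  qed simp
  have "{x2, y1} \<notin> \<B>"
  proof
    assume "{x2, y1} \<in> \<B>"
    then have "t \<le> card ({x1, y2} \<inter> {x2, y1})" using cross AA by blast
    moreover have "{x1, y2} \<inter> {x2, y1} = {}" using d by auto
    ultimately show False using t1 by simp
  qed
  then have "\<B> = {{x1, y1}, {x2, y2}, {x1, y2}}" using subB b D0 by auto
  then show ?thesis using t1 m3 D0 AA by blast
qed

text \<open>Three distinct \<open>(t + 1)\<close>-subsets of \<open>Z\<close> have only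
  \<open>t - 1\<close> common elements. An element of \<open>B\<close> outside \<open>Z\<close>
  would force its other \<open>t\<close> elements into all three.\<close>

lemma subset_of_triangle:
  assumes Z: "finite Z" "card Z = t + 2"
    and A1: "A1 \<in> \<A>" "A2 \<in> \<A>" "A3 \<in> \<A>" "A1 \<noteq> A2" "A1 \<noteq> A3" "A2 \<noteq> A3"
    and sub: "A1 \<subseteq> Z" "A2 \<subseteq> Z" "A3 \<subseteq> Z" and B': "B \<in> \<B>"
  shows "B \<subseteq> Z"
proof (rule ccontr)
  assume "\<not> B \<subseteq> Z"
  then obtain b where b: "b \<in> B" "b \<notin> Z" by blast
  have "B - {b} \<subseteq> A1 \<inter> A2 \<inter> A3" using missB[OF _ B' b(1)] b(2) A1 sub by blast
  moreover have "card (B - {b}) = t" using B B' b by simp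
  ultimately have ge: "t \<le> card (A1 \<inter> A2 \<inter> A3)"
    using A(1)[OF A1(1)] by (metis card_mono finite_Int)
  have "\<exists>z. A = Z - {z} \<and> z \<in> Z" if "A \<in> \<A>" "A \<subseteq> Z" for A
  proof -
    have "card (Z - A) = 1" using that Z A by (simp add: card_Diff_subset)
    then obtain z where "Z - A = {z}" by (meson card_1_singletonE)
    then show ?thesis using that by blast
  qed
  then obtain z1 z2 z3 where z: "A1 = Z - {z1}" "z1 \<in> Z" "A2 = Z - {z2}" "z2 \<in> Z"
    "A3 = Z - {z3}" "z3 \<in> Z" using A1 sub by meson
  have "A1 \<inter> A2 \<inter> A3 = Z - {z1, z2, z3}" using z by blast
  moreover have "card {z1, z2, z3} = 3" using z A1 by auto
  ultimately have "card (A1 \<inter> A2 \<inter> A3) = t + 2 - 3"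
    using Z z by (simp add: card_Diff_subset)
  then show False using ge t_pos by simp
qed

text \<open>If \<open>B\<close> missed an element of \<open>T\<close>, it would contain the rest of
  \<open>T\<close> and the three distinct petals, which is \<open>t + 2\<close> elements and one too
  many.\<close>

lemma kernel_subset:
  assumes A1: "A1 \<in> \<A>" "A2 \<in> \<A>" "A3 \<in> \<A>" "A1 \<noteq> A2" "A1 \<noteq> A3" "A2 \<noteq> A3"
    and T: "card T = t" "T \<subseteq> A1" "T \<subseteq> A2" "T \<subseteq> A3" and B': "B \<in> \<B>"
  shows "T \<subseteq> B"
proof (rule ccontr)
  assume "\<not> T \<subseteq> B"
  then obtain x where x: "x \<in> T" "x \<notin> B" by blast
  have fT: "finite T" using T t_pos by (metis card.infinite not_one_le_zero)
  have "\<exists>a. A = insert a T \<and> a \<notin> T" if "A \<in> \<A>" "T \<subseteq> A" for A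
  proof -
    have "card (A - T) = 1" using that T A fT by (simp add: card_Diff_subset)
    then obtain z where "A - T = {z}" by (meson card_1_singletonE)
    then show ?thesis using that by blast
  qed
  then obtain a1 a2 a3 where a: "A1 = insert a1 T" "a1 \<notin> T" "A2 = insert a2 T" "a2 \<notin> T"
    "A3 = insert a3 T" "a3 \<notin> T" using A1 T by meson
  have "insert a1 (insert a2 (insert a3 (T - {x}))) \<subseteq> B"
    using missA[OF A1(1) B' _ x(2)] missA[OF A1(2) B' _ x(2)] missA[OF A1(3) B' _ x(2)] a x T by blast
  then have "card (insert a1 (insert a2 (insert a3 (T - {x})))) \<le> t + 1"
    using B B' by (metis card_mono)
  moreover have "card (insert a1 (insert a2 (insert a3 (T - {x})))) = t + 2"
  proof -
    have "a1 \<noteq> a2" "a1 \<noteq> a3" "a2 \<noteq> a3" using a A1 by auto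
    then show ?thesis using a fT x T t_pos by (simp add: card_Diff_singleton)
  qed
  ultimately show False by simp
qed

text \<open>With one member on the left the product is at most \<open>(M - 1) * M\<close>, with two
  it is at most \<open>2 * max 4 (m + t)\<close>; both fall short of \<open>M ^ 2\<close>.\<close>

lemma card_ge_3:
  assumes M: "(max m (t + 2)) ^ 2 \<le> card \<A> * card \<B>"
  shows "3 \<le> card \<A>"
proof (rule ccontr)
  define M where "M = max m (t + 2)"
  have M3: "m \<le> M" "t + 2 \<le> M" "3 \<le> M" using t_pos by (auto simp: M_def)
  assume "\<not> ?thesis"
  moreover have "card \<A> \<noteq> 0" using ne fin by simp
  ultimately consider "card \<A> = 1" | "card \<A> = 2" by linarith
  then show False
  proof cases
    case 1
    interpret sw: cross_pair \<B> \<A> t m by (rule swap)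
    obtain A0 where "\<A> = {A0}" using 1 by (meson card_1_singletonE)
    then have "card \<B> \<le> (t + 1) * m" by (rule sw.card_le_singleton)
    also have "\<dots> \<le> (M - 1) * M" using M3 by (intro mult_mono) auto
    also have "\<dots> < M ^ 2" using M3 by (simp add: power2_eq_square)
    finally show False using M 1 by (simp add: M_def)
  next
    case 2
    then obtain A1 A2 where "\<A> = {A1, A2}" "A1 \<noteq> A2" by (meson card_2_iff)
    then have "card \<B> \<le> max 4 (m + t)" using card_B_le_of_two by blast
    moreover have "2 * (m + t) < M ^ 2"
    proof -
      obtain n where n: "M = n + 3" using M3(3) by (metis add.commute le_Suc_ex)
      have "2 * (m + t) \<le> 4 * (n + 2)" using M3 n by simp
      also have "\<dots> < M ^ 2" by (simp add: n power2_eq_square algebra_simps)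
      finally show ?thesis .
    qed
    moreover have "(3::nat) ^ 2 \<le> M ^ 2" using M3 by (intro power_mono) auto
    ultimately have "2 * card \<B> < M ^ 2" by (auto simp: max_def split: if_splits)
    then show False using M 2 by (simp add: M_def)
  qed
qed

text \<open>If two members of \<open>\<A>\<close> meet in fewer than \<open>t\<close> elements, the
  path on four points arises. Otherwise any two meet in exactly \<open>t\<close>, and such a family
  either has a common \<open>t\<close>-set or contains a triangle inside a
  \<open>(t + 2)\<close>-set.\<close>

theorem classification:
  assumes M: "(max m (t + 2)) ^ 2 \<le> card \<A> * card \<B>"
  shows "(t + 2 \<le> m \<and> card \<A> = m \<and> card \<B> = m \<and>
       (\<exists>T. card T = t \<and> (\<forall>A\<in>\<A> \<union> \<B>. T \<subseteq> A))) \<or>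
     (m \<le> t + 2 \<and> (\<exists>Z. finite Z \<and> card Z = t + 2 \<and> \<A> = {A. A \<subseteq> Z \<and> card A = t + 1} \<and>
       \<B> = {A. A \<subseteq> Z \<and> card A = t + 1})) \<or>
     (t = 1 \<and> m \<le> 3 \<and> (\<exists>x1 x2 y1 y2. distinct [x1, x2, y1, y2] \<and>
       \<A> = {{x1, x2}, {x1, y2}, {y1, y2}} \<and> \<B> = {{x1, y1}, {x2, y2}, {x1, y2}}))"
    (is "?sun \<or> ?tri \<or> ?four")
proof -
  interpret sw: cross_pair \<B> \<A> t m by (rule swap)
  define M where "M = max m (t + 2)"
  have MM: "M * M \<le> card \<A> * card \<B>" using M by (simp add: M_def power2_eq_square)
  have A3: "3 \<le> card \<A>" using card_ge_3[OF M] .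
  have B3: "3 \<le> card \<B>" using sw.card_ge_3 M by (simp add: mult.commute)
  \<comment> \<open>Once both families have at most \<open>n\<close> members with \<open>n\<close>
    at most \<open>M\<close>, the lower bound \<open>M ^ 2\<close> leaves no slack anywhere.\<close>
  have sat: "card \<A> = n \<and> card \<B> = n \<and> M = n" if "card \<A> \<le> n" "card \<B> \<le> n" "n \<le> M" for n
  proof -
    have "card \<A> * card \<B> \<le> n * n" using that by (intro mult_mono) auto
    moreover have "n * n \<le> M * M" using that by (intro mult_mono) auto
    ultimately have e: "card \<A> * card \<B> = n * n" "n * n = M * M" using MM by auto
    have n0: "0 < n" using A3 that by simp
    have "card \<A> = n"
    proof (rule ccontr)
      assume "card \<A> \<noteq> n"
      then have "card \<A> * card \<B> < n * n" using that n0 B3 by (intro mult_less_le_imp_less) auto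
      then show False using e by simp
    qed
    then have "card \<B> = n" using e(1) n0 by simp
    moreover have "M = n" using e by (metis power2_eq_imp_eq power2_eq_square zero_le)
    ultimately show ?thesis using \<open>card \<A> = n\<close> by simp
  qed
  have three: "\<exists>X1\<in>\<X>. \<exists>X2\<in>\<X>. \<exists>X3\<in>\<X>. X1 \<noteq> X2 \<and> X1 \<noteq> X3 \<and> X2 \<noteq> X3"
    if "3 \<le> card \<X>" for \<X> :: "'a set set"
  proof -
    obtain Y where Y: "Y \<subseteq> \<X>" "card Y = 3" using obtain_subset_with_card_n \<open>3 \<le> card \<X>\<close> by metis
    from Y(2) obtain X1 X2 X3 where X: "Y = {X1, X2, X3}" "X1 \<noteq> X2" "X1 \<noteq> X3" "X2 \<noteq> X3"
      using card_3_iff by metis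
    then have "X1 \<in> \<X>" "X2 \<in> \<X>" "X3 \<in> \<X>" using Y(1) by auto
    then show ?thesis using X(2-4) by blast
  qed
  show ?thesis
  proof (cases "\<exists>A1\<in>\<A>. \<exists>A2\<in>\<A>. card (A1 \<inter> A2) < t")
    case True
    then obtain A1 A2 where A12: "A1 \<in> \<A>" "A2 \<in> \<A>" "card (A1 \<inter> A2) < t" by blast
    then obtain D x1 x2 y1 y2 where "A1 = insert x1 (insert x2 D)" "A2 = insert y1 (insert y2 D)"
      "distinct [x1, x2, y1, y2]" "{x1, x2, y1, y2} \<inter> D = {}" "card D + 1 = t"
      by (rule far_obtain)
    with A12 have *: "insert x1 (insert x2 D) \<in> \<A>" "insert y1 (insert y2 D) \<in> \<A>"
      "distinct [x1, x2, y1, y2]" "{x1, x2, y1, y2} \<inter> D = {}" "card D + 1 = t"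
      by auto
    have sub: "\<B> \<subseteq> {insert x1 (insert y1 D), insert x1 (insert y2 D),
              insert x2 (insert y1 D), insert x2 (insert y2 D)}"
      using far_B[OF *] by blast
    \<comment> \<open>Since \<open>\<B>\<close> has at least three members, no two of the four
      candidates are absent together.\<close>
    have at_most_one: "P \<in> \<B> \<or> Q \<in> \<B>"
      if "\<B> \<subseteq> {P, Q, R, S}" for P Q R S
    proof (rule ccontr)
      assume "\<not> ?thesis"
      then have "\<B> \<subseteq> {R, S}" using that by blast
      then have "card \<B> \<le> card {R, S}" by (intro card_mono) auto
      also have "\<dots> \<le> 2" by (simp add: card_insert_if)
      finally show False using B3 by simp
    qed
    define w where "w = insert x1 (insert y1 D)"
    define x where "x = insert x1 (insert y2 D)"
    define y where "y = insert x2 (insert y1 D)"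
    define z where "z = insert x2 (insert y2 D)"
    have sub': "\<B> \<subseteq> {w, x, y, z}" using sub by (simp only: w_def x_def y_def z_def)
    have "w \<in> \<B> \<or> x \<in> \<B>" by (rule at_most_one[OF subset_trans[OF sub'], of _ _ y z]) auto
    moreover have "w \<in> \<B> \<or> y \<in> \<B>" by (rule at_most_one[OF subset_trans[OF sub'], of _ _ x z]) auto
    moreover have "w \<in> \<B> \<or> z \<in> \<B>" by (rule at_most_one[OF subset_trans[OF sub'], of _ _ x y]) auto
    moreover have "x \<in> \<B> \<or> y \<in> \<B>" by (rule at_most_one[OF subset_trans[OF sub'], of _ _ w z]) auto
    moreover have "x \<in> \<B> \<or> z \<in> \<B>" by (rule at_most_one[OF subset_trans[OF sub'], of _ _ w y]) auto
    moreover have "y \<in> \<B> \<or> z \<in> \<B>" by (rule at_most_one[OF subset_trans[OF sub'], of _ _ w x]) auto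
    ultimately consider "w \<in> \<B>" "z \<in> \<B>" "x \<in> \<B>" | "w \<in> \<B>" "z \<in> \<B>" "y \<in> \<B>"
      | "x \<in> \<B>" "y \<in> \<B>" "w \<in> \<B>" | "x \<in> \<B>" "y \<in> \<B>" "z \<in> \<B>"
      by argo
    note cases4 = this[unfolded w_def x_def y_def z_def]
    \<comment> \<open>The four cases differ only by exchanging \<open>x1\<close> with
      \<open>x2\<close> or \<open>y1\<close> with \<open>y2\<close>, so \<open>far_three\<close>
      serves all of them.\<close>
    have A1': "insert x2 (insert x1 D) \<in> \<A>" "insert y2 (insert y1 D) \<in> \<A>"
      using * by (simp_all add: insert_commute)
    have "?four"
    proof -
      from cases4 show ?thesis
      proof cases
        case 1
        have "distinct [x1, x2, y1, y2]" using * by simp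
        then show ?thesis using far_three[OF *(1,2) *(3-5) 1 M] by blast
      next
        case 2
        have d: "distinct [x2, x1, y2, y1]" "{x2, x1, y2, y1} \<inter> D = {}" using * by auto
        show ?thesis using far_three[OF A1' d *(5) 2(2,1,3) M] d by blast
      next
        case 3
        have d: "distinct [x1, x2, y2, y1]" "{x1, x2, y2, y1} \<inter> D = {}" using * by auto
        show ?thesis using far_three[OF *(1) A1'(2) d *(5) 3 M] d by blast
      next
        case 4
        have d: "distinct [x2, x1, y1, y2]" "{x2, x1, y1, y2} \<inter> D = {}" using * by auto
        show ?thesis using far_three[OF A1'(1) *(2) d *(5) 4(2,1,3) M] d by blast
      qed
    qed
    then show ?thesis by blast
  next
    case False
    have int: "card (A1 \<inter> A2) = t" if "A1 \<in> \<A>" "A2 \<in> \<A>" "A1 \<noteq> A2" for A1 A2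
    proof -
      have "card (A1 \<inter> A2) \<noteq> t + 1"
        using A that by (metis card_subset_eq inf_le1 inf_le2)
      moreover have "card (A1 \<inter> A2) \<le> t + 1"
        using A that by (metis card_mono inf_le1)
      moreover have "t \<le> card (A1 \<inter> A2)" using False that by (meson not_less)
      ultimately show ?thesis by linarith
    qed
    obtain A1 A2 A3 where A123: "A1 \<in> \<A>" "A2 \<in> \<A>" "A3 \<in> \<A>" "A1 \<noteq> A2" "A1 \<noteq> A3" "A2 \<noteq> A3"
      using three[OF \<open>3 \<le> card \<A>\<close>] by blast
    let ?T = "A1 \<inter> A2" and ?Z = "A1 \<union> A2"
    have cT: "card ?T = t" using int A123 by blast
    have fZ: "finite ?Z" using A A123 by blast
    have cZ: "card ?Z = t + 2" using card_Un_Int[of A1 A2] A A123 cT by simp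
    show ?thesis
    proof (cases "\<forall>A\<in>\<A>. ?T \<subseteq> A")
      case True
      then have TB: "\<forall>B\<in>\<B>. ?T \<subseteq> B"
        using kernel_subset[OF A123 cT] A123 by (metis inf_le1 inf_le2)
      have "{A \<in> \<A>. ?T \<subseteq> A} = \<A>" "{B \<in> \<B>. ?T \<subseteq> B} = \<B>" using True TB by auto
      then have "card \<A> \<le> m" "card \<B> \<le> m" using degA[OF cT] degB[OF cT] by auto
      then have "card \<A> = m \<and> card \<B> = m \<and> M = m" by (intro sat) (auto simp: M_def)
      then have ?sun using True TB cT by (auto simp: M_def max_def split: if_splits)
      then show ?thesis by blast
    next
      case False
      then obtain A4 x where A4: "A4 \<in> \<A>" "x \<in> ?T" "x \<notin> A4" by blast
      then have ne4: "A1 \<noteq> A4" "A2 \<noteq> A4" by blast+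
      have "A1 - {x} \<subseteq> A4"
        using Diff_subset_of_large_Int[of A1 t A4 x] A A123 A4 int[OF A123(1) A4(1) ne4(1)] by auto
      moreover have "A2 - {x} \<subseteq> A4"
        using Diff_subset_of_large_Int[of A2 t A4 x] A A123 A4 int[OF A123(2) A4(1) ne4(2)] by auto
      \<comment> \<open>This identifies \<open>A4\<close> with the union minus \<open>x\<close>. So
        \<open>A1\<close>, \<open>A2\<close>, \<open>A4\<close> form a triangle, which confines
        first \<open>\<B>\<close> and then in turn \<open>\<A>\<close> to the union.\<close>
      ultimately have "?Z - {x} \<subseteq> A4" by blast
      moreover have "card (?Z - {x}) = t + 1" using cZ A4 by simp
      ultimately have "?Z - {x} = A4" using A A4(1) by (metis card_subset_eq)
      then have A4Z: "A4 \<subseteq> ?Z" by blast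
      have BZ: "B \<subseteq> ?Z" if "B \<in> \<B>" for B
        using subset_of_triangle[OF fZ cZ A123(1,2) A4(1) A123(4) ne4 _ _ A4Z that] by blast
      obtain B1 B2 B3 where B123: "B1 \<in> \<B>" "B2 \<in> \<B>" "B3 \<in> \<B>" "B1 \<noteq> B2" "B1 \<noteq> B3" "B2 \<noteq> B3"
        using three[OF \<open>3 \<le> card \<B>\<close>] by blast
      have AZ: "A \<subseteq> ?Z" if "A \<in> \<A>" for A
        using sw.subset_of_triangle[OF fZ cZ B123 BZ BZ BZ that] B123 by blast
      let ?S = "{A. A \<subseteq> ?Z \<and> card A = t + 1}"
      have cS: "card ?S = t + 2" using n_subsets[OF fZ, of "t + 1"] cZ by simp
      have fS: "finite ?S" using fZ by simp
      have subs: "\<A> \<subseteq> ?S" "\<B> \<subseteq> ?S" using AZ BZ A B by auto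
      then have "card \<A> \<le> t + 2" "card \<B> \<le> t + 2" using card_mono[OF fS] cS by metis+
      then have s: "card \<A> = t + 2 \<and> card \<B> = t + 2 \<and> M = t + 2"
        by (intro sat) (auto simp: M_def)
      have eqA: "\<A> = ?S" using card_subset_eq[OF fS subs(1)] cS s by simp
      have eqB: "\<B> = ?S" using card_subset_eq[OF fS subs(2)] cS s by simp
      have m: "m \<le> t + 2" using s by (auto simp: M_def)
      show ?thesis
        by (rule disjI2, rule disjI1, rule conjI[OF m], rule exI[of _ ?Z])
          (intro conjI fZ cZ eqA eqB)
    qed
  qed
qed

end

section \<open>Covers and branching\<close>

definition cover :: "nat \<Rightarrow> 'a set set \<Rightarrow> 'a set \<Rightarrow> bool" where
  "cover t \<F> S \<longleftrightarrow> (\<forall>F\<in>\<F>. t \<le> card (S \<inter> F))"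

text \<open>A member of \<open>\<G>\<close> containing a non-cover \<open>S\<close> must use a further block of some \<open>F\<close>
  compatible with \<open>S\<close>, and there are at most \<open>k - |S|\<close> of those.\<close>

definition branch_bound :: "nat \<Rightarrow> nat \<Rightarrow> nat \<Rightarrow> nat \<Rightarrow> nat" where
  "branch_bound c k j s = (\<Prod>i\<in>{j..<s}. k - i) * npart c (k - s)"

text \<open>Branch until the set has \<open>s\<close> blocks, then count all partitions through it.
  The hypothesis \<open>nocov\<close> concerns only subsets of members of \<open>\<G>\<close>, so
  that the lemma also fits the subfamily of members containing no cover of size
  \<open>t + 1\<close>.\<close>

lemma card_extensions_le:
  assumes c: "0 < c" and FU: "\<F> \<subseteq> U c k k" and GU: "\<G> \<subseteq> U c k k"
    and cross: "cross_intersecting t \<F> \<G>"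
    and nocov: "\<And>G S. G \<in> \<G> \<Longrightarrow> S \<subseteq> G \<Longrightarrow> card S < s \<Longrightarrow> \<not> cover t \<F> S"
    and "S \<in> U c k j" "j \<le> s"
  shows "card {G \<in> \<G>. S \<subseteq> G} \<le> branch_bound c k j s"
  using assms(6,7)
proof (induction "s - j" arbitrary: j S)
  case 0
  then have "j = s" by simp
  have "{G \<in> \<G>. S \<subseteq> G} \<subseteq> star c k S" using GU unfolding star_def by blast
  then have "card {G \<in> \<G>. S \<subseteq> G} \<le> card (star c k S)" by (intro card_mono) auto
  then show ?case using card_star[OF 0(2) c] \<open>j = s\<close> by (simp add: branch_bound_def)
next
  case (Suc n)
  then have js: "j < s" by simp
  have fG: "finite \<G>" using GU by (rule finite_subset) simp
  show ?case
  proof (cases "{G \<in> \<G>. S \<subseteq> G} = {}")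
    case True
    then show ?thesis by (simp only: card.empty)
  next
    case False
    then obtain G0 where "G0 \<in> \<G>" "S \<subseteq> G0" by blast
    then have "\<not> cover t \<F> S" using nocov js card_U_member[OF Suc.prems(1)] by blast
    then obtain F where F: "F \<in> \<F>" "card (S \<inter> F) < t" by (auto simp: cover_def not_le)
    have FUk: "F \<in> U c k k" using F FU by blast
    have fS: "finite S" using finite_U_member[OF Suc.prems(1)] .
    let ?X = "F \<inter> compat c k S"
    have fX: "finite ?X" using finite_U_member[OF FUk] by simp
    have sub: "{G \<in> \<G>. S \<subseteq> G} \<subseteq> (\<Union>e\<in>?X. {G \<in> \<G>. insert e S \<subseteq> G})"
    proof
      fix G assume "G \<in> {G \<in> \<G>. S \<subseteq> G}"
      then have G: "G \<in> \<G>" "S \<subseteq> G" by auto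
      have "t \<le> card (F \<inter> G)" using cross F G by (auto simp: cross_intersecting_def)
      then have "\<not> F \<inter> G \<subseteq> S \<inter> F"
        using F(2) card_mono[of "S \<inter> F" "F \<inter> G"] fS by auto
      then obtain e where e: "e \<in> F" "e \<in> G" "e \<notin> S" by blast
      have "insert e S \<subseteq> G" using e G by blast
      moreover have "G \<in> U c k k" using G(1) GU by blast
      ultimately have "insert e S \<in> U c k (card (insert e S))" by (metis U_subset)
      then have "e \<in> compat c k S" using e fS by (simp add: compat_def)
      then show "G \<in> (\<Union>e\<in>?X. {G \<in> \<G>. insert e S \<subseteq> G})"
        using e(1) G(1) \<open>insert e S \<subseteq> G\<close> by auto
    qed
    have le: "card {G \<in> \<G>. insert e S \<subseteq> G} \<le> branch_bound c k (Suc j) s" if "e \<in> ?X" for e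
    proof (rule Suc.hyps(1))
      show "n = s - Suc j" "Suc j \<le> s" using Suc.hyps(2) js by auto
      show "insert e S \<in> U c k (Suc j)"
        using that card_U_member[OF Suc.prems(1)] by (simp add: compat_def)
    qed
    have "card {G \<in> \<G>. S \<subseteq> G} \<le> card (\<Union>e\<in>?X. {G \<in> \<G>. insert e S \<subseteq> G})"
      using sub fX fG by (intro card_mono) auto
    also have "\<dots> \<le> (\<Sum>e\<in>?X. card {G \<in> \<G>. insert e S \<subseteq> G})" by (rule card_UN_le[OF fX])
    also have "\<dots> \<le> (\<Sum>e\<in>?X. branch_bound c k (Suc j) s)" by (intro sum_mono le)
    also have "\<dots> \<le> (k - j) * branch_bound c k (Suc j) s"
      using card_compat_le[OF Suc.prems(1) FUk c] by simp
    also have "\<dots> = branch_bound c k j s"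
      using js by (simp add: branch_bound_def prod.atLeast_Suc_lessThan)
    finally show ?thesis .
  qed
qed

text \<open>A cover of \<open>\<G>\<close> shares \<open>t\<close> blocks with each member, so its
  \<open>t\<close>-subsets can start the branching.\<close>

lemma card_le_via_cover:
  assumes c: "0 < c" and FU: "\<F> \<subseteq> U c k k" and GU: "\<G> \<subseteq> U c k k"
    and cross: "cross_intersecting t \<F> \<G>"
    and nocov: "\<And>G S. G \<in> \<G> \<Longrightarrow> S \<subseteq> G \<Longrightarrow> card S < s \<Longrightarrow> \<not> cover t \<F> S"
    and S: "S \<in> U c k n" "cover t \<G> S" and "t \<le> s"
  shows "card \<G> \<le> (n choose t) * branch_bound c k t s"
proof -
  let ?\<T> = "{T. T \<subseteq> S \<and> card T = t}"
  have fS: "finite S" using finite_U_member[OF S(1)] .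
  have fT: "finite ?\<T>" using fS by simp
  have fG: "finite \<G>" using GU by (rule finite_subset) simp
  have sub: "\<G> \<subseteq> (\<Union>T\<in>?\<T>. {G \<in> \<G>. T \<subseteq> G})"
  proof
    fix G assume G: "G \<in> \<G>"
    then have "t \<le> card (S \<inter> G)" using S by (simp add: cover_def)
    then obtain T where "T \<subseteq> S \<inter> G" "card T = t" by (metis obtain_subset_with_card_n)
    then show "G \<in> (\<Union>T\<in>?\<T>. {G \<in> \<G>. T \<subseteq> G})" using G by blast
  qed
  have le: "card {G \<in> \<G>. T \<subseteq> G} \<le> branch_bound c k t s" if "T \<in> ?\<T>" for T
  proof (rule card_extensions_le[OF c FU GU cross nocov])
    show "T \<in> U c k t" using U_subset[OF S(1), of T] that by auto
  qed (use \<open>t \<le> s\<close> in auto)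
  have "card \<G> \<le> card (\<Union>T\<in>?\<T>. {G \<in> \<G>. T \<subseteq> G})"
    using sub fT fG by (intro card_mono) auto
  also have "\<dots> \<le> (\<Sum>T\<in>?\<T>. card {G \<in> \<G>. T \<subseteq> G})" by (rule card_UN_le[OF fT])
  also have "\<dots> \<le> (\<Sum>T\<in>?\<T>. branch_bound c k t s)" by (intro sum_mono le)
  also have "\<dots> = (n choose t) * branch_bound c k t s"
    using n_subsets[OF fS, of t] card_U_member[OF S(1)] by simp
  finally show ?thesis .
qed

text \<open>The function \<open>f\<close> of the overview. In the product of the two size bounds,
  each binomial belongs to the cover of one family and multiplies the branching bound with the depth
  of the other; regrouping gives one value of \<open>f\<close> per family.\<close>

definition cover_bound :: "nat \<Rightarrow> nat \<Rightarrow> nat \<Rightarrow> nat \<Rightarrow> nat" where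
  "cover_bound c k t s = (s choose t) * branch_bound c k t s"

lemma branch_bound_Suc:
  assumes "j \<le> s"
  shows "npart c (k - s) * branch_bound c k j (Suc s) =
    branch_bound c k j s * ((k - s) * npart c (k - Suc s))"
  using assms by (simp add: branch_bound_def atLeastLessThanSuc ac_simps)

text \<open>The ratio of consecutive values, cleared of denominators.\<close>

lemma cover_bound_Suc:
  assumes "t \<le> s"
  shows "(Suc s - t) * npart c (k - s) * cover_bound c k t (Suc s) =
    cover_bound c k t s * (Suc s * (k - s) * npart c (k - Suc s))"
proof -
  have "(Suc s - t) * (Suc s choose t) = Suc s * (s choose t)"
    using binomial_absorb_comp[of "Suc s" t] by simp
  then have "(Suc s - t) * npart c (k - s) * cover_bound c k t (Suc s) =
      Suc s * (s choose t) * (npart c (k - s) * branch_bound c k t (Suc s))"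
    unfolding cover_bound_def by (metis (no_types, lifting) mult.assoc mult.left_commute)
  also have "\<dots> = cover_bound c k t s * (Suc s * (k - s) * npart c (k - Suc s))"
    unfolding branch_bound_Suc[OF assms] cover_bound_def by (simp only: ac_simps)
  finally show ?thesis .
qed

text \<open>By the growth of \<open>npart\<close> it suffices that \<open>n + t\<close> is at most
  \<open>3 * n * j ^ (c - 2)\<close>. If \<open>k\<close> is large then \<open>n + j\<close> is at
  least \<open>t + 4\<close>; otherwise the condition on \<open>c\<close> gives that
  \<open>t\<close> is at most \<open>j ^ (c - 2)\<close>. Both use that \<open>j = k - s\<close> is
  at least 2.\<close>

lemma cover_bound_step:
  fixes c k t s :: nat
  assumes c: "6 \<le> c" and s: "t + 1 \<le> s" "s + 2 \<le> k"
    and cond: "2 * t + 3 \<le> k \<or> 7 \<le> c \<and> t ^ 4 \<le> 2 ^ (c - 7)"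
  shows "cover_bound c k t (Suc s) \<le> cover_bound c k t s"
proof -
  define n where "n = Suc s - t"
  define j where "j = k - s"
  have n2: "2 \<le> n" and j2: "2 \<le> j" and ss: "Suc s = n + t" and kj: "k = s + j"
    using s by (auto simp: n_def j_def)
  have key: "n + t \<le> n * (3 * j ^ (c - 2))"
    using cond
  proof
    assume "2 * t + 3 \<le> k"
    then have "t + 4 \<le> n + j" using ss kj by simp
    then have "n + t \<le> 2 * n + j" by simp
    also have "\<dots> \<le> n * (2 + j)" using n2 by (simp add: algebra_simps)
    also have "\<dots> \<le> n * (3 * j ^ (c - 2))"
    proof (rule mult_left_mono)
      have "j ^ 1 \<le> j ^ (c - 2)" using j2 c by (intro power_increasing) auto
      then show "2 + j \<le> 3 * j ^ (c - 2)" using j2 by simp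
    qed simp
    finally show ?thesis .
  next
    assume a: "7 \<le> c \<and> t ^ 4 \<le> 2 ^ (c - 7)"
    have "t \<le> t ^ 4" by (cases "t = 0") (auto intro: self_le_power)
    also have "\<dots> \<le> 2 ^ (c - 7)" using a by simp
    also have "\<dots> \<le> 2 ^ (c - 2)" by (intro power_increasing) auto
    also have "\<dots> \<le> j ^ (c - 2)" using j2 by (intro power_mono) auto
    finally have t: "t \<le> j ^ (c - 2)" .
    have one: "1 \<le> j ^ (c - 2)" using j2 by simp
    have "n + t \<le> n * (1 + t)" using n2 by (simp add: algebra_simps)
    also have "\<dots> \<le> n * (3 * j ^ (c - 2))" using t one by (intro mult_left_mono) auto
    finally show ?thesis .
  qed
  have "c - 1 = Suc (c - 2)" using c by simp
  then have pw: "j ^ (c - 1) = j ^ (c - 2) * j" by (simp add: mult.commute)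
  have ks: "k - Suc s = j - 1" using kj j2 by simp
  have "Suc s * j * npart c (j - 1) \<le> n * (3 * j ^ (c - 2)) * j * npart c (j - 1)"
    using key ss by (intro mult_right_mono) auto
  also have "\<dots> = n * (3 * j ^ (c - 1) * npart c (j - 1))" by (simp only: pw ac_simps)
  also have "\<dots> \<le> n * npart c j" using npart_Suc_ge[OF c j2] by (intro mult_left_mono) auto
  finally have le: "Suc s * j * npart c (j - 1) \<le> n * npart c j" .
  have "n * npart c j * cover_bound c k t (Suc s) = cover_bound c k t s * (Suc s * j * npart c (j - 1))"
    using cover_bound_Suc[of t s c k] s(1) by (simp only: ks n_def[symmetric] j_def[symmetric])
  also have "\<dots> \<le> n * npart c j * cover_bound c k t s"
    using le by (metis mult.commute mult_le_mono1)
  finally show ?thesis using n2 npart_pos[of c j] by simp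
qed

text \<open>The step from \<open>k - 1\<close> to \<open>k\<close> gains nothing from
  \<open>npart\<close>, whose values at 0 and 1 are both 1, and may increase the bound. It costs a
  factor of at most \<open>t + 1\<close>, which \<open>cover_bound_le\<close> carries along.\<close>

lemma cover_bound_last:
  assumes "t + 1 \<le> k"
  shows "cover_bound c k t k \<le> (t + 1) * cover_bound c k t (k - 1)"
proof -
  have k: "Suc (k - 1) = k" using assms by simp
  have "(k - t) * cover_bound c k t k = cover_bound c k t (k - 1) * k"
    using cover_bound_Suc[of t "k - 1" c k] assms by (simp add: k)
  also have "\<dots> \<le> cover_bound c k t (k - 1) * ((t + 1) * (k - t))"
  proof (rule mult_left_mono)
    obtain n where n: "k = t + 1 + n" using assms le_Suc_ex by blast
    show "k \<le> (t + 1) * (k - t)" by (simp add: n)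
  qed simp
  finally have "(k - t) * cover_bound c k t k \<le> (k - t) * ((t + 1) * cover_bound c k t (k - 1))"
    by (simp only: ac_simps)
  then show ?thesis using assms by simp
qed

lemma cover_bound_le:
  fixes c k t s :: nat
  assumes c: "6 \<le> c" and s: "t + 2 \<le> s" "s \<le> k" and k: "t + 3 \<le> k"
    and cond: "2 * t + 3 \<le> k \<or> 7 \<le> c \<and> t ^ 4 \<le> 2 ^ (c - 7)"
  shows "cover_bound c k t s \<le> (t + 1) * cover_bound c k t (t + 2)"
proof -
  have le: "cover_bound c k t s \<le> cover_bound c k t (t + 2)" if "t + 2 \<le> s" "s + 1 \<le> k" for s
    using that
  proof (induction s rule: nat_induct_at_least)
    case (Suc s)
    then have "cover_bound c k t (Suc s) \<le> cover_bound c k t s"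
      by (intro cover_bound_step[OF c _ _ cond]) auto
    then show ?case using Suc by simp
  qed simp
  show ?thesis
  proof (cases "s = k")
    case True
    have "cover_bound c k t k \<le> (t + 1) * cover_bound c k t (k - 1)"
      using k by (intro cover_bound_last) simp
    also have "\<dots> \<le> (t + 1) * cover_bound c k t (t + 2)"
      using le[of "k - 1"] k by (intro mult_left_mono) auto
    finally show ?thesis using True by simp
  next
    case False
    then have "cover_bound c k t s \<le> cover_bound c k t (t + 2)" using le s by simp
    then show ?thesis by simp
  qed
qed

text \<open>These are the two inequalities that let the main term beat all error terms in the
  comparison of products. If \<open>m\<close> is at least \<open>t + 2\<close>, then
  \<open>d\<close> is at most \<open>m ^ 3\<close> while \<open>r\<close> is at least
  \<open>m ^ 5\<close>; otherwise powers of \<open>t\<close> are needed too and come from the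
  condition on \<open>c\<close>.\<close>

lemma ratio_bounds:
  fixes c k t m r :: nat
  assumes c: "6 \<le> c" and t: "1 \<le> t" and k: "k = t + m + 1" "2 \<le> m"
    and cond: "2 * t + 3 \<le> k \<or> 7 \<le> c \<and> t ^ 4 \<le> 2 ^ (c - 7)"
    and r: "3 * m ^ (c - 1) \<le> r"
  defines "M \<equiv> max m (t + 2)" and "d \<equiv> (t + 1) * (m + 1) * m"
  shows "M ^ 2 * (d + (M - 1)) + M < r" "d ^ 2 \<le> M * r"
proof -
  have "M ^ 2 * (d + (M - 1)) + M < r \<and> d ^ 2 \<le> M * r"
  proof (cases "t + 2 \<le> m")
    case True
    then have M: "M = m" by (simp add: M_def)
    have "m ^ 5 \<le> m ^ (c - 1)" using k c by (intro power_increasing) auto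
    moreover have "1 \<le> m ^ 5" using k by simp
    ultimately have r5: "m ^ 5 \<le> r" "m ^ 5 < r" using r by linarith+
    obtain n where n: "m = n + 1" using k(2) by (metis add.commute le_Suc_ex one_le_numeral order.trans)
    have d1: "d \<le> n * (n + 2) * (n + 1)" unfolding d_def using True n by (intro mult_mono) auto
    have "m ^ 2 * (d + (m - 1)) + m \<le> m ^ 2 * (n * (n + 2) * (n + 1) + n) + m"
      using d1 n by simp
    also have "\<dots> \<le> m ^ 5" using n k
      by (simp add: power2_eq_square eval_nat_numeral algebra_simps)
    finally have 1: "M ^ 2 * (d + (M - 1)) + M < r" using r5 M by simp
    have "d \<le> m ^ 3" using d1 n by (simp add: eval_nat_numeral algebra_simps)
    then have "d ^ 2 \<le> (m ^ 3) ^ 2" by (intro power_mono) auto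
    also have "\<dots> = m * m ^ 5" by (simp add: eval_nat_numeral)
    also have "\<dots> \<le> M * r" using r5 M by simp
    finally show ?thesis using 1 by simp
  next
    case False
    then have M: "M = t + 2" by (simp add: M_def)
    \<comment> \<open>Here \<open>k\<close> is at most \<open>2 * t + 2\<close>, so only the second
      alternative of \<open>cond\<close> can hold.\<close>
    have c7: "7 \<le> c" and t4: "t ^ 4 \<le> 2 ^ (c - 7)" using cond False k by auto
    have "c - 1 = 6 + (c - 7)" using c7 by simp
    then have "m ^ (c - 1) = m ^ 6 * m ^ (c - 7)" by (simp only: power_add)
    moreover have "m ^ 6 * t ^ 4 \<le> m ^ 6 * 2 ^ (c - 7)" using t4 by (intro mult_left_mono) auto
    moreover have "m ^ 6 * 2 ^ (c - 7) \<le> m ^ 6 * m ^ (c - 7)"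
      using k by (intro mult_left_mono power_mono) auto
    ultimately have "m ^ 6 * t ^ 4 \<le> m ^ (c - 1)" by linarith
    then have r1: "3 * (m ^ 6 * t ^ 4) \<le> r" using r by simp
    have "(2::nat) ^ 4 \<le> m ^ 4" using k by (intro power_mono) auto
    then have m6: "16 * m ^ 2 \<le> m ^ 6"
      using mult_right_mono[of 16 "m ^ 4" "m ^ 2"] by (simp add: power_add[symmetric])
    have t34: "t ^ 3 \<le> t ^ 4" using t by (intro power_increasing) auto
    have "48 * m ^ 2 * t ^ 3 \<le> 3 * (m ^ 6 * t ^ 4)"
      using mult_mono[OF m6 t34] by simp
    then have r2: "48 * m ^ 2 * t ^ 3 \<le> r" using r1 by simp
    have m4: "4 \<le> m ^ 2" using k(2) power_mono[of 2 m 2] by simp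
    have mm: "2 * m \<le> m ^ 2" using k(2) by (simp add: power2_eq_square)
    have t13: "t \<le> t ^ 3" "1 \<le> t ^ 3" using t by (auto intro: self_le_power)
    have "d + (t + 1) = (t + 1) * ((m + 1) * m + 1)" by (simp add: d_def algebra_simps)
    also have "\<dots> \<le> (2 * t) * (m ^ 2 + m + 1)" using t
      by (intro mult_mono) (auto simp: power2_eq_square)
    finally have dd: "d + (t + 1) \<le> (2 * t) * (m ^ 2 + m + 1)" .
    have "(t + 2) ^ 2 \<le> (3 * t) ^ 2" using t by (intro power_mono) auto
    then have "(t + 2) ^ 2 * (d + (t + 1)) \<le> (3 * t) ^ 2 * ((2 * t) * (m ^ 2 + m + 1))"
      using dd by (intro mult_mono) auto
    also have "\<dots> = 18 * t ^ 3 * (m ^ 2 + m + 1)" by (simp add: power2_eq_square power3_eq_cube algebra_simps)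
    finally have "(t + 2) ^ 2 * (d + (t + 1)) + (t + 2) \<le> 18 * t ^ 3 * (m ^ 2 + m + 1) + 3 * t ^ 3"
      using t13 t by simp
    also have "\<dots> = t ^ 3 * (18 * (m ^ 2 + m + 1) + 3)" by (simp add: algebra_simps)
    also have "\<dots> < t ^ 3 * (48 * m ^ 2)"
    proof (rule mult_strict_left_mono)
      show "18 * (m ^ 2 + m + 1) + 3 < 48 * m ^ 2"
        using m4 mm unfolding distrib_left by linarith
    qed (use t13 in linarith)
    also have "\<dots> \<le> r" using r2 by (simp add: mult.commute)
    finally have 1: "M ^ 2 * (d + (M - 1)) + M < r" using M by simp
    have "d \<le> (2 * t) * (2 * m) * m" unfolding d_def using t k by (intro mult_mono) auto
    then have "d ^ 2 \<le> ((2 * t) * (2 * m) * m) ^ 2" by (intro power_mono) auto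
    also have "\<dots> = 16 * t ^ 2 * m ^ 4" by (simp add: power2_eq_square power4_eq_xxxx)
    also have "\<dots> \<le> 3 * (3 * (t ^ 4 * m ^ 6))"
    proof -
      have "4 * m ^ 4 \<le> m ^ 6" using mult_right_mono[OF m4, of "m ^ 4"] by (simp add: power_add[symmetric])
      moreover have "t ^ 2 \<le> t ^ 4" using t by (intro power_increasing) auto
      ultimately have "t ^ 2 * (4 * m ^ 4) \<le> t ^ 4 * m ^ 6" by (intro mult_mono) auto
      then show ?thesis by simp
    qed
    also have "\<dots> \<le> M * r" using r1 M t by (intro mult_mono) (auto simp: mult.commute)
    finally show ?thesis using 1 by simp
  qed
  then show "M ^ 2 * (d + (M - 1)) + M < r" "d ^ 2 \<le> M * r" by auto
qed

text \<open>The logarithmic condition, exponentiated. The conjunct on \<open>c\<close> makes the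
  subtraction in the exponent exact.\<close>

lemma pow4_le_of_log:
  assumes "1 \<le> t" "4 * log 2 (real t) + 7 \<le> real c"
  shows "7 \<le> c \<and> t ^ 4 \<le> 2 ^ (c - 7)"
proof -
  have t0: "0 < real t" using assms by simp
  have "0 \<le> log 2 (real t)" using assms by simp
  then have c7: "7 \<le> c" using assms(2) by linarith
  have "log 2 (real t ^ 4) = 4 * log 2 (real t)" using t0 by (simp add: log_nat_power)
  also have "\<dots> \<le> real (c - 7)" using assms(2) c7 by (simp add: of_nat_diff)
  finally have "real t ^ 4 \<le> 2 powr (real (c - 7))" using t0 by (simp add: log_le_iff)
  also have "\<dots> = 2 ^ (c - 7)" by (simp add: powr_realpow)
  finally have "real (t ^ 4) \<le> real (2 ^ (c - 7))" by simp
  then show ?thesis using c7 by (metis of_nat_le_iff)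
qed

text \<open>The two lemmas \<open>product_lt_of_cover_counts\<close> and \<open>product_lt_of_large_cover\<close> compare with
  the lower bound \<open>(M u - C v)\<^sup>2\<close> for the maximal product, where \<open>u = r v\<close> and \<open>v\<close> count the
  partitions through \<open>t + 1\<close> and \<open>t + 2\<close> given blocks.\<close>

lemma square_lower_bound:
  fixes M r C :: int
  assumes "0 \<le> r" "0 \<le> M" "2 * C \<le> M * (M - 1)"
  shows "M\<^sup>2 * r\<^sup>2 - M\<^sup>2 * (M - 1) * r \<le> (M * r - C)\<^sup>2"
proof -
  have "(M * r) * (2 * C) \<le> (M * r) * (M * (M - 1))" using assms by (intro mult_left_mono) auto
  moreover have "(M * r - C)\<^sup>2 = M\<^sup>2 * r\<^sup>2 - (M * r) * (2 * C) + C\<^sup>2"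
    by (simp add: power2_eq_square algebra_simps)
  moreover have "(M * r) * (M * (M - 1)) = M\<^sup>2 * (M - 1) * r" by (simp add: power2_eq_square)
  ultimately show ?thesis using zero_le_power2[of C] by linarith
qed

text \<open>\<open>N\<close> is at least \<open>(M * r - C) * v\<close>, and squaring costs at most
  \<open>2 * C * M * r\<close> from the main term. The integers keep the subtractions exact.\<close>

lemma square_lower_bound_nat:
  fixes r v d M C N :: nat
  assumes M: "1 \<le> M" and C: "2 * C \<le> M * (M - 1)"
    and N: "M * r * v \<le> N + C * v" and r: "M \<le> r"
  shows "((int M)\<^sup>2 * (int r)\<^sup>2 - (int M)\<^sup>2 * (int M - 1) * int r) * (int v)\<^sup>2 \<le> (int N)\<^sup>2"
proof -
  have C1: "2 * int C \<le> int M * (int M - 1)"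
  proof -
    have "int (2 * C) \<le> int (M * (M - 1))" using C by (simp only: of_nat_le_iff)
    then show ?thesis using M by (simp add: of_nat_diff)
  qed
  have N1: "(int M * int r - int C) * int v \<le> int N"
  proof -
    have "int (M * r * v) \<le> int (N + C * v)" using N by (simp only: of_nat_le_iff)
    then show ?thesis by (simp add: algebra_simps)
  qed
  have "int M * (int M - 1) \<le> int M * int r" using r by (intro mult_left_mono) auto
  then have CM: "0 \<le> int M * int r - int C" using C1 by linarith
  have "((int M)\<^sup>2 * (int r)\<^sup>2 - (int M)\<^sup>2 * (int M - 1) * int r) * (int v)\<^sup>2
      \<le> (int M * int r - int C)\<^sup>2 * (int v)\<^sup>2"
    using square_lower_bound[of "int r" "int M" "int C"] C1 by (intro mult_right_mono) auto
  also have "\<dots> = ((int M * int r - int C) * int v)\<^sup>2" by (simp add: power_mult_distrib)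
  also have "\<dots> \<le> (int N)\<^sup>2" using N1 CM by (intro power_mono) auto
  finally show ?thesis .
qed

lemma product_lt_of_cover_counts:
  fixes a b r v d M C N X Y :: nat
  assumes X: "X \<le> (a * r + d) * v" and Y: "Y \<le> (b * r + d) * v"
    and ab: "1 \<le> a" "1 \<le> b" "a * b < M ^ 2" and M: "1 \<le> M" and C: "2 * C \<le> M * (M - 1)"
    and N: "M * r * v \<le> N + C * v" and v: "1 \<le> v"
    and r: "M ^ 2 * (d + (M - 1)) + M < r" "d ^ 2 \<le> M * r"
  shows "X * Y < N * N"
proof -
  define a' b' r' v' d' M' where defs:
    "a' = int a" "b' = int b" "r' = int r" "v' = int v" "d' = int d" "M' = int M"
  have pos: "0 \<le> a'" "0 \<le> b'" "0 \<le> r'" "0 \<le> d'" "1 \<le> v'" "1 \<le> M'" "0 < r'"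
    using v M r(1) by (auto simp: defs)
  have M1: "int (M - 1) = M' - 1" using M by (simp add: defs of_nat_diff)
  have "int (M ^ 2 * (d + (M - 1)) + M) < int r" using r(1) by (simp only: of_nat_less_iff)
  then have "M'\<^sup>2 * (d' + int (M - 1)) + M' < r'" by (simp only: defs of_nat_add of_nat_mult of_nat_power)
  then have r1: "M'\<^sup>2 * d' + M'\<^sup>2 * (M' - 1) + M' < r'" unfolding M1 by (simp add: algebra_simps)
  have r2: "d'\<^sup>2 \<le> M' * r'"
  proof -
    have "int (d ^ 2) \<le> int (M * r)" using r(2) by (simp only: of_nat_le_iff)
    then show ?thesis by (simp add: defs)
  qed
  have ab1: "a' * b' + 1 \<le> M'\<^sup>2"
  proof -
    have "int (a * b) < int (M ^ 2)" using ab(3) by (simp only: of_nat_less_iff)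
    then show ?thesis by (simp add: defs)
  qed
  \<comment> \<open>For positive numbers \<open>a + b\<close> is at most \<open>a * b + 1\<close>,
    which is at most \<open>M ^ 2\<close> here.\<close>
  have ab2: "a' + b' \<le> M'\<^sup>2"
  proof -
    have "0 \<le> (a' - 1) * (b' - 1)" using ab by (simp add: defs)
    then show ?thesis using ab1 by (simp add: algebra_simps)
  qed
  have "(a' * r' + d') * (b' * r' + d') = (a' * b') * r'\<^sup>2 + (a' + b') * (d' * r') + d'\<^sup>2"
    by (simp add: power2_eq_square algebra_simps)
  also have "\<dots> \<le> (M'\<^sup>2 - 1) * r'\<^sup>2 + M'\<^sup>2 * (d' * r') + M' * r'"
    using ab1 ab2 r2 pos by (intro add_mono mult_right_mono) auto
  \<comment> \<open>Losing one in the leading coefficient costs a whole \<open>r' * r'\<close>, and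
    \<open>r1\<close> says that this exceeds all terms linear in \<open>r'\<close>.\<close>
  also have "\<dots> < M'\<^sup>2 * r'\<^sup>2 - M'\<^sup>2 * (M' - 1) * r'"
  proof -
    have "(M'\<^sup>2 * d' + M'\<^sup>2 * (M' - 1) + M') * r' < r' * r'"
      using r1 pos by (intro mult_strict_right_mono) auto
    then show ?thesis by (simp add: power2_eq_square algebra_simps)
  qed
  finally have lt: "(a' * r' + d') * (b' * r' + d') < M'\<^sup>2 * r'\<^sup>2 - M'\<^sup>2 * (M' - 1) * r'" .
  have "int (X * Y) \<le> ((a' * r' + d') * v') * ((b' * r' + d') * v')"
  proof -
    have "X * Y \<le> ((a * r + d) * v) * ((b * r + d) * v)" using X Y by (intro mult_mono) auto
    then have "int (X * Y) \<le> int (((a * r + d) * v) * ((b * r + d) * v))" by (simp only: of_nat_le_iff)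
    then show ?thesis by (simp add: defs)
  qed
  also have "\<dots> = ((a' * r' + d') * (b' * r' + d')) * v'\<^sup>2" by (simp add: power2_eq_square algebra_simps)
  also have "\<dots> < (M'\<^sup>2 * r'\<^sup>2 - M'\<^sup>2 * (M' - 1) * r') * v'\<^sup>2"
    using lt pos by (intro mult_strict_right_mono) auto
  also have "\<dots> \<le> (int N)\<^sup>2"
    unfolding defs using square_lower_bound_nat[OF M C N] r(1) by linarith
  also have "\<dots> = int (N * N)" by (simp add: power2_eq_square)
  finally show ?thesis by (simp only: of_nat_less_iff)
qed

lemma product_lt_of_large_cover:
  fixes r v d M C N X :: nat
  assumes X: "2 * X \<le> M ^ 2 * (M ^ 2 * d) * r * v ^ 2"
    and M: "1 \<le> M" and C: "2 * C \<le> M * (M - 1)"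
    and N: "M * r * v \<le> N + C * v" and v: "1 \<le> v"
    and r: "M ^ 2 * (d + (M - 1)) + M < r"
  shows "X < N * N"
proof -
  define r' v' d' M' where defs: "r' = int r" "v' = int v" "d' = int d" "M' = int M"
  have pos: "0 \<le> r'" "0 \<le> d'" "1 \<le> v'" "1 \<le> M'" "0 < r'"
    using v M r by (auto simp: defs)
  have M1: "int (M - 1) = M' - 1" using M by (simp add: defs of_nat_diff)
  have "int (M ^ 2 * (d + (M - 1)) + M) < int r" using r by (simp only: of_nat_less_iff)
  then have "M'\<^sup>2 * (d' + int (M - 1)) + M' < r'" by (simp only: defs of_nat_add of_nat_mult of_nat_power)
  then have r1: "M'\<^sup>2 * d' + M'\<^sup>2 * (M' - 1) + M' < r'" unfolding M1 by (simp add: algebra_simps)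
  have "0 \<le> M'\<^sup>2 * d'" using pos by simp
  moreover have "1 * (M' - 1) \<le> M'\<^sup>2 * (M' - 1)"
    using pos by (intro mult_right_mono) auto
  ultimately have "M'\<^sup>2 * d' < 2 * r' - 2 * (M' - 1)" using r1 pos by linarith
  then have "M'\<^sup>2 * r' * (M'\<^sup>2 * d') < M'\<^sup>2 * r' * (2 * r' - 2 * (M' - 1))"
    using pos by (intro mult_strict_left_mono) auto
  then have lt: "M'\<^sup>2 * (M'\<^sup>2 * d') * r' < 2 * (M'\<^sup>2 * r'\<^sup>2 - M'\<^sup>2 * (M' - 1) * r')"
    by (simp add: power2_eq_square algebra_simps)
  have "2 * int X \<le> M'\<^sup>2 * (M'\<^sup>2 * d') * r' * v'\<^sup>2"
  proof -
    have "int (2 * X) \<le> int (M ^ 2 * (M ^ 2 * d) * r * v ^ 2)" using X by (simp only: of_nat_le_iff)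
    then show ?thesis by (simp add: defs)
  qed
  also have "\<dots> < 2 * (M'\<^sup>2 * r'\<^sup>2 - M'\<^sup>2 * (M' - 1) * r') * v'\<^sup>2"
    using lt pos by (intro mult_strict_right_mono) auto
  also have "\<dots> \<le> 2 * (int N)\<^sup>2"
    unfolding defs using square_lower_bound_nat[OF M C N] r by (simp only: mult.assoc) linarith
  finally have "int X < int (N * N)" by (simp add: power2_eq_square)
  then show ?thesis by (simp only: of_nat_less_iff)
qed

section \<open>The constructions\<close>

lemma ex_U:
  assumes "0 < c" "j \<le> k" obtains A where "A \<in> U c k j"
proof -
  have "{} \<in> U c k 0" by (simp add: U_def)
  then have "0 < card (star c k {})" using card_star assms(1) npart_pos by simp
  then obtain F where "F \<in> star c k {}" by (metis card_gt_0_iff ex_in_conv)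
  then have F: "F \<in> U c k k" by (simp add: star_def)
  then have "j \<le> card F" using assms card_U_member by simp
  then obtain A where "A \<subseteq> F" "card A = j" by (metis obtain_subset_with_card_n)
  then show ?thesis using U_subset[OF F] that by metis
qed

lemma star_avoiding_one:
  assumes "6 \<le> c" "A \<in> U c k j" "j + 2 \<le> k" "e \<notin> A"
  obtains F where "F \<in> star c k A" "e \<notin> F"
proof -
  have "card ({e} \<inter> compat c k A) \<le> 1" using card_mono[of "{e}" "{e} \<inter> compat c k A"] by simp
  then have "card ({e} \<inter> compat c k A) * npart c (k - Suc j) \<le> npart c (k - Suc j)" by simp
  also have "\<dots> < npart c (k - j)"
  proof -
    have "2 \<le> k - j" using assms(3) by simp
    then have "96 * npart c (k - Suc j) \<le> npart c (k - j)" using npart_ge_96[OF assms(1)] by fastforce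
    then show ?thesis using npart_pos[of c "k - Suc j"] by linarith
  qed
  finally have "card ({e} \<inter> compat c k A) * npart c (k - Suc j) < npart c (k - j)" .
  moreover have "0 < c" "{e} \<inter> A = {}" using assms(1,4) by auto
  ultimately obtain F where "F \<in> star c k A" "F \<inter> {e} = {}"
    using star_avoiding[OF assms(2), of "{e}"] by blast
  then show ?thesis using that by blast
qed

section \<open>Nontriviality and sizes of the two main families\<close>

lemma card_common_blocks_0:
  assumes "\<And>e. \<exists>F\<in>\<F>. e \<notin> F"
  shows "card (common_blocks c k \<F>) = 0"
proof -
  have "common_blocks c k \<F> = {}" using assms by (auto simp: common_blocks_def)
  then show ?thesis by simp
qed

lemma card_Int_ge:
  assumes "finite Z" "X \<subseteq> Z" "Y \<subseteq> Z"
  shows "card X + card Y \<le> card (X \<inter> Y) + card Z"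
proof -
  have "card X + card Y = card (X \<union> Y) + card (X \<inter> Y)"
    using assms finite_subset by (intro card_Un_Int) blast+
  moreover have "card (X \<union> Y) \<le> card Z" using assms by (intro card_mono) auto
  ultimately show ?thesis by linarith
qed

lemma card_Int_ge_within:
  assumes F: "finite F" and Z: "finite Z"
  shows "card (F \<inter> Z) + card (G \<inter> Z) \<le> card (F \<inter> G) + card Z"
proof -
  have "card (F \<inter> Z) + card (G \<inter> Z) \<le> card ((F \<inter> Z) \<inter> (G \<inter> Z)) + card Z"
    by (rule card_Int_ge[OF Z]) auto
  moreover have "card ((F \<inter> Z) \<inter> (G \<inter> Z)) \<le> card (F \<inter> G)" using F by (intro card_mono) auto
  ultimately show ?thesis by linarith
qed

text \<open>Two members meet within \<open>Z\<close> in at least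
  \<open>2 * (t + 1) - (t + 2) = t\<close> blocks. No block \<open>e\<close> is common to all: some
  \<open>Z - {z}\<close> avoids \<open>e\<close>, and since two blocks or more remain to be chosen,
  it completes to a partition without \<open>e\<close>.\<close>

lemma N2_nontrivial:
  assumes "6 \<le> c" "1 \<le> t" "t + 3 \<le> k" and Z: "Z \<in> U c k (t + 2)"
  shows "nontrivial_cross_pair c k t (N2 c k t Z) (N2 c k t Z)"
proof -
  have fZ: "finite Z" "card Z = t + 2" using Z finite_U_member card_U_member by auto
  have "card (common_blocks c k (N2 c k t Z)) = 0"
  proof (rule card_common_blocks_0)
    fix e
    obtain z where z: "z \<in> Z" "e \<notin> Z - {z}"
    proof (cases "e \<in> Z")
      case True
      then show ?thesis using that[of e] by blast
    next
      case False
      moreover have "Z \<noteq> {}" using fZ by auto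
      ultimately show ?thesis using that by blast
    qed
    have c1: "card (Z - {z}) = t + 1" using fZ z by simp
    have "Z - {z} \<in> U c k (card (Z - {z}))" by (rule U_subset[OF Z]) blast
    then have ZU: "Z - {z} \<in> U c k (t + 1)" using c1 by simp
    have "t + 1 + 2 \<le> k" using assms(3) by simp
    then obtain F where F: "F \<in> star c k (Z - {z})" "e \<notin> F"
      by (rule star_avoiding_one[OF assms(1) ZU _ z(2)])
    have "Z - {z} \<subseteq> F \<inter> Z" using F by (auto simp: star_def)
    then have "t + 1 \<le> card (F \<inter> Z)" using c1 fZ card_mono[of "F \<inter> Z" "Z - {z}"] by simp
    then have "F \<in> N2 c k t Z" using F(1) by (simp add: N2_def star_def)
    then show "\<exists>F\<in>N2 c k t Z. e \<notin> F" using F(2) by blast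
  qed
  moreover have "cross_intersecting t (N2 c k t Z) (N2 c k t Z)"
    unfolding cross_intersecting_def
  proof (intro ballI)
    fix F G assume "F \<in> N2 c k t Z" "G \<in> N2 c k t Z"
    then have "F \<in> U c k k" "t + 1 \<le> card (F \<inter> Z)" "t + 1 \<le> card (G \<inter> Z)"
      by (auto simp: N2_def)
    then show "t \<le> card (F \<inter> G)"
      using card_Int_ge_within[of F Z G] fZ finite_U_member[of F c k k] by linarith
  qed
  moreover have "N2 c k t Z \<subseteq> U c k k" by (auto simp: N2_def)
  ultimately show ?thesis using assms by (simp add: nontrivial_cross_pair_def)
qed

text \<open>The case of equal sets suffices as a competitor, because by \<open>card_N1\<close> the
  size does not depend on \<open>L\<close> and \<open>M\<close>. If not both members contain
  \<open>T\<close>, they meet within \<open>L\<close> in at least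
  \<open>(t + 1) + (k - 2) - (k - 1) = t\<close> blocks.\<close>

lemma N1_nontrivial:
  assumes c: "6 \<le> c" and t: "1 \<le> t" and k: "t + 3 \<le> k" and L: "L \<in> U c k (k - 1)"
    and T: "T \<subseteq> L" "card T = t"
  shows "nontrivial_cross_pair c k t (N1 c k t T L L) (N1 c k t T L L)"
proof -
  have fL: "finite L" "card L = k - 1" using L finite_U_member card_U_member by auto
  have fT: "finite T" using T fL finite_subset by blast
  have "card (common_blocks c k (N1 c k t T L L)) = 0"
  proof (rule card_common_blocks_0)
    fix e
    show "\<exists>F\<in>N1 c k t T L L. e \<notin> F"
    proof (cases "e \<in> T")
      case True
      have c1: "card (L - {e}) = k - 2" using fL True T by auto
      have "L - {e} \<in> U c k (card (L - {e}))" by (rule U_subset[OF L]) blast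
      then have LU: "L - {e} \<in> U c k (k - 2)" using c1 by simp
      have "k - 2 + 2 \<le> k" "e \<notin> L - {e}" using k by auto
      then obtain F where F: "F \<in> star c k (L - {e})" "e \<notin> F"
        by (rule star_avoiding_one[OF c LU])
      have "F \<inter> L = L - {e}" using F by (auto simp: star_def)
      then have "F \<in> N1 c k t T L L" using F True c1 by (auto simp: N1_def star_def)
      then show ?thesis using F(2) by blast
    next
      case False
      have "card (L - T) = k - 1 - t" using fL fT T by (simp add: card_Diff_subset)
      then have "\<not> L - T \<subseteq> {e}" using k card_mono[of "{e}" "L - T"] by auto
      then obtain a where a: "a \<in> L" "a \<notin> T" "a \<noteq> e" by blast
      have c1: "card (insert a T) = t + 1" using a T fT by simp
      have "insert a T \<in> U c k (card (insert a T))" by (rule U_subset[OF L]) (use a T in blast)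
      then have aU: "insert a T \<in> U c k (t + 1)" using c1 by simp
      have "t + 1 + 2 \<le> k" "e \<notin> insert a T" using k False a by auto
      then obtain F where F: "F \<in> star c k (insert a T)" "e \<notin> F"
        by (rule star_avoiding_one[OF c aU])
      have "insert a T \<subseteq> F \<inter> L" using F a T by (auto simp: star_def)
      then have "t + 1 \<le> card (F \<inter> L)" using c1 fL card_mono[of "F \<inter> L" "insert a T"] by simp
      then have "F \<in> N1 c k t T L L" using F by (auto simp: N1_def star_def)
      then show ?thesis using F(2) by blast
    qed
  qed
  moreover have "cross_intersecting t (N1 c k t T L L) (N1 c k t T L L)"
    unfolding cross_intersecting_def
  proof (intro ballI)
    fix F G assume F: "F \<in> N1 c k t T L L" and G: "G \<in> N1 c k t T L L"
    then have "F \<in> U c k k" by (auto simp: N1_def)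
    then have fF: "finite F" by (rule finite_U_member)
    have FL: "T \<subseteq> F \<and> t + 1 \<le> card (F \<inter> L) \<or> card (F \<inter> L) = k - 2"
      and GL: "T \<subseteq> G \<and> t + 1 \<le> card (G \<inter> L) \<or> card (G \<inter> L) = k - 2"
      using F G by (auto simp: N1_def)
    show "t \<le> card (F \<inter> G)"
    proof (cases "T \<subseteq> F \<and> T \<subseteq> G")
      case True
      then have "T \<subseteq> F \<inter> G" by blast
      then show ?thesis using T(2) fF card_mono[of "F \<inter> G" T] by simp
    next
      case False
      then have "t + 1 + (k - 2) \<le> card (F \<inter> L) + card (G \<inter> L)" using FL GL k by linarith
      then show ?thesis using card_Int_ge_within[OF fF fL(1), of G] fL(2) k by linarith
    qed
  qed
  moreover have "N1 c k t T L L \<subseteq> U c k k" by (auto simp: N1_def)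
  ultimately show ?thesis using t by (simp add: nontrivial_cross_pair_def)
qed

text \<open>The partitions through \<open>Z - {z}\<close> but not through \<open>Z\<close> are
  disjoint for different \<open>z\<close>. Together with those through \<open>Z\<close> they give
  \<open>(t + 2) * (u - v) + v\<close>.\<close>

lemma card_N2_ge:
  assumes c: "0 < c" and k: "t + 2 \<le> k" and Z: "Z \<in> U c k (t + 2)"
  shows "(t + 2) * npart c (k - (t + 1)) \<le> card (N2 c k t Z) + (t + 1) * npart c (k - (t + 2))"
proof -
  have fZ: "finite Z" "card Z = t + 2" using Z finite_U_member card_U_member by auto
  let ?u = "npart c (k - (t + 1))" and ?v = "npart c (k - (t + 2))"
  let ?E = "\<lambda>z. star c k (Z - {z}) - star c k Z"
  have Fz: "F \<inter> Z = Z - {z}" if "F \<in> ?E z" "z \<in> Z" for F z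
    using that unfolding star_def by blast
  have "card (\<Union>z\<in>Z. ?E z) = (\<Sum>z\<in>Z. card (?E z))"
  proof (rule card_UN_disjoint[OF fZ(1)])
    show "\<forall>i\<in>Z. \<forall>j\<in>Z. i \<noteq> j \<longrightarrow> ?E i \<inter> ?E j = {}"
    proof (intro ballI impI)
      fix i j assume ij: "i \<in> Z" "j \<in> Z" "i \<noteq> j"
      show "?E i \<inter> ?E j = {}"
      proof (rule ccontr)
        assume "?E i \<inter> ?E j \<noteq> {}"
        then obtain F where "F \<in> ?E i" "F \<in> ?E j" by blast
        then have "Z - {i} = Z - {j}" using Fz ij by metis
        then show False using ij by blast
      qed
    qed
  qed simp
  also have "\<dots> = (\<Sum>z\<in>Z. ?u - ?v)"
  proof (rule sum.cong)
    fix z assume z: "z \<in> Z"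
    have "Z - {z} \<in> U c k (card (Z - {z}))" by (rule U_subset[OF Z]) blast
    then have "card (star c k (Z - {z})) = ?u" using card_star[OF _ c] fZ z by simp
    moreover have "card (star c k Z) = ?v" using card_star[OF Z c] .
    moreover have "star c k Z \<subseteq> star c k (Z - {z})" by (auto simp: star_def)
    ultimately show "card (?E z) = ?u - ?v" by (simp add: card_Diff_subset)
  qed simp
  finally have 1: "card (\<Union>z\<in>Z. ?E z) = (t + 2) * (?u - ?v)" using fZ by simp
  have "card ((\<Union>z\<in>Z. ?E z) \<union> star c k Z) = card (\<Union>z\<in>Z. ?E z) + card (star c k Z)"
    using fZ by (intro card_Un_disjoint) auto
  then have 2: "card ((\<Union>z\<in>Z. ?E z) \<union> star c k Z) = (t + 2) * (?u - ?v) + ?v"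
    using 1 card_star[OF Z c] by simp
  have "(\<Union>z\<in>Z. ?E z) \<union> star c k Z \<subseteq> N2 c k t Z"
  proof
    fix F assume "F \<in> (\<Union>z\<in>Z. ?E z) \<union> star c k Z"
    then consider z where "z \<in> Z" "F \<in> ?E z" | "F \<in> star c k Z" by blast
    then show "F \<in> N2 c k t Z"
    proof cases
      case 1
      have "card (F \<inter> Z) = card (Z - {z})" using Fz[OF 1(2,1)] by simp
      then have "card (F \<inter> Z) = t + 1" using fZ 1(1) by simp
      then show ?thesis using 1 by (simp add: N2_def star_def)
    next
      case 2
      then have "F \<inter> Z = Z" by (auto simp: star_def)
      then show ?thesis using 2 fZ by (simp add: N2_def star_def)
    qed
  qed
  then have "card ((\<Union>z\<in>Z. ?E z) \<union> star c k Z) \<le> card (N2 c k t Z)"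
    by (rule card_mono[rotated]) (simp add: N2_def)
  then have le: "(t + 2) * (?u - ?v) + ?v \<le> card (N2 c k t Z)" using 2 by simp
  have "?v \<le> ?u" using k by (intro npart_mono) simp
  then obtain w where w: "?u = ?v + w" using le_Suc_ex by blast
  show ?thesis using le unfolding w by (simp add: algebra_simps)
qed

text \<open>The second Bonferroni inequality.\<close>

lemma card_UN_ge:
  fixes E :: "'b \<Rightarrow> 'a set"
  assumes "finite I" "\<And>i. i \<in> I \<Longrightarrow> finite (E i)" "\<And>i. i \<in> I \<Longrightarrow> card (E i) = u"
    "\<And>i j. i \<in> I \<Longrightarrow> j \<in> I \<Longrightarrow> i \<noteq> j \<Longrightarrow> card (E i \<inter> E j) \<le> v"
  shows "card I * u \<le> card (\<Union>i\<in>I. E i) + (card I choose 2) * v"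
  using assms
proof (induction I rule: finite_induct)
  case (insert x I)
  let ?W = "\<Union>i\<in>I. E i"
  have IH: "card I * u \<le> card ?W + (card I choose 2) * v" by (rule insert.IH) (use insert.prems in auto)
  have fin: "finite ?W" "finite (E x)" using insert by auto
  have "card (E x) + card ?W = card (E x \<union> ?W) + card (E x \<inter> ?W)"
    by (rule card_Un_Int[OF fin(2,1)])
  moreover have "card (E x \<inter> ?W) \<le> card I * v"
  proof -
    have "E x \<inter> ?W = (\<Union>i\<in>I. E x \<inter> E i)" by blast
    then have "card (E x \<inter> ?W) \<le> (\<Sum>i\<in>I. card (E x \<inter> E i))"
      using card_UN_le[OF insert.hyps(1), of "\<lambda>i. E x \<inter> E i"] by simp
    also have "\<dots> \<le> (\<Sum>i\<in>I. v)" using insert.hyps insert.prems(3) by (intro sum_mono) auto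
    finally show ?thesis by simp
  qed
  moreover have "card (E x) = u" using insert.prems by simp
  moreover have "Suc (card I) choose 2 = (card I choose 2) + card I"
    by (simp add: numeral_2_eq_2)
  ultimately show ?case using IH insert.hyps by (simp add: algebra_simps)
qed simp

definition hit :: "nat \<Rightarrow> nat \<Rightarrow> nat set set \<Rightarrow> nat set set \<Rightarrow> nat set set set" where
  "hit c k A X = {F \<in> star c k A. F \<inter> X \<noteq> {}}"

lemma finite_hit [simp]: "finite (hit c k A X)"
  by (simp add: hit_def)

lemma hit_UN: "hit c k A X = (\<Union>e\<in>X. star c k (insert e A))"
  by (auto simp: hit_def star_def)

lemma N1_split:
  assumes "finite L" "T \<subseteq> L" "card T = t"
  shows "N1 c k t T L M = hit c k T (L - T) \<union> {F \<in> U c k k. \<not> T \<subseteq> F \<and> card (F \<inter> M) = k - 2}"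
proof -
  have "t + 1 \<le> card (F \<inter> L) \<longleftrightarrow> F \<inter> (L - T) \<noteq> {}" if "T \<subseteq> F" for F
  proof -
    have "F \<inter> L = T \<union> F \<inter> (L - T)" using that assms(2) by blast
    moreover have "finite T" using assms finite_subset by blast
    ultimately have "card (F \<inter> L) = t + card (F \<inter> (L - T))"
      using assms card_Un_disjoint[of T "F \<inter> (L - T)"] by auto
    moreover have "finite (F \<inter> (L - T))" using assms by simp
    ultimately show ?thesis by (auto simp: card_gt_0_iff Suc_le_eq)
  qed
  then show ?thesis unfolding N1_def hit_def star_def by blast
qed

text \<open>Counts the partitions through \<open>a\<close> given blocks that meet \<open>x\<close>
  further ones, by inclusion and exclusion on one of the latter. That such a recursion exists shows
  the count to depend on the numbers \<open>a\<close> and \<open>x\<close> only.\<close>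

fun nhit :: "nat \<Rightarrow> nat \<Rightarrow> nat \<Rightarrow> nat \<Rightarrow> int" where
  "nhit c k a 0 = 0"
| "nhit c k a (Suc x) = nhit c k a x + int (npart c (k - Suc a)) - nhit c k (Suc a) x"

lemma card_hit:
  assumes c: "0 < c" and "finite X" "A \<inter> X = {}" "A \<union> X \<in> U c k (a + card X)" "card A = a"
  shows "int (card (hit c k A X)) = nhit c k a (card X)"
  using assms(2-)
proof (induction X arbitrary: A a rule: finite_induct)
  case empty
  then show ?case by (simp add: hit_def)
next
  case (insert e X)
  have AX: "A \<union> insert e X \<in> U c k (Suc a + card X)" using insert by simp
  have fA: "finite A" using finite_U_member[OF AX] by simp
  have cAX: "card (A \<union> X) = a + card X"
    using insert fA by (subst card_Un_disjoint) auto
  have "A \<union> X \<in> U c k (card (A \<union> X))" by (rule U_subset[OF AX]) blast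
  then have 1: "int (card (hit c k A X)) = nhit c k a (card X)"
    using insert cAX by (intro insert.IH) auto
  have eA: "e \<notin> A" using insert.prems by blast
  then have ceA: "card (insert e A) = Suc a" using insert.prems fA by simp
  have 2: "int (card (hit c k (insert e A) X)) = nhit c k (Suc a) (card X)"
    by (rule insert.IH) (use insert AX ceA in auto)
  have "insert e A \<in> U c k (card (insert e A))" by (rule U_subset[OF AX]) blast
  then have 3: "card (star c k (insert e A)) = npart c (k - Suc a)" using card_star c ceA by simp
  \<comment> \<open>The recursion of \<open>nhit\<close>: the partitions containing the new block
    are added, and those that also meet \<open>X\<close> were counted twice.\<close>
  have "hit c k A (insert e X) = hit c k A X \<union> star c k (insert e A)"
    by (auto simp: hit_def star_def)
  moreover have "hit c k A X \<inter> star c k (insert e A) = hit c k (insert e A) X"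
    by (auto simp: hit_def star_def)
  ultimately have "card (hit c k A X) + card (star c k (insert e A)) =
      card (hit c k A (insert e X)) + card (hit c k (insert e A) X)"
    using card_Un_Int[of "hit c k A X" "star c k (insert e A)"] by simp
  then show ?case using 1 2 3 insert.hyps by simp
qed

text \<open>Such a partition misses exactly one block \<open>z\<close> of \<open>M\<close>, and
  \<open>z\<close> lies in \<open>T\<close>. Of the \<open>npart c 2\<close> partitions through
  \<open>M - {z}\<close>, the one containing \<open>M\<close> is removed.\<close>

lemma card_swap_part:
  assumes c: "0 < c" and k: "2 \<le> k" and M: "M \<in> U c k (k - 1)" and T: "T \<subseteq> M" "card T = t"
  shows "card {F \<in> U c k k. \<not> T \<subseteq> F \<and> card (F \<inter> M) = k - 2} = t * (npart c 2 - 1)"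
proof -
  have fM: "finite M" "card M = k - 1" using M finite_U_member card_U_member by auto
  have fT: "finite T" using T fM finite_subset by blast
  let ?E = "\<lambda>z. star c k (M - {z}) - star c k M"
  have Fz: "F \<inter> M = M - {z}" if "F \<in> ?E z" "z \<in> T" for F z
    using that T unfolding star_def by blast
  have eq: "{F \<in> U c k k. \<not> T \<subseteq> F \<and> card (F \<inter> M) = k - 2} = (\<Union>z\<in>T. ?E z)"
  proof (intro equalityI subsetI)
    fix F assume "F \<in> {F \<in> U c k k. \<not> T \<subseteq> F \<and> card (F \<inter> M) = k - 2}"
    then have F: "F \<in> U c k k" "\<not> T \<subseteq> F" "card (F \<inter> M) = k - 2" by auto
    then obtain z where z: "z \<in> T" "z \<notin> F" by blast
    have "F \<inter> M = M - {z}"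
    proof (rule card_subset_eq)
      show "card (F \<inter> M) = card (M - {z})" using F fM z T by auto
    qed (use fM z in auto)
    then have "F \<in> ?E z" using F z T by (auto simp: star_def)
    then show "F \<in> (\<Union>z\<in>T. ?E z)" using z by blast
  next
    fix F assume "F \<in> (\<Union>z\<in>T. ?E z)"
    then obtain z where z: "z \<in> T" "F \<in> ?E z" by blast
    then have "F \<inter> M = M - {z}" using Fz by blast
    moreover have "card (M - {z}) = k - 2" using fM z T by auto
    moreover have "z \<notin> F" using calculation z T by blast
    ultimately show "F \<in> {F \<in> U c k k. \<not> T \<subseteq> F \<and> card (F \<inter> M) = k - 2}"
      using z by (auto simp: star_def)
  qed
  have "card (\<Union>z\<in>T. ?E z) = (\<Sum>z\<in>T. card (?E z))"
  proof (rule card_UN_disjoint[OF fT])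
    show "\<forall>i\<in>T. \<forall>j\<in>T. i \<noteq> j \<longrightarrow> ?E i \<inter> ?E j = {}"
    proof (intro ballI impI)
      fix i j assume ij: "i \<in> T" "j \<in> T" "i \<noteq> j"
      show "?E i \<inter> ?E j = {}"
      proof (rule ccontr)
        assume "?E i \<inter> ?E j \<noteq> {}"
        then obtain F where "F \<in> ?E i" "F \<in> ?E j" by blast
        then have "M - {i} = M - {j}" using Fz ij by metis
        then show False using ij T by blast
      qed
    qed
  qed simp
  also have "\<dots> = (\<Sum>z\<in>T. npart c 2 - 1)"
  proof (rule sum.cong)
    fix z assume z: "z \<in> T"
    have "card (M - {z}) = k - 2" using fM z T by auto
    moreover have "M - {z} \<in> U c k (card (M - {z}))" by (rule U_subset[OF M]) blast
    ultimately have "card (star c k (M - {z})) = npart c 2" using card_star[OF _ c] k by simp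
    moreover have "card (star c k M) = 1" using card_star[OF M c] k by simp
    moreover have "star c k M \<subseteq> star c k (M - {z})" by (auto simp: star_def)
    ultimately show "card (?E z) = npart c 2 - 1" by (simp add: card_Diff_subset)
  qed simp
  finally show ?thesis using eq T by simp
qed

text \<open>The formula involves neither \<open>L\<close> nor \<open>M\<close>. So all pairs of the
  first kind have the same product, and a family contained in one can be compared with the case of
  equal sets.\<close>

lemma card_N1:
  assumes c: "0 < c" and k: "2 \<le> k" "t + m + 1 = k"
    and L: "L \<in> U c k (k - 1)" and M: "M \<in> U c k (k - 1)"
    and T: "T \<subseteq> L" "T \<subseteq> M" "card T = t"
  shows "int (card (N1 c k t T L M)) = nhit c k t m + int (t * (npart c 2 - 1))"
proof -
  have fL: "finite L" "card L = k - 1" using L finite_U_member card_U_member by auto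
  have fT: "finite T" using T fL finite_subset by blast
  have cLT: "card (L - T) = m" using fL fT T k by (simp add: card_Diff_subset)
  have "T \<union> (L - T) = L" using T by blast
  then have "int (card (hit c k T (L - T))) = nhit c k t m"
    using card_hit[OF c, of "L - T" T k t] fL cLT L T(3) k by auto
  moreover have "card (hit c k T (L - T) \<union> {F \<in> U c k k. \<not> T \<subseteq> F \<and> card (F \<inter> M) = k - 2}) =
      card (hit c k T (L - T)) + card {F \<in> U c k k. \<not> T \<subseteq> F \<and> card (F \<inter> M) = k - 2}"
    by (rule card_Un_disjoint) (auto simp: hit_def star_def)
  ultimately show ?thesis
    using N1_split[OF fL(1) T(1,3), of c k M] card_swap_part[OF c k(1) M T(2,3)] by simp
qed

lemma card_N1_ge:
  assumes c: "0 < c" and k: "t + m + 1 = k"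
    and L: "L \<in> U c k (k - 1)" and T: "T \<subseteq> L" "card T = t"
  shows "m * npart c (k - (t + 1)) \<le> card (N1 c k t T L L) + (m choose 2) * npart c (k - (t + 2))"
proof -
  have fL: "finite L" "card L = k - 1" using L finite_U_member card_U_member by auto
  have fT: "finite T" using T fL finite_subset by blast
  have cLT: "card (L - T) = m" using fL fT T k by (simp add: card_Diff_subset)
  have "card (L - T) * npart c (k - (t + 1)) \<le>
      card (\<Union>e\<in>L - T. star c k (insert e T)) + (card (L - T) choose 2) * npart c (k - (t + 2))"
  proof (rule card_UN_ge)
    fix i assume i: "i \<in> L - T"
    have ci: "card (insert i T) = t + 1" using i fT T by simp
    have "insert i T \<in> U c k (card (insert i T))" by (rule U_subset[OF L]) (use i T in blast)
    then have iU: "insert i T \<in> U c k (t + 1)" using ci by simp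
    then show "card (star c k (insert i T)) = npart c (k - (t + 1))" using card_star[OF _ c] by simp
    fix j assume j: "j \<in> L - T" "i \<noteq> j"
    have "star c k (insert i T) \<inter> star c k (insert j T) = star c k (insert j (insert i T))"
      by (auto simp: star_def)
    then show "card (star c k (insert i T) \<inter> star c k (insert j T)) \<le> npart c (k - (t + 2))"
      using card_star_insert_le[OF iU _ c, of j] j by simp
  qed (use fL in auto)
  moreover have "(\<Union>e\<in>L - T. star c k (insert e T)) \<subseteq> N1 c k t T L L"
    unfolding N1_split[OF fL(1) T, of c k L] hit_UN by (rule Un_upper1)
  then have "card (\<Union>e\<in>L - T. star c k (insert e T)) \<le> card (N1 c k t T L L)"
    by (rule card_mono[rotated]) (simp add: N1_def)
  ultimately show ?thesis using cLT by simp
qed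

lemma nhit_ge:
  assumes c: "0 < c" and x: "1 \<le> x" "a + x \<le> k"
  shows "int (npart c (k - Suc a)) \<le> nhit c k a x"
proof -
  obtain B where B: "B \<in> U c k (a + x)" using ex_U c x by metis
  have fB: "finite B" "card B = a + x" using B finite_U_member card_U_member by auto
  then obtain A where A: "A \<subseteq> B" "card A = a" by (metis le_add1 obtain_subset_with_card_n)
  have fA: "finite A" using A fB finite_subset by blast
  have cX: "card (B - A) = x" using A fB fA by (simp add: card_Diff_subset)
  have AB: "A \<union> (B - A) = B" using A by blast
  have "B - A \<noteq> {}" using cX x by (metis card.empty not_one_le_zero)
  then obtain e where e: "e \<in> B" "e \<notin> A" by blast
  have ceA: "card (insert e A) = Suc a" using e A fA by simp
  have "insert e A \<in> U c k (card (insert e A))" by (rule U_subset[OF B]) (use e A in blast)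
  then have "card (star c k (insert e A)) = npart c (k - Suc a)" using card_star c ceA by simp
  moreover have "star c k (insert e A) \<subseteq> hit c k A (B - A)"
    using e by (auto simp: hit_def star_def)
  then have "card (star c k (insert e A)) \<le> card (hit c k A (B - A))" by (intro card_mono) auto
  moreover have "int (card (hit c k A (B - A))) = nhit c k a x"
    using card_hit[OF c, of "B - A" A k a] fB A cX AB B by auto
  ultimately show ?thesis by linarith
qed

text \<open>For \<open>x = 3\<close> this is inclusion and exclusion with equality; every further
  block adds \<open>u\<close> and removes at least \<open>v\<close>.\<close>

lemma nhit_le:
  assumes c: "0 < c" and x: "3 \<le> x" "a + x < k"
  shows "nhit c k a x \<le> int x * int (npart c (k - (a + 1))) - int x * int (npart c (k - (a + 2)))
    + int (npart c (k - (a + 3)))"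
  using x
proof (induction x rule: nat_induct_at_least)
  case base
  show ?case by (simp add: numeral_3_eq_3)
next
  case (Suc x)
  then have "int (npart c (k - Suc (Suc a))) \<le> nhit c k (Suc a) x" by (intro nhit_ge c) auto
  then show ?case using Suc by (simp add: algebra_simps)
qed

text \<open>At \<open>k = 2 * t + 3\<close> both sizes have the leading term
  \<open>(t + 2) * ?u\<close>, so the coefficients of \<open>?v\<close> decide: one more
  \<open>?v\<close> is lost on the left.\<close>

lemma card_N1_less_N2:
  assumes c: "6 \<le> c" and t: "2 \<le> t" and k: "k = 2 * t + 3"
    and L: "L \<in> U c k (k - 1)" and M: "M \<in> U c k (k - 1)"
    and T: "T \<subseteq> L" "T \<subseteq> M" "card T = t" and Z: "Z \<in> U c k (t + 2)"
  shows "card (N1 c k t T L M) < card (N2 c k t Z)"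
proof -
  let ?u = "npart c (k - (t + 1))" and ?v = "npart c (k - (t + 2))" and ?w = "npart c (k - (t + 3))"
  have c0: "0 < c" using c by simp
  have "int (card (N1 c k t T L M)) = nhit c k t (t + 2) + int (t * (npart c 2 - 1))"
    using k t by (intro card_N1[OF c0 _ _ L M T]) auto
  moreover have "nhit c k t (t + 2) \<le> int (t + 2) * int ?u - int (t + 2) * int ?v + int ?w"
    using k t by (intro nhit_le[OF c0]) auto
  \<comment> \<open>The remaining terms on the left do not make up for that \<open>?v\<close>. At
    \<open>t = 1\<close> the two sides would be equal, which is why the lemma starts at 2.\<close>
  moreover have "t * (npart c 2 - 1) + ?w < ?v"
  proof -
    have "npart c 2 \<le> ?w" using k t by (intro npart_mono) auto
    then have "npart c 2 - 1 \<le> ?w" by simp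
    then have "t * (npart c 2 - 1) + ?w \<le> t * ?w + ?w" by (intro add_right_mono mult_left_mono) auto
    also have "\<dots> = (t + 1) * ?w" by simp
    also have "\<dots> < (3 * (t + 1)) * ?w" using npart_pos[of c "k - (t + 3)"] by (intro mult_strict_right_mono) auto
    also have "\<dots> \<le> 3 * (k - (t + 2)) ^ (c - 1) * ?w"
    proof (rule mult_right_mono)
      have "(t + 1) ^ 1 \<le> (k - (t + 2)) ^ 1" using k by simp
      also have "\<dots> \<le> (k - (t + 2)) ^ (c - 1)" using k c by (intro power_increasing) auto
      finally show "3 * (t + 1) \<le> 3 * (k - (t + 2)) ^ (c - 1)" by simp
    qed simp
    also have "\<dots> \<le> ?v" using npart_Suc_ge[OF c, of "k - (t + 2)"] k t by simp
    finally show ?thesis .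
  qed
  moreover have "(t + 2) * ?u \<le> card (N2 c k t Z) + (t + 1) * ?v"
    using k by (intro card_N2_ge[OF c0 _ Z]) simp
  then have "int ((t + 2) * ?u) \<le> int (card (N2 c k t Z) + (t + 1) * ?v)" by (simp only: of_nat_le_iff)
  ultimately have "int (card (N1 c k t T L M)) < int (card (N2 c k t Z))"
    by (simp add: algebra_simps)
  then show ?thesis by simp
qed

section \<open>Maximal pairs\<close>

definition covers :: "nat \<Rightarrow> nat \<Rightarrow> nat \<Rightarrow> nat set set set \<Rightarrow> nat set set set" where
  "covers c k t \<F> = {A \<in> U c k (t + 1). cover t \<F> A}"

locale maximal_pair =
  fixes c k t m :: nat and \<F> \<G> :: "nat set set set"
  assumes t: "1 \<le> t" and c: "6 \<le> c" and k: "k = t + m + 1" and m: "2 \<le> m"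
    and pair: "nontrivial_cross_pair c k t \<F> \<G>"
    and cond: "2 * t + 3 \<le> k \<or> 7 \<le> c \<and> t ^ 4 \<le> 2 ^ (c - 7)"
    and maxi: "\<And>\<F>' \<G>'. nontrivial_cross_pair c k t \<F>' \<G>' \<Longrightarrow>
      card \<F>' * card \<G>' \<le> card \<F> * card \<G>"
begin

text \<open>In terms of the overview \<open>u\<close> is \<open>r * v\<close>, and the constructions
  have about \<open>M * u\<close> members. By \<open>card_G_le_covers\<close>, \<open>d * v\<close>
  bounds the members of \<open>\<G>\<close> that contain no cover with \<open>t + 1\<close>
  blocks.\<close>

definition M where "M = max m (t + 2)"
definition d where "d = (t + 1) * (m + 1) * m"
definition r where "r = (c * m - 1) choose (c - 1)"
definition v where "v = npart c (m - 1)"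

lemma c0: "0 < c" using c by simp

lemma FU: "\<F> \<subseteq> U c k k" and GU: "\<G> \<subseteq> U c k k" and cross: "cross_intersecting t \<F> \<G>"
  and commonF: "card (common_blocks c k \<F>) < t" and commonG: "card (common_blocks c k \<G>) < t"
  using pair by (auto simp: nontrivial_cross_pair_def)

lemma finF: "finite \<F>" and finG: "finite \<G>"
  by (rule finite_subset[OF FU finite_U], rule finite_subset[OF GU finite_U])

lemma swap: "maximal_pair c k t m \<G> \<F>"
proof
  have sym: "nontrivial_cross_pair c k t \<Y> \<X>" if "nontrivial_cross_pair c k t \<X> \<Y>" for \<X> \<Y>
    using that Int_commute unfolding nontrivial_cross_pair_def cross_intersecting_def by metis
  show "nontrivial_cross_pair c k t \<G> \<F>" using sym[OF pair] .
  show "card \<F>' * card \<G>' \<le> card \<G> * card \<F>" if "nontrivial_cross_pair c k t \<F>' \<G>'" for \<F>' \<G>'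
    using maxi[OF sym[OF that]] by (simp add: mult.commute)
qed (use t c k m cond in auto)

lemma M_bounds: "m \<le> M" "t + 2 \<le> M" "1 \<le> M"
  by (auto simp: M_def)

lemma npart_m: "npart c m = r * v"
  unfolding r_def v_def using m by (cases m) auto

lemma v_pos: "1 \<le> v"
  using npart_pos[of c "m - 1"] by (simp add: v_def)

lemma r_bounds: "M ^ 2 * (d + (M - 1)) + M < r" "d ^ 2 \<le> M * r"
  unfolding M_def d_def r_def
  by (rule ratio_bounds[OF c t k m cond binomial_ratio_ge[OF c m]])+

lemma k_diff: "k - (t + 1) = m" "k - (t + 2) = m - 1" "k - Suc t = m" "k - Suc (Suc t) = m - 1"
  using k by auto

text \<open>\<open>N\<close> is the size of \<open>N1\<close> or \<open>N2\<close>, whichever has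
  the larger leading coefficient, and \<open>C\<close> is its coefficient of \<open>v\<close>:
  \<open>m choose 2\<close> in one case and \<open>t + 1\<close> in the other.\<close>

lemma lower_bound:
  obtains N C where "N * N \<le> card \<F> * card \<G>" "M * r * v \<le> N + C * v" "2 * C \<le> M * (M - 1)"
proof (cases "t + 2 \<le> m")
  case True
  then have M: "M = m" by (simp add: M_def)
  obtain L where L: "L \<in> U c k (k - 1)" using ex_U[OF c0, of "k - 1" k] by auto
  have "t \<le> card L" using card_U_member[OF L] k by simp
  then obtain T where T: "T \<subseteq> L" "card T = t" by (metis obtain_subset_with_card_n)
  have "t + 3 \<le> k" using k m by simp
  then have "card (N1 c k t T L L) * card (N1 c k t T L L) \<le> card \<F> * card \<G>"
    by (rule maxi[OF N1_nontrivial[OF c t _ L T]])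
  moreover have "m * npart c m \<le> card (N1 c k t T L L) + (m choose 2) * v"
    using card_N1_ge[OF c0 k[symmetric] L T] by (simp add: k_diff v_def)
  then have "M * r * v \<le> card (N1 c k t T L L) + (m choose 2) * v" unfolding M npart_m by (simp only: mult.assoc)
  moreover have "2 * (m choose 2) \<le> M * (M - 1)" by (simp add: M choose_two)
  ultimately show ?thesis by (rule that)
next
  case False
  then have M: "M = t + 2" by (simp add: M_def)
  obtain Z where Z: "Z \<in> U c k (t + 2)" using ex_U[OF c0, of "t + 2" k] k m by auto
  have "t + 3 \<le> k" using k m by simp
  then have "card (N2 c k t Z) * card (N2 c k t Z) \<le> card \<F> * card \<G>"
    by (rule maxi[OF N2_nontrivial[OF c t _ Z]])
  moreover have "(t + 2) * npart c m \<le> card (N2 c k t Z) + (t + 1) * v"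
    using card_N2_ge[OF c0 _ Z] k m by (simp add: k_diff v_def)
  then have "M * r * v \<le> card (N2 c k t Z) + (t + 1) * v" unfolding M npart_m by (simp only: mult.assoc)
  moreover have "2 * (t + 1) \<le> M * (M - 1)" by (simp add: M)
  ultimately show ?thesis by (rule that)
qed

lemma product_pos: "0 < card \<F> * card \<G>"
proof -
  obtain N C where "N * N \<le> card \<F> * card \<G>" "M * r * v \<le> N + C * v" "2 * C \<le> M * (M - 1)"
    by (rule lower_bound)
  \<comment> \<open>For \<open>X = 0\<close> the comparison of products says just that
    \<open>N\<close> is positive.\<close>
  moreover from this have "0 < N * N"
    using product_lt_of_large_cover[of 0 M d r v C N] M_bounds(3) v_pos r_bounds(1) by simp
  ultimately show ?thesis by linarith
qed

section \<open>Covering numbers\<close>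

lemma F_ne: "\<F> \<noteq> {}" and G_ne: "\<G> \<noteq> {}"
  using product_pos by auto

text \<open>A cover with at most \<open>t\<close> blocks has exactly \<open>t\<close>, and all of
  them lie in every member, against nontriviality.\<close>

lemma not_cover_small:
  assumes S: "S \<in> U c k j" and j: "j \<le> t"
  shows "\<not> cover t \<F> S"
proof
  assume cov: "cover t \<F> S"
  have fS: "finite S" "card S = j" using S finite_U_member card_U_member by auto
  have sub: "S \<subseteq> F \<and> card S = t" if "F \<in> \<F>" for F
  proof -
    have "t \<le> card (S \<inter> F)" using cov that by (simp add: cover_def)
    moreover have "card (S \<inter> F) \<le> card S" using fS by (intro card_mono) auto
    ultimately have "card (S \<inter> F) = card S" "card S = t" using fS j by auto
    then have "S \<inter> F = S" using fS by (intro card_subset_eq) auto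
    then show ?thesis using \<open>card S = t\<close> by blast
  qed
  obtain F where "F \<in> \<F>" using F_ne by blast
  then have "card S = t" using sub by blast
  moreover have "S \<subseteq> common_blocks c k \<F>"
    using sub S by (auto simp: common_blocks_def U_def)
  then have "card S \<le> card (common_blocks c k \<F>)"
    by (intro card_mono) (auto simp: common_blocks_def)
  ultimately show False using commonF by simp
qed

text \<open>The covering number of \<open>\<F>\<close>. The least element exists since any member of
  \<open>\<G>\<close> is a cover.\<close>

definition tau where "tau = (LEAST n. \<exists>S\<in>U c k n. cover t \<F> S)"

lemma tau_ex: "\<exists>S\<in>U c k tau. cover t \<F> S" and tau_le: "tau \<le> k"
proof -
  obtain G where G: "G \<in> \<G>" using G_ne by blast
  have "G \<in> U c k k" using G GU by blast
  moreover have "cover t \<F> G"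
    using G cross by (auto simp: cover_def cross_intersecting_def Int_commute)
  ultimately have ex: "\<exists>S\<in>U c k k. cover t \<F> S" by blast
  show "\<exists>S\<in>U c k tau. cover t \<F> S" unfolding tau_def by (rule LeastI[of _ k]) (rule ex)
  show "tau \<le> k" unfolding tau_def by (rule Least_le) (rule ex)
qed

lemma not_cover_below_tau:
  assumes "S \<in> U c k j" "j < tau"
  shows "\<not> cover t \<F> S"
  using not_less_Least[OF assms(2)[unfolded tau_def]] assms(1) by blast

lemma tau_ge: "t + 1 \<le> tau"
proof (rule ccontr)
  assume "\<not> ?thesis"
  then have "tau \<le> t" by simp
  then show False using tau_ex not_cover_small by blast
qed

lemma card_G_le:
  assumes "S \<in> U c k n" "cover t \<G> S"
  shows "card \<G> \<le> (n choose t) * branch_bound c k t tau"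
proof (rule card_le_via_cover[OF c0 FU GU cross _ assms])
  fix G S assume G: "G \<in> \<G>" and S: "S \<subseteq> G" "card S < tau"
  have "G \<in> U c k k" using G GU by blast
  then have "S \<in> U c k (card S)" using S(1) by (rule U_subset)
  then show "\<not> cover t \<F> S" using S(2) by (rule not_cover_below_tau)
qed (use tau_ge in simp)

lemma cover_bound_t1: "cover_bound c k t (t + 1) = (t + 1) * (m + 1) * (r * v)"
  using k by (simp add: cover_bound_def branch_bound_def npart_m[symmetric] algebra_simps)

lemma cover_bound_t2: "2 * cover_bound c k t (t + 2) = (t + 2) * d * v"
proof -
  have "2 * ((t + 2) choose t) = (t + 2) * (t + 1)"
    using binomial_symmetric[of t "t + 2"] by (simp add: choose_two)
  moreover have "branch_bound c k t (t + 2) = (m + 1) * m * v"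
    using k by (simp add: branch_bound_def v_def numeral_2_eq_2)
  ultimately show ?thesis
    unfolding cover_bound_def d_def by (metis (no_types, opaque_lifting) mult.assoc)
qed

lemma d_le: "M ^ 2 * d < r"
proof -
  have "M ^ 2 * d \<le> M ^ 2 * (d + (M - 1))" by (intro mult_left_mono) auto
  then show ?thesis using r_bounds(1) by linarith
qed

lemma cover_bound_le_first:
  assumes "t + 1 \<le> s" "s \<le> k"
  shows "cover_bound c k t s \<le> (t + 1) * (m + 1) * (r * v)"
proof (cases "s = t + 1")
  case True
  then show ?thesis using cover_bound_t1 by simp
next
  case False
  then have "cover_bound c k t s \<le> (t + 1) * cover_bound c k t (t + 2)"
    using assms k m by (intro cover_bound_le[OF c _ _ _ cond]) auto
  then have "2 * cover_bound c k t s \<le> (t + 1) * (2 * cover_bound c k t (t + 2))" by simp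
  also have "\<dots> = (t + 1) * (((t + 2) * d) * v)" unfolding cover_bound_t2 by (simp only: mult.assoc)
  also have "\<dots> \<le> (t + 1) * (r * v)"
  proof (intro mult_left_mono mult_right_mono)
    have "(t + 2) * d \<le> M ^ 2 * d"
      using M_bounds by (intro mult_right_mono) (auto simp: power2_eq_square intro: order_trans[of _ M])
    then show "(t + 2) * d \<le> r" using d_le by simp
  qed auto
  also have "\<dots> \<le> 2 * ((t + 1) * (m + 1) * (r * v))" by (simp add: algebra_simps)
  finally show ?thesis by simp
qed

text \<open>If \<open>tau\<close> were larger, the product would be bounded by an expression linear
  in \<open>r\<close>, whereas \<open>lower_bound\<close> is quadratic in \<open>r\<close>. Only
  this covering number needs the assumption; the other factor is bounded by
  \<open>cover_bound_le_first\<close>.\<close>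

lemma tau_eq: "tau = t + 1"
proof (rule ccontr)
  interpret sw: maximal_pair c k t m \<G> \<F> by (rule swap)
  assume "tau \<noteq> t + 1"
  then have tau: "t + 2 \<le> tau" using tau_ge by simp
  obtain S where S: "S \<in> U c k tau" "cover t \<F> S" using tau_ex by blast
  obtain S' where S': "S' \<in> U c k sw.tau" "cover t \<G> S'" using sw.tau_ex by blast
  have "card \<F> * card \<G> \<le>
      ((tau choose t) * branch_bound c k t sw.tau) * ((sw.tau choose t) * branch_bound c k t tau)"
    using sw.card_G_le[OF S] card_G_le[OF S'] by (rule mult_le_mono)
  \<comment> \<open>The binomials change partners here.\<close>
  also have "\<dots> = cover_bound c k t tau * cover_bound c k t sw.tau"
    by (simp add: cover_bound_def)
  also have "\<dots> \<le> ((t + 1) * cover_bound c k t (t + 2)) * ((t + 1) * (m + 1) * (r * v))"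
  proof (rule mult_le_mono)
    show "cover_bound c k t tau \<le> (t + 1) * cover_bound c k t (t + 2)"
      using tau tau_le k m by (intro cover_bound_le[OF c _ _ _ cond]) auto
    show "cover_bound c k t sw.tau \<le> (t + 1) * (m + 1) * (r * v)"
      using sw.tau_ge sw.tau_le by (rule cover_bound_le_first)
  qed
  finally have "2 * (card \<F> * card \<G>) \<le>
      2 * (((t + 1) * cover_bound c k t (t + 2)) * ((t + 1) * (m + 1) * (r * v)))"
    by (rule mult_left_mono) simp
  also have "\<dots> = (t + 1) * (2 * cover_bound c k t (t + 2)) * ((t + 1) * (m + 1) * (r * v))"
    by (simp only: ac_simps)
  also have "\<dots> = ((t + 1) * (t + 2)) * (((t + 1) * (m + 1)) * d) * r * v ^ 2"
    unfolding cover_bound_t2 by (simp only: power2_eq_square ac_simps)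
  also have "\<dots> \<le> M ^ 2 * (M ^ 2 * d) * r * v ^ 2"
  proof (intro mult_right_mono mult_mono)
    show "(t + 1) * (t + 2) \<le> M ^ 2"
      unfolding power2_eq_square using M_bounds by (intro mult_mono) auto
    obtain n where n: "M = n + 1" using M_bounds(3) by (metis add.commute le_Suc_ex)
    have "(t + 1) * (m + 1) \<le> n * (n + 2)" using M_bounds n by (intro mult_mono) auto
    also have "\<dots> \<le> M ^ 2" by (simp add: n power2_eq_square)
    finally show "(t + 1) * (m + 1) \<le> M ^ 2" .
  qed auto
  finally have X: "2 * (card \<F> * card \<G>) \<le> M ^ 2 * (M ^ 2 * d) * r * v ^ 2" .
  obtain N C where NC: "N * N \<le> card \<F> * card \<G>" "M * r * v \<le> N + C * v" "2 * C \<le> M * (M - 1)"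
    by (rule lower_bound)
  have "card \<F> * card \<G> < N * N"
    by (rule product_lt_of_large_cover[OF X M_bounds(3) NC(3,2) v_pos r_bounds(1)])
  then show False using NC(1) by simp
qed

section \<open>Covers with \<open>t + 1\<close> blocks\<close>

abbreviation \<A> where "\<A> \<equiv> covers c k t \<F>"
abbreviation \<B> where "\<B> \<equiv> covers c k t \<G>"

lemma A_ne: "\<A> \<noteq> {}"
  using tau_ex tau_eq by (auto simp: covers_def)

text \<open>Adding all partitions through a cover of \<open>\<F>\<close> preserves the cross
  intersection and can only shrink the set of common blocks. By maximality, and since
  \<open>\<F>\<close> is nonempty, they are already in \<open>\<G>\<close>.\<close>

lemma star_subset_G:
  assumes "A \<in> \<A>" shows "star c k A \<subseteq> \<G>"
proof -
  let ?G = "\<G> \<union> star c k A"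
  have cov: "cover t \<F> A" using assms by (simp add: covers_def)
  have "cross_intersecting t \<F> ?G"
    unfolding cross_intersecting_def
  proof (intro ballI)
    fix F G assume F: "F \<in> \<F>" and G: "G \<in> ?G"
    show "t \<le> card (F \<inter> G)"
    proof (cases "G \<in> \<G>")
      case True
      then show ?thesis using cross F by (simp add: cross_intersecting_def)
    next
      case False
      then have "A \<subseteq> G" using G by (simp add: star_def)
      then have "A \<inter> F \<subseteq> F \<inter> G" by blast
      moreover have "finite F" using F FU finite_U_member by blast
      ultimately have "card (A \<inter> F) \<le> card (F \<inter> G)" by (intro card_mono) auto
      then show ?thesis using cov F by (auto simp: cover_def)
    qed
  qed
  moreover have "?G \<subseteq> U c k k" using GU by (auto simp: star_def)
  moreover have "card (common_blocks c k ?G) < t"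
  proof -
    have "common_blocks c k ?G \<subseteq> common_blocks c k \<G>" by (auto simp: common_blocks_def)
    then have "card (common_blocks c k ?G) \<le> card (common_blocks c k \<G>)"
      by (intro card_mono) (auto simp: common_blocks_def)
    then show ?thesis using commonG by simp
  qed
  ultimately have "nontrivial_cross_pair c k t \<F> ?G"
    using FU commonF by (simp add: nontrivial_cross_pair_def)
  then have "card \<F> * card ?G \<le> card \<F> * card \<G>" by (rule maxi)
  then have "card ?G \<le> card \<G>" using product_pos by simp
  then have "\<G> = ?G" using finG by (intro card_seteq) auto
  then show ?thesis by blast
qed

text \<open>Each cover accounts for \<open>r * v\<close> members. In those containing no cover from
  \<open>\<A>\<close> the branching reaches depth \<open>t + 2\<close> from the \<open>t + 1\<close>
  subsets of a cover \<open>B\<close> of \<open>\<G>\<close>, which gives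
  \<open>(t + 1) * (m + 1) * m * v\<close>.\<close>

lemma card_G_le_covers: "card \<G> \<le> (card \<A> * r + d) * v"
proof -
  interpret sw: maximal_pair c k t m \<G> \<F> by (rule swap)
  obtain B where "B \<in> \<B>" using sw.A_ne by blast
  then have B: "B \<in> U c k (t + 1)" "cover t \<G> B" by (auto simp: covers_def)
  define \<G>' where "\<G>' = {G \<in> \<G>. \<forall>A\<in>\<A>. \<not> A \<subseteq> G}"
  have sub': "\<G>' \<subseteq> \<G>" by (auto simp: \<G>'_def)
  have "card \<G>' \<le> ((t + 1) choose t) * branch_bound c k t (t + 2)"
  proof (rule card_le_via_cover[OF c0 FU _ _ _ B(1)])
    show "\<G>' \<subseteq> U c k k" using sub' GU by blast
    show "cross_intersecting t \<F> \<G>'" using sub' cross by (auto simp: cross_intersecting_def)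
    show "cover t \<G>' B" using sub' B(2) by (auto simp: cover_def)
    fix G S assume G: "G \<in> \<G>'" and S: "S \<subseteq> G" "card S < t + 2"
    have "G \<in> U c k k" using G sub' GU by blast
    then have SU: "S \<in> U c k (card S)" using S(1) by (rule U_subset)
    show "\<not> cover t \<F> S"
    proof (cases "card S = t + 1")
      case True
      then have "S \<in> \<A>" if "cover t \<F> S" using that SU by (simp add: covers_def)
      then show ?thesis using G S(1) by (auto simp: \<G>'_def)
    next
      case False
      then show ?thesis using S(2) by (intro not_cover_small[OF SU]) simp
    qed
  qed simp
  also have "\<dots> = d * v"
    using k by (simp add: branch_bound_def v_def d_def numeral_2_eq_2 algebra_simps)
  finally have G': "card \<G>' \<le> d * v" .
  have finA: "finite \<A>" by (simp add: covers_def)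
  have "card (\<Union>A\<in>\<A>. star c k A) \<le> (\<Sum>A\<in>\<A>. card (star c k A))" by (rule card_UN_le[OF finA])
  also have "\<dots> = (\<Sum>A\<in>\<A>. r * v)"
    by (rule sum.cong) (auto simp: covers_def card_star[OF _ c0] k_diff npart_m)
  finally have U1: "card (\<Union>A\<in>\<A>. star c k A) \<le> card \<A> * (r * v)" by simp
  have "\<G> \<subseteq> (\<Union>A\<in>\<A>. star c k A) \<union> \<G>'"
  proof
    fix G assume G: "G \<in> \<G>"
    then have "G \<in> U c k k" using GU by blast
    then show "G \<in> (\<Union>A\<in>\<A>. star c k A) \<union> \<G>'" using G by (auto simp: \<G>'_def star_def)
  qed
  moreover have "finite \<G>'" using finG sub' finite_subset by blast
  ultimately have "card \<G> \<le> card ((\<Union>A\<in>\<A>. star c k A) \<union> \<G>')"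
    using finA by (intro card_mono) auto
  also have "\<dots> \<le> card (\<Union>A\<in>\<A>. star c k A) + card \<G>'" by (rule card_Un_le)
  also have "\<dots> \<le> (card \<A> * r + d) * v" using U1 G' by (simp add: algebra_simps)
  finally show ?thesis .
qed

text \<open>As \<open>r\<close> exceeds \<open>t + 1\<close>, some partition through
  \<open>B\<close> avoids all blocks of \<open>A - B\<close>. It belongs to \<open>\<F>\<close>, so
  \<open>A\<close> meets it in at least \<open>t\<close> blocks, and these lie in
  \<open>B\<close>.\<close>

lemma covers_cross:
  assumes A: "A \<in> \<A>" and B: "B \<in> \<B>"
  shows "t \<le> card (A \<inter> B)"
proof -
  interpret sw: maximal_pair c k t m \<G> \<F> by (rule swap)
  have BU: "B \<in> U c k (t + 1)" and AU: "A \<in> U c k (t + 1)" using A B by (auto simp: covers_def)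
  have fA: "finite A" "card A = t + 1" using AU finite_U_member card_U_member by auto
  have "card ((A - B) \<inter> compat c k B) * npart c (k - Suc (t + 1)) < npart c (k - (t + 1))"
  proof -
    have "card ((A - B) \<inter> compat c k B) \<le> card A" using fA by (intro card_mono) auto
    also have "\<dots> < r" using fA M_bounds r_bounds(1) by linarith
    finally show ?thesis using v_pos by (simp add: k_diff npart_m v_def)
  qed
  then obtain F where F: "F \<in> star c k B" "F \<inter> (A - B) = {}"
    using star_avoiding[OF BU c0, of "A - B"] fA by blast
  have "F \<in> \<F>" using F(1) sw.star_subset_G[OF B] by blast
  then have "t \<le> card (A \<inter> F)" using A by (simp add: covers_def cover_def)
  also have "\<dots> \<le> card (A \<inter> B)" using F(2) fA by (intro card_mono) auto
  finally show ?thesis .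
qed

text \<open>\<open>T\<close> falls short on \<open>F\<close>, so the single extra block of the cover
  must lie in \<open>F\<close> and make up a deficit of exactly one.\<close>

lemma cover_insert:
  assumes F: "F \<in> \<F>" "card (T \<inter> F) < t" and T: "T \<in> U c k t" and A: "A \<in> \<A>" "T \<subseteq> A"
  obtains a where "A = insert a T" "a \<in> F \<inter> compat c k T" "card (F \<inter> T) + 1 = t"
proof -
  have AU: "A \<in> U c k (t + 1)" using A by (simp add: covers_def)
  have fT: "finite T" "card T = t" using T finite_U_member card_U_member by auto
  have "card (A - T) = 1" using A(2) fT card_U_member[OF AU] by (simp add: card_Diff_subset)
  then obtain a where "A - T = {a}" by (meson card_1_singletonE)
  then have a: "A = insert a T" "a \<notin> T" using A(2) by auto
  have le: "t \<le> card (A \<inter> F)" using A(1) F(1) by (simp add: covers_def cover_def)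
  have aF: "a \<in> F"
  proof (rule ccontr)
    assume "a \<notin> F"
    then have "A \<inter> F = T \<inter> F" using a by blast
    then show False using le F(2) by simp
  qed
  have "A \<inter> F = insert a (T \<inter> F)" using a aF by blast
  then have "card (A \<inter> F) = Suc (card (T \<inter> F))" using a fT by simp
  then have "card (F \<inter> T) + 1 = t" using le F(2) by (simp add: Int_commute)
  moreover have "a \<in> compat c k T" using AU a(1) fT by (simp add: compat_def)
  ultimately show ?thesis using that a aF by blast
qed

lemma not_cover_obtain:
  assumes "T \<in> U c k t"
  obtains F where "F \<in> \<F>" "card (T \<inter> F) < t"
  using not_cover_small[OF assms] by (auto simp: cover_def not_le)

text \<open>\<open>T\<close> is no cover, so some \<open>F\<close> witnesses this. The covers
  through \<open>T\<close> arise by adding a block of \<open>F\<close> compatible with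
  \<open>T\<close>, and \<open>card_compat_less\<close> allows only \<open>m\<close> of
  these.\<close>

lemma covers_degree:
  assumes T: "card T = t"
  shows "card {A \<in> \<A>. T \<subseteq> A} \<le> m"
proof (cases "{A \<in> \<A>. T \<subseteq> A} = {}")
  case True
  then show ?thesis by (simp only: card.empty)
next
  case False
  then obtain A0 where A0: "A0 \<in> \<A>" "T \<subseteq> A0" by blast
  have "A0 \<in> U c k (t + 1)" using A0 by (simp add: covers_def)
  then have "T \<in> U c k (card T)" using A0(2) by (rule U_subset)
  then have TU: "T \<in> U c k t" using T by simp
  obtain F where F: "F \<in> \<F>" "card (T \<inter> F) < t" by (rule not_cover_obtain[OF TU])
  have FUk: "F \<in> U c k k" using F FU by blast
  obtain a where "card (F \<inter> T) + 1 = t" by (rule cover_insert[OF F TU A0])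
  then have "card (F \<inter> compat c k T) < k - t" by (rule card_compat_less[OF TU FUk c0])
  then have le: "card (F \<inter> compat c k T) \<le> m" using k by simp
  have fX: "finite (F \<inter> compat c k T)" using finite_U_member[OF FUk] by simp
  have "{A \<in> \<A>. T \<subseteq> A} \<subseteq> (\<lambda>a. insert a T) ` (F \<inter> compat c k T)"
  proof
    fix A assume "A \<in> {A \<in> \<A>. T \<subseteq> A}"
    then have A: "A \<in> \<A>" "T \<subseteq> A" by auto
    show "A \<in> (\<lambda>a. insert a T) ` (F \<inter> compat c k T)"
      by (rule cover_insert[OF F TU A]) (rule image_eqI)
  qed
  then have "card {A \<in> \<A>. T \<subseteq> A} \<le> card (F \<inter> compat c k T)"
    using fX by (rule surj_card_le[rotated])
  then show ?thesis using le by simp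
qed

lemma covers_cross_pair: "cross_pair \<A> \<B> t m"
proof
  show "finite \<A>" "finite \<B>" by (simp_all add: covers_def)
  show "\<And>A. A \<in> \<A> \<Longrightarrow> finite A" "\<And>A. A \<in> \<A> \<Longrightarrow> card A = t + 1"
    "\<And>A. A \<in> \<B> \<Longrightarrow> finite A" "\<And>A. A \<in> \<B> \<Longrightarrow> card A = t + 1"
    by (auto simp: covers_def finite_U_member card_U_member)
qed (use t A_ne maximal_pair.A_ne[OF swap] covers_cross covers_degree
      maximal_pair.covers_degree[OF swap] in auto)

lemma covers_many: "(max m (t + 2)) ^ 2 \<le> card \<A> * card \<B>"
proof (rule ccontr)
  interpret sw: maximal_pair c k t m \<G> \<F> by (rule swap)
  assume "\<not> ?thesis"
  then have lt: "card \<A> * card \<B> < M ^ 2" by (simp add: M_def)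
  interpret cross_pair \<A> \<B> t m by (rule covers_cross_pair)
  have ab: "1 \<le> card \<A>" "1 \<le> card \<B>" using fin ne by (auto simp: Suc_le_eq card_gt_0_iff)
  have F: "card \<F> \<le> (card \<B> * r + d) * v"
    using sw.card_G_le_covers by (simp add: sw.r_def sw.d_def sw.v_def r_def d_def v_def)
  obtain N C where NC: "N * N \<le> card \<F> * card \<G>" "M * r * v \<le> N + C * v" "2 * C \<le> M * (M - 1)"
    by (rule lower_bound)
  have "card \<G> * card \<F> < N * N"
    by (rule product_lt_of_cover_counts[OF card_G_le_covers F ab lt M_bounds(3) NC(3,2) v_pos r_bounds])
  then show False using NC(1) by (simp add: mult.commute)
qed

section \<open>Recovering the families from their covers\<close>

lemmas covers_classification =
  cross_pair.classification[OF covers_cross_pair covers_many]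

text \<open>A member \<open>G\<close> of \<open>\<G>\<close> contains some \<open>z\<close> of
  \<open>Z\<close> and at least \<open>t\<close> blocks of \<open>Z - {z}\<close>, which is a cover
  of \<open>\<G>\<close>; so \<open>t + 1\<close> in all. Conversely, partitions through a cover of
  \<open>\<F>\<close> lie in \<open>\<G>\<close>.\<close>

lemma G_eq_N2:
  assumes Z: "finite Z" "card Z = t + 2"
    and AZ: "\<A> = {A. A \<subseteq> Z \<and> card A = t + 1}" and BZ: "\<B> = {A. A \<subseteq> Z \<and> card A = t + 1}"
  shows "\<G> = N2 c k t Z"
proof
  show "\<G> \<subseteq> N2 c k t Z"
  proof
    fix G assume G: "G \<in> \<G>"
    have le: "t \<le> card ((Z - {z}) \<inter> G)" if "z \<in> Z" for z
    proof -
      have "Z - {z} \<in> \<B>" unfolding BZ using that Z by simp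
      then show ?thesis using G by (simp add: covers_def cover_def)
    qed
    have "Z \<noteq> {}" using Z by auto
    then obtain z0 where z0: "z0 \<in> Z" by blast
    have "(Z - {z0}) \<inter> G \<noteq> {}" using le[OF z0] t by (metis card.empty not_one_le_zero le_trans)
    then obtain z where z: "z \<in> Z" "z \<in> G" by blast
    have "G \<inter> Z = insert z ((Z - {z}) \<inter> G)" using z by blast
    then have "card (G \<inter> Z) = Suc (card ((Z - {z}) \<inter> G))" using Z by simp
    then have "t + 1 \<le> card (G \<inter> Z)" using le[OF z(1)] by simp
    moreover have "G \<in> U c k k" using G GU by blast
    ultimately show "G \<in> N2 c k t Z" by (simp add: N2_def)
  qed
  show "N2 c k t Z \<subseteq> \<G>"
  proof
    fix G assume "G \<in> N2 c k t Z"
    then have G: "G \<in> U c k k" "t + 1 \<le> card (G \<inter> Z)" by (auto simp: N2_def)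
    from G(2) obtain A where A: "A \<subseteq> G \<inter> Z" "card A = t + 1" by (metis obtain_subset_with_card_n)
    have "A \<in> \<A>" unfolding AZ using A by simp
    moreover have "G \<in> star c k A" using G A by (simp add: star_def)
    ultimately show "G \<in> \<G>" using star_subset_G by blast
  qed
qed

text \<open>\<open>Z\<close> has at least three blocks, so any two lie together in some
  \<open>Z - {z}\<close>, whose blocks are disjoint.\<close>

lemma triangle_U:
  assumes Z: "finite Z" "card Z = t + 2" and AZ: "\<A> = {A. A \<subseteq> Z \<and> card A = t + 1}"
  shows "Z \<in> U c k (t + 2)"
proof -
  have pairs: "x \<in> blocks c k \<and> (x \<noteq> y \<longrightarrow> x \<inter> y = {})" if "x \<in> Z" "y \<in> Z" for x y
  proof -
    have "card {x, y} \<le> 2" by (simp add: card_insert_if)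
    then have "\<not> Z \<subseteq> {x, y}" using Z(2) t card_mono[of "{x, y}" Z] by auto
    then obtain z where z: "z \<in> Z" "z \<noteq> x" "z \<noteq> y" by blast
    have "Z - {z} \<in> \<A>" unfolding AZ using z Z by simp
    then have "Z - {z} \<subseteq> blocks c k" "disjoint (Z - {z})" by (auto simp: covers_def U_def)
    moreover have "x \<in> Z - {z}" "y \<in> Z - {z}" using that z by auto
    ultimately show ?thesis by (auto dest: disjointD)
  qed
  have "disjoint Z" by (rule disjointI) (use pairs in blast)
  moreover have "Z \<subseteq> blocks c k" using pairs by blast
  ultimately show ?thesis using Z by (simp add: U_def)
qed

lemma G_eq_N3:
  assumes AX: "\<A> = {X1, X2, X3}"
    and tr: "\<And>G. G \<in> \<G> \<Longrightarrow> X1 \<subseteq> G \<or> X2 \<subseteq> G \<or> X3 \<subseteq> G"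
  shows "\<G> = N3 c k X1 X2 X3"
proof
  show "\<G> \<subseteq> N3 c k X1 X2 X3" using tr GU by (auto simp: N3_def)
  show "N3 c k X1 X2 X3 \<subseteq> \<G>"
  proof
    fix G assume "G \<in> N3 c k X1 X2 X3"
    then have "G \<in> star c k X1 \<or> G \<in> star c k X2 \<or> G \<in> star c k X3"
      by (auto simp: N3_def star_def)
    moreover have "star c k X1 \<subseteq> \<G>" "star c k X2 \<subseteq> \<G>" "star c k X3 \<subseteq> \<G>"
      using star_subset_G[of X1] star_subset_G[of X2] star_subset_G[of X3] AX by simp_all
    ultimately show "G \<in> \<G>" by blast
  qed
qed

lemma meets:
  assumes "t = 1" "B \<in> \<B>" "G \<in> \<G>"
  shows "B \<inter> G \<noteq> {}"
  using assms by (auto simp: covers_def cover_def)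

text \<open>\<open>\<A>\<close> attains the degree bound, so every block of \<open>F\<close>
  compatible with \<open>T\<close> gives a cover; \<open>L\<close> is \<open>T\<close> with these
  \<open>m\<close> blocks. A member of \<open>\<G>\<close> through \<open>T\<close> meets
  \<open>F\<close> in \<open>t\<close> blocks, one of which lies outside \<open>T\<close> and is
  compatible with it.\<close>

lemma sunflower_L:
  assumes T: "card T = t" "\<forall>A\<in>\<A>. T \<subseteq> A" and card_A: "card \<A> = m"
  obtains L where "L \<in> U c k (k - 1)" "T \<subseteq> L" "\<A> = (\<lambda>a. insert a T) ` (L - T)"
    "\<forall>G\<in>\<G>. T \<subseteq> G \<longrightarrow> G \<inter> (L - T) \<noteq> {}"
proof -
  obtain A0 where A0: "A0 \<in> \<A>" using A_ne by blast
  have "A0 \<in> U c k (t + 1)" using A0 by (simp add: covers_def)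
  moreover have "T \<subseteq> A0" using A0 T by blast
  ultimately have "T \<in> U c k (card T)" by (rule U_subset)
  then have TU: "T \<in> U c k t" using T by simp
  obtain F where F: "F \<in> \<F>" "card (T \<inter> F) < t" by (rule not_cover_obtain[OF TU])
  have FUk: "F \<in> U c k k" using F FU by blast
  let ?X = "F \<inter> compat c k T"
  obtain a where "card (F \<inter> T) + 1 = t" by (rule cover_insert[OF F TU A0 \<open>T \<subseteq> A0\<close>])
  then have "card ?X < k - t" by (rule card_compat_less[OF TU FUk c0])
  then have le: "card ?X \<le> m" using k by simp
  have fX: "finite ?X" using finite_U_member[OF FUk] by simp
  have sub: "\<A> \<subseteq> (\<lambda>a. insert a T) ` ?X"
  proof
    fix A assume A: "A \<in> \<A>"
    then have "T \<subseteq> A" using T by blast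
    show "A \<in> (\<lambda>a. insert a T) ` ?X"
      by (rule cover_insert[OF F TU A \<open>T \<subseteq> A\<close>]) (rule image_eqI)
  qed
  have cX: "card ?X = m" using surj_card_le[OF fX sub] card_A le by simp
  have eqA: "\<A> = (\<lambda>a. insert a T) ` ?X"
  proof (rule card_seteq[OF _ sub])
    show "card ((\<lambda>a. insert a T) ` ?X) \<le> card \<A>"
      using card_image_le[OF fX, of "\<lambda>a. insert a T"] cX card_A by simp
  qed (use fX in simp)
  let ?L = "T \<union> ?X"
  have "?L \<in> U c k (t + card ?X)" by (rule compat_Un[OF TU FUk c0])
  then have LU: "?L \<in> U c k (k - 1)" using cX k by simp
  have "e \<notin> T" if "e \<in> ?X" for e
    using that U_insertD(1)[OF _ TU] T(1) by (auto simp: compat_def)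
  then have LT: "?L - T = ?X" by blast
  show ?thesis
  proof (rule that[OF LU])
    show "\<A> = (\<lambda>a. insert a T) ` (?L - T)" unfolding LT by (rule eqA)
    show "\<forall>G\<in>\<G>. T \<subseteq> G \<longrightarrow> G \<inter> (?L - T) \<noteq> {}"
    proof (intro ballI impI)
      fix G assume G: "G \<in> \<G>" "T \<subseteq> G"
      have "t \<le> card (F \<inter> G)" using cross F G by (auto simp: cross_intersecting_def)
      then have "\<not> F \<inter> G \<subseteq> T \<inter> F"
        using F(2) card_mono[of "T \<inter> F" "F \<inter> G"] finite_U_member[OF TU] by auto
      then obtain e where e: "e \<in> F" "e \<in> G" "e \<notin> T" by blast
      have GUk: "G \<in> U c k k" using G GU by blast
      have "insert e T \<in> U c k (card (insert e T))" by (rule U_subset[OF GUk]) (use e G in blast)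
      then have "e \<in> compat c k T" using e finite_U_member[OF TU] by (simp add: compat_def)
      then show "G \<inter> (?L - T) \<noteq> {}" unfolding LT using e by blast
    qed
  qed blast
qed

text \<open>If \<open>G\<close> misses part of \<open>T\<close>, each cover
  \<open>insert b T\<close> of \<open>\<G>\<close> forces \<open>b\<close> into \<open>G\<close> and
  leaves just one block of \<open>T\<close> missing. So \<open>G\<close> has
  \<open>(t - 1) + m = k - 2\<close> blocks in \<open>K\<close>.\<close>

lemma sunflower_G_subset:
  assumes T: "card T = t" and L: "L \<in> U c k (k - 1)" "T \<subseteq> L"
    and hitL: "\<forall>G\<in>\<G>. T \<subseteq> G \<longrightarrow> G \<inter> (L - T) \<noteq> {}"
    and K: "K \<in> U c k (k - 1)" "T \<subseteq> K" and BK: "\<B> = (\<lambda>a. insert a T) ` (K - T)"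
  shows "\<G> \<subseteq> N1 c k t T L K"
proof
  fix G assume G: "G \<in> \<G>"
  have GUk: "G \<in> U c k k" using G GU by blast
  have fL: "finite L" using finite_U_member[OF L(1)] .
  have fK: "finite K" "card K = k - 1" using K finite_U_member card_U_member by auto
  have fT: "finite T" using L(2) fL finite_subset by blast
  show "G \<in> N1 c k t T L K"
  proof (cases "T \<subseteq> G")
    case True
    then have "G \<in> hit c k T (L - T)" using hitL G GUk by (simp add: hit_def star_def)
    then show ?thesis unfolding N1_split[OF fL L(2) T] by blast
  next
    case False
    have cKT: "card (K - T) = m" using fK fT K T k by (simp add: card_Diff_subset)
    have lt: "card (T \<inter> G) < t"
    proof -
      have "T \<inter> G \<subset> T" using False by blast
      then show ?thesis using psubset_card_mono[OF fT] T by blast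
    qed
    have each: "b \<in> G \<and> t \<le> card (T \<inter> G) + 1" if b: "b \<in> K - T" for b
    proof -
      have "insert b T \<in> \<B>" unfolding BK using b by blast
      then have le: "t \<le> card (insert b T \<inter> G)" using G by (simp add: covers_def cover_def)
      show ?thesis
      proof (cases "b \<in> G")
        case True
        then have "insert b T \<inter> G = insert b (T \<inter> G)" by blast
        then show ?thesis using le True b fT by simp
      next
        case False
        then have "insert b T \<inter> G = T \<inter> G" by blast
        then show ?thesis using le lt by simp
      qed
    qed
    have "K - T \<noteq> {}" using cKT m by (metis card.empty not_numeral_le_zero)
    then have ct: "card (T \<inter> G) + 1 = t" using each lt by fastforce
    have "G \<inter> K = (T \<inter> G) \<union> (K - T)" using each K(2) by blast
    then have "card (G \<inter> K) = card (T \<inter> G) + card (K - T)"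
      using fT fK by (subst card_Un_disjoint[symmetric]) auto
    then have "card (G \<inter> K) = k - 2" using ct cKT k by simp
    then show ?thesis using False GUk by (simp add: N1_def)
  qed
qed

text \<open>Besides \<open>z\<close>, at most two blocks of \<open>H\<close> are compatible with
  \<open>L - {z}\<close>. Hence at most three blocks are to be avoided, against at least 96
  completions.\<close>

lemma swap_member:
  assumes L: "L \<in> U c k (k - 1)" and z: "z \<in> L" and H: "H \<in> U c k j"
  obtains F where "F \<in> U c k k" "F \<inter> L = L - {z}" "F \<inter> (H - (L - {z})) = {}"
proof -
  let ?S = "L - {z}"
  have fL: "finite L" "card L = k - 1" using L finite_U_member card_U_member by auto
  have cS: "card ?S = k - 2" using fL z by simp
  have "?S \<in> U c k (card ?S)" by (rule U_subset[OF L]) blast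
  then have SU: "?S \<in> U c k (k - 2)" using cS by simp
  let ?E = "insert z (H - ?S)"
  have k2: "k - (k - 2) = 2" "k - Suc (k - 2) = 1" using k m by auto
  have fH: "finite H" using finite_U_member[OF H] .
  have "card (?E \<inter> compat c k ?S) \<le> card (insert z (H \<inter> compat c k ?S))"
    using fH by (intro card_mono) auto
  also have "\<dots> \<le> 3" using card_compat_le[OF SU H c0] fH by (simp add: card_insert_if k2)
  finally have "card (?E \<inter> compat c k ?S) * npart c (k - Suc (k - 2)) < npart c (k - (k - 2))"
    using npart_ge_96[OF c, of 2] by (simp add: k2)
  then obtain F where F: "F \<in> star c k ?S" "F \<inter> ?E = {}"
    using star_avoiding[OF SU c0, of ?E] fH by blast
  show ?thesis
  proof (rule that)
    show "F \<in> U c k k" using F(1) by (simp add: star_def)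
    have "?S \<subseteq> F" using F(1) by (simp add: star_def)
    then show "F \<inter> L = ?S" using F(2) by blast
    show "F \<inter> (H - ?S) = {}" using F(2) by blast
  qed
qed

text \<open>Both families lie in families of the same size \<open>n\<close>, and maximality against
  \<open>N1 c k t T L L\<close> forces equality. At \<open>k = 2 * t + 3\<close> with
  \<open>t\<close> at least 2 the product would be smaller than for \<open>N2\<close>.\<close>

lemma sunflower_N1:
  assumes T: "card T = t" "\<forall>A\<in>\<A> \<union> \<B>. T \<subseteq> A" and card_AB: "card \<A> = m" "card \<B> = m"
  shows "is_N1_pair c k t \<F> \<G>" "k = 2 * t + 3 \<Longrightarrow> t = 1"
proof -
  interpret sw: maximal_pair c k t m \<G> \<F> by (rule swap)
  have TA: "\<forall>A\<in>\<A>. T \<subseteq> A" and TB: "\<forall>A\<in>\<B>. T \<subseteq> A" using T(2) by auto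
  obtain L where L: "L \<in> U c k (k - 1)" "T \<subseteq> L" "\<A> = (\<lambda>a. insert a T) ` (L - T)"
    "\<forall>G\<in>\<G>. T \<subseteq> G \<longrightarrow> G \<inter> (L - T) \<noteq> {}"
    by (rule sunflower_L[OF T(1) TA card_AB(1)])
  obtain K where K: "K \<in> U c k (k - 1)" "T \<subseteq> K" "\<B> = (\<lambda>a. insert a T) ` (K - T)"
    "\<forall>G\<in>\<F>. T \<subseteq> G \<longrightarrow> G \<inter> (K - T) \<noteq> {}"
    by (rule sw.sunflower_L[OF T(1) TB card_AB(2)])
  have subG: "\<G> \<subseteq> N1 c k t T L K"
    by (rule sunflower_G_subset[OF T(1) L(1,2,4) K(1-3)])
  have subF: "\<F> \<subseteq> N1 c k t T K L"
    by (rule sw.sunflower_G_subset[OF T(1) K(1,2,4) L(1-3)])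
  have k2: "2 \<le> k" "t + m + 1 = k" and k3: "t + 3 \<le> k" using k m by auto
  define n where "n = card (N1 c k t T L L)"
  have cn: "card (N1 c k t T L K) = n" "card (N1 c k t T K L) = n"
  proof -
    have "int (card (N1 c k t T L K)) = int n" "int (card (N1 c k t T K L)) = int n"
      unfolding n_def card_N1[OF c0 k2 L(1) L(1) L(2) L(2) T(1)]
        card_N1[OF c0 k2 L(1) K(1) L(2) K(2) T(1)] card_N1[OF c0 k2 K(1) L(1) K(2) L(2) T(1)]
      by (rule refl)+
    then show "card (N1 c k t T L K) = n" "card (N1 c k t T K L) = n" by simp_all
  qed
  have fin: "finite (N1 c k t T L K)" "finite (N1 c k t T K L)" by (auto simp: N1_def)
  have leF: "card \<F> \<le> n" using card_mono[OF fin(2) subF] cn by simp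
  have leG: "card \<G> \<le> n" using card_mono[OF fin(1) subG] cn by simp
  have ge: "n * n \<le> card \<F> * card \<G>"
    unfolding n_def by (rule maxi[OF N1_nontrivial[OF c t k3 L(1,2) T(1)]])
  have n0: "0 < n" using leF product_pos by (cases n) auto
  have "n \<le> card \<F>"
  proof -
    have "card \<F> * card \<G> \<le> card \<F> * n" using leG by simp
    then have "n * n \<le> card \<F> * n" using ge by (rule order_trans[rotated])
    then show ?thesis using n0 by simp
  qed
  then have eqF: "\<F> = N1 c k t T K L" using subF fin cn by (intro card_seteq) auto
  have "n \<le> card \<G>"
  proof -
    have "card \<F> * card \<G> \<le> n * card \<G>" using leF by simp
    then have "n * n \<le> n * card \<G>" using ge by (rule order_trans[rotated])
    then show ?thesis using n0 by simp
  qed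
  then have eqG: "\<G> = N1 c k t T L K" using subG fin cn by (intro card_seteq) auto
  have TU: "T \<in> U c k t" using U_subset[OF L(1,2)] T(1) by simp
  have fL: "finite L" "card L = k - 1" using L finite_U_member card_U_member by auto
  have fK: "finite K" "card K = k - 1" using K finite_U_member card_U_member by auto
  have "t + min t 2 \<le> card (K \<inter> L)"
  proof -
    \<comment> \<open>For \<open>t = 1\<close> both are the only block of \<open>T\<close>;
      otherwise they are distinct, which is the source of \<open>min t 2\<close>.\<close>
    obtain z z' where z: "z \<in> T" "z' \<in> T" "card {z, z'} = min t 2"
    proof (cases "t = 1")
      case True
      then obtain z where "T = {z}" using T(1) by (metis card_1_singletonE)
      then show ?thesis using that[of z z] True by simp
    next
      case False
      then have "2 \<le> card T" using T(1) t by simp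
      then obtain P where P: "P \<subseteq> T" "card P = 2" by (metis obtain_subset_with_card_n)
      then obtain z z' where "P = {z, z'}" "z \<noteq> z'" by (meson card_2_iff)
      then show ?thesis using that[of z z'] P False t by simp
    qed
    have zL: "z \<in> L" "z' \<in> L" "z \<in> K" "z' \<in> K" using z L(2) K(2) by auto
    \<comment> \<open>\<open>G\<close> and \<open>F\<close> swap out \<open>z'\<close> and
      \<open>z\<close> and otherwise avoid coincidences. Their common blocks lie in \<open>K\<close>
      and \<open>L\<close> but are neither \<open>z\<close> nor \<open>z'\<close>, so
      \<open>t\<close> common blocks force the bound on the intersection.\<close>
    obtain G where G: "G \<in> U c k k" "G \<inter> K = K - {z'}" "G \<inter> (L - (K - {z'})) = {}"
      by (rule swap_member[OF K(1) zL(4) L(1)])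
    obtain F where F: "F \<in> U c k k" "F \<inter> L = L - {z}" "F \<inter> (G - (L - {z})) = {}"
      by (rule swap_member[OF L(1) zL(1) G(1)])
    have "card (K - {z'}) = k - 2" using fK zL by simp
    moreover have "\<not> T \<subseteq> G" using G(2) z(2) zL by blast
    ultimately have "G \<in> \<G>" unfolding eqG N1_def using G by simp
    have "card (L - {z}) = k - 2" using fL zL by simp
    moreover have "\<not> T \<subseteq> F" using F(2) z(1) zL by blast
    ultimately have "F \<in> \<F>" unfolding eqF N1_def using F by simp
    have "F \<inter> G \<subseteq> (K \<inter> L) - {z, z'}"
    proof
      fix e assume e: "e \<in> F \<inter> G"
      then have eL: "e \<in> L - {z}" using F(3) by blast
      then have "e \<in> K - {z'}" using G(3) e by blast
      then show "e \<in> (K \<inter> L) - {z, z'}" using eL by blast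
    qed
    then have "card (F \<inter> G) \<le> card ((K \<inter> L) - {z, z'})" using fK by (intro card_mono) auto
    also have "\<dots> = card (K \<inter> L) - min t 2"
      using zL z(3) by (subst card_Diff_subset) auto
    finally have "card (F \<inter> G) \<le> card (K \<inter> L) - min t 2" .
    moreover have "t \<le> card (F \<inter> G)"
      using cross \<open>F \<in> \<F>\<close> \<open>G \<in> \<G>\<close> by (simp add: cross_intersecting_def)
    ultimately show ?thesis using t by linarith
  qed
  moreover have "T \<subseteq> K \<inter> L" using K(2) L(2) by blast
  ultimately show "is_N1_pair c k t \<F> \<G>"
    unfolding is_N1_pair_def using TU K(1) L(1) eqF eqG by blast
  show "t = 1" if "k = 2 * t + 3"
  proof (rule ccontr)
    assume "t \<noteq> 1"
    then have t2: "2 \<le> t" using t by simp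
    have "t + 2 \<le> k" using k3 by simp
    then obtain Z where Z: "Z \<in> U c k (t + 2)" by (rule ex_U[OF c0])
    have lt: "n < card (N2 c k t Z)"
      unfolding n_def by (rule card_N1_less_N2[OF c t2 that L(1) L(1) L(2) L(2) T(1) Z])
    have "card (N2 c k t Z) * card (N2 c k t Z) \<le> card \<F> * card \<G>"
      by (rule maxi[OF N2_nontrivial[OF c t k3 Z]])
    also have "\<dots> \<le> n * n" using leF leG by (rule mult_le_mono)
    also have "\<dots> < card (N2 c k t Z) * card (N2 c k t Z)"
      using lt by (intro mult_strict_mono) auto
    finally show False by simp
  qed
qed

lemma triangle_N2:
  assumes Z: "finite Z" "card Z = t + 2"
    and AZ: "\<A> = {A. A \<subseteq> Z \<and> card A = t + 1}" and BZ: "\<B> = {A. A \<subseteq> Z \<and> card A = t + 1}"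
  shows "is_N2_pair c k t \<F> \<G>"
  unfolding is_N2_pair_def
proof (intro bexI conjI)
  show "\<F> = N2 c k t Z" by (rule maximal_pair.G_eq_N2[OF swap Z BZ AZ])
  show "\<G> = N2 c k t Z" by (rule G_eq_N2[OF Z AZ BZ])
  show "Z \<in> U c k (t + 2)" by (rule triangle_U[OF Z AZ])
qed

text \<open>For \<open>t = 1\<close> every member of \<open>\<G>\<close> meets all three edges of
  the path \<open>y1, x1, y2, x2\<close> formed by \<open>\<B>\<close>. The minimal vertex covers of
  this path are exactly the edges in \<open>\<A>\<close>; the same holds with the roles
  exchanged.\<close>

lemma path_N3:
  assumes t1: "t = 1"
    and A: "\<A> = {{x1, x2}, {x1, y2}, {y1, y2}}" and B: "\<B> = {{x1, y1}, {x2, y2}, {x1, y2}}"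
  shows "is_N3_pair c k \<F> \<G>"
proof -
  have inA: "{x1, x2} \<in> \<A>" "{x1, y2} \<in> \<A>" "{y1, y2} \<in> \<A>" by (simp_all add: A)
  have inB: "{x1, y1} \<in> \<B>" "{x2, y2} \<in> \<B>" "{x1, y2} \<in> \<B>" by (simp_all add: B)
  have G: "\<G> = N3 c k {x1, x2} {y1, y2} {x1, y2}"
  proof (rule G_eq_N3)
    show "\<A> = {{x1, x2}, {y1, y2}, {x1, y2}}" unfolding A by (rule arg_cong[OF insert_commute])
    fix G assume G: "G \<in> \<G>"
    show "{x1, x2} \<subseteq> G \<or> {y1, y2} \<subseteq> G \<or> {x1, y2} \<subseteq> G"
      using meets[OF t1 inB(1) G] meets[OF t1 inB(2) G] meets[OF t1 inB(3) G] by auto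
  qed
  have F: "\<F> = N3 c k {x1, y1} {x2, y2} {x1, y2}"
  proof (rule maximal_pair.G_eq_N3[OF swap B])
    fix F assume F: "F \<in> \<F>"
    note meets' = maximal_pair.meets[OF swap t1 _ F]
    show "{x1, y1} \<subseteq> F \<or> {x2, y2} \<subseteq> F \<or> {x1, y2} \<subseteq> F"
      using meets'[OF inA(1)] meets'[OF inA(2)] meets'[OF inA(3)] by auto
  qed
  have mem: "{x1, y1} \<in> U c k 2" "{x2, y2} \<in> U c k 2" "{x1, x2} \<in> U c k 2"
      "{y1, y2} \<in> U c k 2" "{x1, y2} \<in> U c k 2"
    using inA inB t1 by (simp_all add: covers_def numeral_2_eq_2)
  show ?thesis
    unfolding is_N3_pair_def
    by (intro exI[of _ x1] exI[of _ y1] exI[of _ x2] exI[of _ y2] conjI mem F G)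
qed

lemma trichotomy:
  "(is_N1_pair c k t \<F> \<G> \<and> 2 * t + 3 \<le> k \<and> (k = 2 * t + 3 \<longrightarrow> t = 1)) \<or>
   (is_N2_pair c k t \<F> \<G> \<and> k \<le> 2 * t + 3) \<or>
   (is_N3_pair c k \<F> \<G> \<and> t = 1 \<and> k \<le> 5)"
  using covers_classification
proof (elim disjE conjE exE)
  fix T assume "t + 2 \<le> m" and T: "card \<A> = m" "card \<B> = m" "card T = t" "\<forall>A\<in>\<A> \<union> \<B>. T \<subseteq> A"
  then have "2 * t + 3 \<le> k" using k by simp
  then show ?thesis using sunflower_N1[OF T(3,4,1,2)] by simp
next
  fix Z assume "m \<le> t + 2" and Z: "finite Z" "card Z = t + 2"
    "\<A> = {A. A \<subseteq> Z \<and> card A = t + 1}" "\<B> = {A. A \<subseteq> Z \<and> card A = t + 1}"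
  then have "k \<le> 2 * t + 3" using k by simp
  then show ?thesis using triangle_N2[OF Z] by simp
next
  fix x1 x2 y1 y2 assume t1: "t = 1" and "m \<le> 3"
    and AB: "\<A> = {{x1, x2}, {x1, y2}, {y1, y2}}" "\<B> = {{x1, y1}, {x2, y2}, {x1, y2}}"
  then have "k \<le> 5" using k by simp
  then show ?thesis using path_N3[OF t1 AB] t1 by simp
qed

end

theorem theorem1p2:
  fixes c k t :: nat and \<F> \<G> :: "nat set set set"
  assumes "1 \<le> t" and "6 \<le> c" and "t + 3 \<le> k"
    and "nontrivial_cross_pair c k t \<F> \<G>"
    and "4 * log 2 (real t) + 7 \<le> real c \<or> 2 * t + 3 \<le> k"
    and "\<forall>\<F>' \<G>'. nontrivial_cross_pair c k t \<F>' \<G>' \<longrightarrow>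
           card \<F>' * card \<G>' \<le> card \<F> * card \<G>"
  shows "(is_N1_pair c k t \<F> \<G> \<or> is_N2_pair c k t \<F> \<G> \<or> is_N3_pair c k \<F> \<G>) \<and>
    ((k, t) \<in> {(4, 1), (5, 1)} \<longrightarrow>
       is_N1_pair c k t \<F> \<G> \<or> is_N2_pair c k t \<F> \<G> \<or> is_N3_pair c k \<F> \<G>) \<and>
    (k = t + 3 \<and> 2 \<le> t \<longrightarrow> is_N1_pair c k t \<F> \<G> \<or> is_N2_pair c k t \<F> \<G>) \<and>
    (t + 4 \<le> k \<and> k \<le> 2 * t + 3 \<and> (k, t) \<noteq> (5, 1) \<longrightarrow> is_N2_pair c k t \<F> \<G>) \<and>
    (2 * t + 4 \<le> k \<longrightarrow> is_N1_pair c k t \<F> \<G>)"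
proof -
  \<comment> \<open>Here \<open>m\<close> is \<open>k - t - 1\<close>, so \<open>m\<close> compared
    with \<open>t + 2\<close> is \<open>k\<close> compared with \<open>2 * t + 3\<close>.\<close>
  interpret maximal_pair c k t "k - t - 1" \<F> \<G>
    by unfold_locales (use assms pow4_le_of_log in auto)
  show ?thesis using trichotomy assms(1,3) by auto
qed

end
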